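(* Fix $p\ge3$ and let $(\beta,h)\in\Theta$ be $p$-critical, with $\beta$ known and $\bm X\sim\mathbb P_{\beta,h,p}$. Let $m_1<\dots<m_K$ ($K\in\{2,3\}$) be the global maximizers of $H=H_{\beta,h,p}$ and $p_k=[(m_k^2-1)H''(m_k)]^{-1/2}/\sum_{i=1}^K[(m_i^2-1)H''(m_i)]^{-1/2}$. Then, as $N\to\infty$, in distribution: (1) If $p$ is odd, then $K=2$ and $N^{1/2}(\hat h_N-h)\to\frac{p_1}{2}N^-(0,-H''(m_1))+\frac{1-p_1}{2}N^+(0,-H''(m_2))+\frac12\delta_0$. (2) If $p\ge4$ is even: (a) if $h\ne0$, then $K=2$ and $N^{1/2}(\hat h_N-h)\to\frac{p_1}{2}N^-(0,-H''(m_1))+\frac{1-p_1}{2}N^+(0,-H''(m_2))+\frac12\delta_0$; (b) if $h=0$ and $\beta>\tilde\beta_p$, then $K=2$, $m_2=-m_1=m_*>0$, and $N^{1/2}\hat h_N\to\frac12N(0,-H''(m_* ))+\frac12\delta_0$; (c) if $h=0$ and $\beta=\tilde\beta_p$, then $K=3$ with maximizers $-m_*,0,m_*$ ($m_*>0$) and $N^{1/2}\hat h_N\to p_1N(0,-H''(m_1))+(1-p_1)\delta_0$.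
   Context: The $p$-tensor Curie–Weiss model on $\{-1,1\}^N$: $\mathbb P_{\beta,h,p}(\bm X)=\frac{1}{2^NZ_N(\beta,h,p)}\exp\{N(\beta\bar X_N^p+h\bar X_N)\}$ with $\bar X_N=N^{-1}\sum_iX_i$, $(\beta,h)\in\mathbb R^2$; $\Theta=[0,\infty)\times\mathbb R$. $I(x)=\frac12[(1+x)\log(1+x)+(1-x)\log(1-x)]$, $H_{\beta,h,p}(x)=\beta x^p+hx-I(x)$ on $[-1,1]$. $(\beta,h)$ is $p$-critical if $H_{\beta,h,p}$ has more than one global maximizer (points $m$ with $H(m)=\sup_{[-1,1]}H$); these lie in $(-1,1)$ and have $H''<0$. $\tilde\beta_p=\sup\{\beta\ge0:\sup_{x\in[-1,1]}H_{\beta,0,p}(x)=0\}$. $\hat h_N$ (for known $\beta$) is the maximum likelihood estimate of $h$, the solution in $h$ of $\mathbb E_{\beta,h,p}(\bar X_N)=\bar X_N$. $N^+(0,\sigma^2)$ is the law of $|Z|$ and $N^-(0,\sigma^2)$ the law of $-|Z|$ for $Z\sim N(0,\sigma^2)$; $\delta_0$ is the point mass at $0$; sums denote mixtures. *)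

theory Defs
  imports "HOL-Probability.Probability"
begin

definition cfgs :: "nat \<Rightarrow> (nat \<Rightarrow> real) set" where
  "cfgs N = PiE {..<N} (\<lambda>_. {-1, 1})"

definition mean :: "nat \<Rightarrow> (nat \<Rightarrow> real) \<Rightarrow> real" where
  "mean N x = (\<Sum>i<N. x i) / real N"

definition CW_weight :: "real \<Rightarrow> real \<Rightarrow> nat \<Rightarrow> nat \<Rightarrow> (nat \<Rightarrow> real) \<Rightarrow> real" where
  "CW_weight \<beta> h p N x = exp (real N * (\<beta> * mean N x ^ p + h * mean N x))"

definition CW_Z :: "real \<Rightarrow> real \<Rightarrow> nat \<Rightarrow> nat \<Rightarrow> real" where
  "CW_Z \<beta> h p N = (\<Sum>x\<in>cfgs N. CW_weight \<beta> h p N x) / 2 ^ N"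

definition CW_prob :: "real \<Rightarrow> real \<Rightarrow> nat \<Rightarrow> nat \<Rightarrow> (nat \<Rightarrow> real) \<Rightarrow> real" where
  "CW_prob \<beta> h p N x = CW_weight \<beta> h p N x / (2 ^ N * CW_Z \<beta> h p N)"

definition CW_measure :: "real \<Rightarrow> real \<Rightarrow> nat \<Rightarrow> nat \<Rightarrow> (nat \<Rightarrow> real) measure" where
  "CW_measure \<beta> h p N = point_measure (cfgs N) (\<lambda>x. ennreal (CW_prob \<beta> h p N x))"

definition CW_expect_mean :: "real \<Rightarrow> real \<Rightarrow> nat \<Rightarrow> nat \<Rightarrow> real" where
  "CW_expect_mean \<beta> h p N = (\<integral>x. mean N x \<partial>CW_measure \<beta> h p N)"

text \<open>Maximum likelihood estimate of h (beta known): the solution in h of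
  E_{beta,h,p}(bar X_N) = bar X_N (unspecified if no solution exists).\<close>
definition hhat :: "real \<Rightarrow> nat \<Rightarrow> nat \<Rightarrow> (nat \<Rightarrow> real) \<Rightarrow> real" where
  "hhat \<beta> p N x = (THE h. CW_expect_mean \<beta> h p N = mean N x)"

definition hhat_law :: "real \<Rightarrow> real \<Rightarrow> nat \<Rightarrow> nat \<Rightarrow> real measure" where
  "hhat_law \<beta> h p N =
     distr (CW_measure \<beta> h p N) borel (\<lambda>x. sqrt (real N) * (hhat \<beta> p N x - h))"

definition I_fun :: "real \<Rightarrow> real" where
  "I_fun x = ((1 + x) * ln (1 + x) + (1 - x) * ln (1 - x)) / 2"

definition H :: "real \<Rightarrow> real \<Rightarrow> nat \<Rightarrow> real \<Rightarrow> real" where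
  "H \<beta> h p x = \<beta> * x ^ p + h * x - I_fun x"

definition global_maximizers :: "real \<Rightarrow> real \<Rightarrow> nat \<Rightarrow> real set" where
  "global_maximizers \<beta> h p =
     {m \<in> {-1..1}. \<forall>y\<in>{-1..1}. H \<beta> h p y \<le> H \<beta> h p m}"

definition p_critical :: "nat \<Rightarrow> real \<Rightarrow> real \<Rightarrow> bool" where
  "p_critical p \<beta> h \<longleftrightarrow> (\<exists>m1 m2. m1 \<noteq> m2 \<and>
      m1 \<in> global_maximizers \<beta> h p \<and> m2 \<in> global_maximizers \<beta> h p)"

definition beta_tilde :: "nat \<Rightarrow> real" where
  "beta_tilde p = Sup {\<beta>. \<beta> \<ge> 0 \<and> (SUP x\<in>{-1..1}. H \<beta> 0 p x) = 0}"

definition H2 :: "real \<Rightarrow> real \<Rightarrow> nat \<Rightarrow> real \<Rightarrow> real" where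
  "H2 \<beta> h p = deriv (deriv (H \<beta> h p))"

definition mweight :: "real \<Rightarrow> real \<Rightarrow> nat \<Rightarrow> real \<Rightarrow> real" where
  "mweight \<beta> h p m = ((m\<^sup>2 - 1) * H2 \<beta> h p m) powr (-1/2)"

definition normal_law :: "real \<Rightarrow> real measure" where
  "normal_law s2 = density lborel (normal_density 0 (sqrt s2))"

definition normal_plus :: "real \<Rightarrow> real measure" where
  "normal_plus s2 = distr (normal_law s2) borel (\<lambda>z. \<bar>z\<bar>)"

definition normal_minus :: "real \<Rightarrow> real measure" where
  "normal_minus s2 = distr (normal_law s2) borel (\<lambda>z. - \<bar>z\<bar>)"

definition dirac0 :: "real measure" where
  "dirac0 = return borel 0"

definition mixture :: "(real \<times> real measure) list \<Rightarrow> real measure" where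
  "mixture ws = measure_of UNIV (sets borel)
      (\<lambda>A. (\<Sum>(w, M)\<leftarrow>ws. ennreal w * emeasure M A))"

end

(*
  The likelihood equation is monotone in h, so the event sqrt N (hhat - h) <= t says that the mean
  magnetization is at most u_N(t), its expectation under the field h + t / sqrt N. For t < 0 this
  small tilt moves all the mass to the smallest maximizer m_1, for t > 0 to the largest one m_K, and
  the expectation is m + t / (- N^(1/2) H''(m)) up to o(N^(-1/2)). On the other hand, under the field h
  the mean lies near each m_k with probability p_k and has Gaussian fluctuations of variance
  - 1 / H''(m_k) there. Hence the distribution functions converge at every t other than 0, where
  the limit has an atom. Both asymptotics are instances of one Laplace expansion of sums over the grid
  of magnetizations.
*)
theory Submission
  imports Defs
begin

section \<open>Stirling asymptotics of the binomial weights\<close>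

text \<open>The atom comes from the coexistence of maximizers. While the field runs through a window
  of size o(N^(-1/2)) around h, the expected mean sweeps the whole gap between m_1 and m_K. Every
  observed mean inside that gap therefore gives an estimate within o(N^(-1/2)) of h. Only the outer
  halves of the fluctuations, below m_1 and above m_K, stay visible in the scale N^(-1/2); hence the
  half-normal laws and the factors 1/2. The window itself is never analysed: the limits for t < 0
  and for t > 0 determine the mixture. The variance -H'' arises because a deviation y / sqrt N of
  the mean from an extreme maximizer corresponds to a field shift of -H'' y / sqrt N, and y has
  variance -1 / H''. The Laplace expansion has to serve both the tilt exp (t sqrt N (x - m)) and the
  indicator of a moving threshold. For this reason its test functions may grow exponentially in the
  scale y = sqrt N (x - m) and need to converge only for almost every y.\<close>

definition stirling_ratio :: "nat \<Rightarrow> real" where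
  "stirling_ratio n = fact n / (sqrt (real n) * exp (real n * ln (real n) - real n))"

text \<open>This bound and the next agree with \<open>ln (1 + x)\<close> to second order at 0, which
  is the precision that makes the steps of \<open>stirling_ratio\<close> summable. Each difference
  has a derivative with a square in the numerator.\<close>

lemma ln_add_one_ge_Pade:
  fixes x :: real assumes "x \<ge> 0" shows "2 * x / (2 + x) \<le> ln (1 + x)"
proof -
  have "(\<lambda>x. ln (1 + x) - 2 * x / (2 + x)) 0 \<le> (\<lambda>x. ln (1 + x) - 2 * x / (2 + x)) x"
  proof (rule DERIV_nonneg_imp_nondecreasing[OF assms])
    fix y :: real assume y: "0 \<le> y" "y \<le> x"
    have "((\<lambda>x. ln (1 + x) - 2 * x / (2 + x)) has_real_derivative
        y\<^sup>2 / ((1 + y) * (2 + y)\<^sup>2)) (at y)"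
      using y by (auto intro!: derivative_eq_intros)
        (simp_all add: divide_simps power2_eq_square, simp_all add: algebra_simps)
    then show "\<exists>z. ((\<lambda>x. ln (1 + x) - 2 * x / (2 + x)) has_real_derivative z) (at y) \<and> 0 \<le> z"
      using y by (intro exI[of _ "y\<^sup>2 / ((1 + y) * (2 + y)\<^sup>2)"] conjI) auto
  qed
  then show ?thesis by simp
qed

lemma ln_add_one_le_Pade:
  fixes x :: real assumes "x \<ge> 0" shows "ln (1 + x) \<le> x * (2 + x) / (2 * (1 + x))"
proof -
  let ?f = "\<lambda>x::real. x * (2 + x) / (2 * (1 + x)) - ln (1 + x)"
  have "?f 0 \<le> ?f x"
  proof (rule DERIV_nonneg_imp_nondecreasing[OF assms])
    fix y :: real assume y: "0 \<le> y" "y \<le> x"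
    have "(?f has_real_derivative y\<^sup>2 / (2 * (1 + y)\<^sup>2)) (at y)"
      using y by (auto intro!: derivative_eq_intros)
        (simp_all add: divide_simps power2_eq_square, simp_all add: algebra_simps)
    then show "\<exists>z. (?f has_real_derivative z) (at y) \<and> 0 \<le> z"
      using y by (intro exI[of _ "y\<^sup>2 / (2 * (1 + y)\<^sup>2)"] conjI) auto
  qed
  then show ?thesis by simp
qed

lemma ln_stirling_ratio:
  assumes "n > 0"
  shows "ln (stirling_ratio n) = ln (fact n) + real n - (real n + 1/2) * ln (real n)"
  using assms
  by (simp add: stirling_ratio_def ln_div ln_mult ln_sqrt algebra_simps)

text \<open>With x = 1/n the difference is (1/x + 1/2) ln (1 + x) - 1. The lower Pade bound makes it
  nonnegative, the upper one bounds it by a telescoping term.\<close>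

lemma ln_stirling_ratio_step:
  assumes "n > 0"
  shows "0 \<le> ln (stirling_ratio n) - ln (stirling_ratio (Suc n))"
    and "ln (stirling_ratio n) - ln (stirling_ratio (Suc n)) \<le> 1 / (4 * real n) - 1 / (4 * real (Suc n))"
proof -
  define x where "x = 1 / real n"
  have x: "x > 0" using assms by (simp add: x_def)
  have l: "ln (real (Suc n)) = ln (real n) + ln (1 + x)"
  proof -
    have "real (Suc n) = real n * (1 + x)" using assms by (simp add: x_def field_simps)
    then show ?thesis using assms x by (simp only:) (simp add: ln_mult)
  qed
  have n: "real n = 1 / x" by (simp add: x_def)
  have f: "ln (fact (Suc n) :: real) = ln (real (Suc n)) + ln (fact n)"
    by (simp add: ln_mult del: of_nat_Suc)
  have eq: "ln (stirling_ratio n) - ln (stirling_ratio (Suc n)) = (1 / x + 1/2) * ln (1 + x) - 1"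
    using assms unfolding ln_stirling_ratio[OF assms] ln_stirling_ratio[OF zero_less_Suc] f l
    by (simp add: n[symmetric] algebra_simps)
  have nz: "x * 4 + x * (x * 2) > 0" using x by (intro add_pos_pos mult_pos_pos) auto
  then have "1 = (1 / x + 1/2) * (2 * x / (2 + x))" using x by (simp add: field_simps)
  also have "\<dots> \<le> (1 / x + 1/2) * ln (1 + x)"
    using x ln_add_one_ge_Pade[of x] by (intro mult_left_mono) auto
  finally show "0 \<le> ln (stirling_ratio n) - ln (stirling_ratio (Suc n))" using eq by simp
  have "(1 / x + 1/2) * ln (1 + x) \<le> (1 / x + 1/2) * (x * (2 + x) / (2 * (1 + x)))"
    using x ln_add_one_le_Pade[of x] by (intro mult_left_mono) auto
  also have "\<dots> - 1 = 1 / (4 * real n) - 1 / (4 * real (Suc n))"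
  proof -
    have *: "1 / (4 * real n) = x / 4" "1 / (4 * real (Suc n)) = x / (4 * (1 + x))"
      using assms by (simp_all add: x_def field_simps)
    show ?thesis unfolding * using x by (simp add: divide_simps) (simp add: algebra_simps)
  qed
  finally show "ln (stirling_ratio n) - ln (stirling_ratio (Suc n)) \<le> 1 / (4 * real n) - 1 / (4 * real (Suc n))"
    using eq by simp
qed

lemma stirling_ratio_pos: "n > 0 \<Longrightarrow> stirling_ratio n > 0"
  by (simp add: stirling_ratio_def)

text \<open>The logarithm decreases, while subtracting 1/(4n) from it gives an increasing sequence,
  so it is bounded below. The bounds by the limit and by the value at 1 later dominate the
  prefactors uniformly in \<open>N\<close>.\<close>

lemma stirling_ratio_limit:
  obtains C where "C > 0" "stirling_ratio \<longlonglongrightarrow> C"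
    "\<And>n. n > 0 \<Longrightarrow> C \<le> stirling_ratio n" "\<And>n. n > 0 \<Longrightarrow> stirling_ratio n \<le> stirling_ratio 1"
proof -
  define L where "L n = ln (stirling_ratio (Suc n))" for n
  have dec: "decseq L" unfolding L_def
    by (rule decseq_SucI) (use ln_stirling_ratio_step(1)[of "Suc _"] in force)
  have inc: "incseq (\<lambda>n. L n - 1 / (4 * real (Suc n)))" unfolding L_def
  proof (rule incseq_SucI)
    fix n show "ln (stirling_ratio (Suc n)) - 1 / (4 * real (Suc n))
      \<le> ln (stirling_ratio (Suc (Suc n))) - 1 / (4 * real (Suc (Suc n)))"
      using ln_stirling_ratio_step(2)[of "Suc n"] by linarith
  qed
  have lb: "L 0 - 1/4 \<le> L n" for n
    using incseqD[OF inc, of 0 n] by (simp add: L_def) (smt (verit) divide_nonneg_nonneg of_nat_0_le_iff)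
  obtain l where l: "L \<longlonglongrightarrow> l" "\<And>n. l \<le> L n"
    using decseq_convergent[OF dec, of "L 0 - 1/4"] lb by blast
  have "(\<lambda>n. exp (L n)) \<longlonglongrightarrow> exp l" by (intro tendsto_intros l)
  then have "(\<lambda>n. stirling_ratio (Suc n)) \<longlonglongrightarrow> exp l"
    by (simp add: L_def stirling_ratio_pos)
  then have lim: "stirling_ratio \<longlonglongrightarrow> exp l" by (rule LIMSEQ_imp_Suc)
  have e: "stirling_ratio n = exp (L (n - 1))" if "n > 0" for n
    using that by (simp add: L_def stirling_ratio_pos)
  show ?thesis
  proof (rule that[OF _ lim])
    show "exp l \<le> stirling_ratio n" if "n > 0" for n using l(2) that by (simp add: e)
    show "stirling_ratio n \<le> stirling_ratio 1" if "n > 0" for n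
      using that decseqD[OF dec, of 0 "n - 1"] by (simp add: e)
  qed simp
qed

text \<open>The value of this constant is never needed: it cancels in all ratios of Gibbs sums.\<close>

definition stirling_const :: real where
  "stirling_const = lim stirling_ratio"

lemma stirling_const:
  shows "stirling_const > 0" "stirling_ratio \<longlonglongrightarrow> stirling_const"
    "\<And>n. n > 0 \<Longrightarrow> stirling_const \<le> stirling_ratio n"
    "\<And>n. n > 0 \<Longrightarrow> stirling_ratio n \<le> stirling_ratio 1"
  by (rule stirling_ratio_limit; simp add: stirling_const_def limI)+

text \<open>The mean magnetization of a configuration with exactly \<open>k\<close> spins equal to
  \<open>+1\<close>.\<close>

definition grid :: "nat \<Rightarrow> nat \<Rightarrow> real" where
  "grid N k = (2 * real k - real N) / real N"

text \<open>An exact identity: the error of Stirling's formula is confined to the three ratios, and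
  sqrt (1 - x^2) is 2 sqrt (k (N - k)) / N. The ends of the grid are excluded because
  \<open>stirling_ratio 0 = 0\<close>.\<close>

lemma binomial_stirling:
  assumes "0 < k" "k < N"
  shows "real (N choose k) / 2 ^ N =
    stirling_ratio N / (stirling_ratio k * stirling_ratio (N - k)) *
      (2 / (sqrt (real N) * sqrt (1 - (grid N k)\<^sup>2))) * exp (- real N * I_fun (grid N k))"
proof -
  let ?x = "grid N k"
  have N: "N > 0" and kN: "real (N - k) = real N - real k" using assms by auto
  have F: "fact n = stirling_ratio n * (sqrt (real n) * exp (real n * ln (real n) - real n))" if "n > 0" for n
    using that by (simp add: stirling_ratio_def)
  have x: "1 + ?x = 2 * (real k / real N)" "1 - ?x = 2 * (real (N - k) / real N)"
    using N by (simp_all add: grid_def field_simps kN)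
  have l: "ln (1 + ?x) = ln 2 + (ln (real k) - ln (real N))" "ln (1 - ?x) = ln 2 + (ln (real (N - k)) - ln (real N))"
  proof -
    have *: "ln (2 * (a / b)) = ln 2 + (ln a - ln b)" if "a > 0" "b > 0" for a b :: real
      using that by (subst ln_mult) (simp_all add: ln_div)
    show "ln (1 + ?x) = ln 2 + (ln (real k) - ln (real N))"
      unfolding x using assms by (intro *) auto
    show "ln (1 - ?x) = ln 2 + (ln (real (N - k)) - ln (real N))"
      unfolding x using assms by (intro *) auto
  qed
  have "real N * I_fun ?x = real k * ln (1 + ?x) + real (N - k) * ln (1 - ?x)"
    unfolding I_fun_def using N by (simp add: x field_simps)
  also have "\<dots> = real N * ln 2 + real k * ln (real k) + real (N - k) * ln (real (N - k)) - real N * ln (real N)"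
    unfolding l kN by (simp add: algebra_simps)
  finally have I: "real N * I_fun ?x = \<dots>" .
  have "1 - ?x\<^sup>2 = (1 + ?x) * (1 - ?x)" by (simp add: algebra_simps power2_eq_square)
  also have "\<dots> = 4 * real k * real (N - k) / (real N)\<^sup>2" unfolding x by (simp add: power2_eq_square)
  finally have "sqrt (1 - ?x\<^sup>2) = 2 * sqrt (real k) * sqrt (real (N - k)) / real N"
    by (simp add: real_sqrt_mult real_sqrt_divide)
  then have "2 / (sqrt (real N) * sqrt (1 - ?x\<^sup>2))
      = (real N / sqrt (real N)) / (sqrt (real k) * sqrt (real (N - k)))"
    by simp
  then have s: "2 / (sqrt (real N) * sqrt (1 - ?x\<^sup>2)) = sqrt (real N) / (sqrt (real k) * sqrt (real (N - k)))"
    by (simp only: real_div_sqrt of_nat_0_le_iff)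
  have e: "exp (- real N * I_fun ?x) * 2 ^ N = exp (real N * ln (real N) - real N) /
     (exp (real k * ln (real k) - real k) * exp (real (N - k) * ln (real (N - k)) - real (N - k)))"
  proof -
    have "(2::real) ^ N = exp (real N * ln 2)" by (simp add: exp_of_nat_mult)
    then have "exp (- real N * I_fun ?x) * 2 ^ N = exp (- (real N * I_fun ?x) + real N * ln 2)"
      by (simp add: exp_add[symmetric])
    also have "\<dots> = exp ((real N * ln (real N) - real N) -
       ((real k * ln (real k) - real k) + (real (N - k) * ln (real (N - k)) - real (N - k))))"
      unfolding I by (simp add: kN)
    finally show ?thesis by (simp only: exp_diff exp_add)
  qed
  have "real (N choose k) = fact N / (fact k * fact (N - k))"
    using assms by (simp add: binomial_fact)
  also have "\<dots> = stirling_ratio N / (stirling_ratio k * stirling_ratio (N - k)) *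
      (sqrt (real N) / (sqrt (real k) * sqrt (real (N - k)))) *
      (exp (real N * ln (real N) - real N) /
     (exp (real k * ln (real k) - real k) * exp (real (N - k) * ln (real (N - k)) - real (N - k))))"
    using assms by (simp only: F zero_less_diff N) (simp add: field_simps)
  finally show ?thesis unfolding e[symmetric] s by simp
qed

text \<open>A single term of the expansion of (q + (1 - q))^N = 1 at q = k/N is at most 1. Unlike
  the Stirling form this covers the ends of the grid, so it can control the sum away from the
  maximizers.\<close>

lemma binomial_le_exp_I_fun:
  assumes "k \<le> N" "N > 0"
  shows "real (N choose k) / 2 ^ N \<le> exp (- real N * I_fun (grid N k))"
proof -
  let ?x = "grid N k"
  define q where "q = real k / real N"
  have q: "0 \<le> q" "q \<le> 1" and x: "1 + ?x = 2 * q" "1 - ?x = 2 * (1 - q)"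
    using assms by (auto simp: q_def grid_def field_simps)
  have kN: "real (N - k) = real N - real k" using assms by auto
  have "real (N choose k) * q ^ k * (1 - q) ^ (N - k) \<le> (\<Sum>j\<le>N. real (N choose j) * q ^ j * (1 - q) ^ (N - j))"
    using assms q by (intro member_le_sum[where f="\<lambda>j. real (N choose j) * q ^ j * (1 - q) ^ (N - j)"]) auto
  also have "\<dots> = (q + (1 - q)) ^ N" by (subst binomial_ring) simp
  finally have b: "real (N choose k) * (q ^ k * (1 - q) ^ (N - k)) \<le> 1" by (simp add: mult.assoc)
  \<comment> \<open>At \<open>k = 0\<close> or \<open>k = N\<close> one of the two bases is 0, but
    then its exponent is 0 as well.\<close>
  have pk: "(2 * r) ^ j = exp (real j * ln (2 * r))" if "r > 0 \<or> j = 0" for r :: real and j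
    using that by (auto simp: exp_of_nat_mult)
  have "real N * I_fun ?x = real k * ln (2 * q) + real (N - k) * ln (2 * (1 - q))"
    unfolding I_fun_def x using assms kN by (simp add: q_def field_simps)
  then have "exp (real N * I_fun ?x) = (2 * q) ^ k * (2 * (1 - q)) ^ (N - k)"
    using assms by (subst (1 2) pk) (auto simp: exp_add q_def)
  also have "\<dots> = 2 ^ (k + (N - k)) * (q ^ k * (1 - q) ^ (N - k))"
    by (simp only: power_mult_distrib power_add) simp
  also have "\<dots> = 2 ^ N * (q ^ k * (1 - q) ^ (N - k))" using assms by simp
  finally have "real (N choose k) * exp (real N * I_fun ?x) \<le> 2 ^ N"
    using b mult_left_mono[OF b, of "2^N"] by (simp add: algebra_simps)
  then show ?thesis by (simp add: exp_minus field_simps)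
qed

text \<open>Configurations correspond to their sets of \<open>+1\<close> spins, and
  \<open>N choose k\<close> of these sets have \<open>k\<close> elements.\<close>

lemma sum_cfgs:
  fixes G :: "real \<Rightarrow> real"
  assumes "N > 0"
  shows "(\<Sum>x\<in>cfgs N. G (mean N x)) = (\<Sum>k\<le>N. real (N choose k) * G (grid N k))"
proof -
  define \<phi> where "\<phi> S = (\<lambda>i\<in>{..<N}. if i \<in> S then 1 else - 1 :: real)" for S
  have bij: "bij_betw \<phi> (Pow {..<N}) (cfgs N)"
  proof (rule bij_betw_byWitness[where f'="\<lambda>x. {i\<in>{..<N}. x i = 1}"])
    show "\<forall>x\<in>cfgs N. \<phi> {i \<in> {..<N}. x i = 1} = x"
      by (force simp: \<phi>_def cfgs_def PiE_def Pi_def extensional_def fun_eq_iff)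
    show "\<phi> ` Pow {..<N} \<subseteq> cfgs N" by (auto simp: \<phi>_def cfgs_def PiE_def Pi_def)
  qed (auto simp: \<phi>_def split: if_splits)
  have m: "mean N (\<phi> S) = grid N (card S)" if "S \<subseteq> {..<N}" for S
  proof -
    have "(\<Sum>i<N. \<phi> S i) = (\<Sum>i<N. if i \<in> S then 1 else - 1)" by (simp add: \<phi>_def)
    also have "\<dots> = real (card S) - real (card ({..<N} - S))"
      using that by (simp add: sum.If_cases Int_absorb1 Diff_eq[symmetric])
    also have "\<dots> = 2 * real (card S) - real N"
      using that card_mono[of "{..<N}" S] by (subst card_Diff_subset) (auto intro: finite_subset simp: of_nat_diff)
    finally show ?thesis by (simp add: mean_def grid_def)
  qed
  have "(\<Sum>x\<in>cfgs N. G (mean N x)) = (\<Sum>S\<in>Pow {..<N}. G (grid N (card S)))"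
    using m by (subst sum.reindex_bij_betw[OF bij, symmetric]) auto
  also have "\<dots> = (\<Sum>k\<le>N. \<Sum>S\<in>{S\<in>Pow {..<N}. card S = k}. G (grid N (card S)))"
  proof (rule sum.group[symmetric])
    show "card ` Pow {..<N} \<subseteq> {..N}" using card_mono[of "{..<N}"] by fastforce
  qed auto
  also have "\<dots> = (\<Sum>k\<le>N. real (N choose k) * G (grid N k))"
    using n_subsets[of "{..<N}"] by (intro sum.cong) auto
  finally show ?thesis .
qed

section \<open>Convexity of H and its maximizers\<close>

text \<open>Both sides of the sandwich come from ln z \<le> z - 1, applied to 1 / sqrt x for the
  lower bound and to x for the upper one.\<close>

lemma tendsto_mult_ln_0: "((\<lambda>x::real. x * ln x) \<longlongrightarrow> 0) (at_right 0)"
proof (rule tendsto_sandwich[where f="\<lambda>x. - 2 * sqrt x" and h="\<lambda>x. x * (x - 1)"])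
  show "\<forall>\<^sub>F x::real in at_right 0. - 2 * sqrt x \<le> x * ln x"
  proof (rule eventually_at_right_less[THEN eventually_mono])
    fix x :: real assume x: "0 < x"
    have "ln (1 / sqrt x) \<le> 1 / sqrt x - 1" using x by (intro ln_le_minus_one) auto
    then have "- (1 / sqrt x) * 2 \<le> ln x" using x by (simp add: ln_div ln_sqrt)
    then have "x * (- (1 / sqrt x) * 2) \<le> x * ln x" using x by (intro mult_left_mono) auto
    moreover have "x / sqrt x = sqrt x" using x by (simp add: real_div_sqrt)
    moreover have "x * (- (1 / sqrt x) * 2) = - 2 * (x / sqrt x)" by simp
    ultimately show "- 2 * sqrt x \<le> x * ln x" by linarith
  qed
  show "\<forall>\<^sub>F x::real in at_right 0. x * ln x \<le> x * (x - 1)"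
    by (rule eventually_at_right_less[THEN eventually_mono])
       (intro mult_left_mono ln_le_minus_one, auto)
  show "((\<lambda>x::real. - 2 * sqrt x) \<longlongrightarrow> 0) (at_right 0)"
    by (auto intro!: tendsto_eq_intros)
  show "((\<lambda>x::real. x * (x - 1)) \<longlongrightarrow> 0) (at_right 0)"
    by (auto intro!: tendsto_eq_intros)
qed

text \<open>At 0 the factor x makes the value 0, which is also the limit. This is what makes
  \<open>H\<close> continuous up to both endpoints of [-1,1].\<close>

lemma continuous_on_mult_ln: "continuous_on {0..} (\<lambda>x::real. x * ln x)"
  unfolding continuous_on_def
proof
  fix x :: real assume x: "x \<in> {0..}"
  show "((\<lambda>x. x * ln x) \<longlongrightarrow> x * ln x) (at x within {0..})"
  proof (cases "x = 0")
    case True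
    have "at x within {0..} = at_right (0::real)"
      unfolding True by (rule at_within_Ici_at_right)
    then show ?thesis using tendsto_mult_ln_0 True by simp
  next
    case False
    with x show ?thesis by (auto intro!: tendsto_intros)
  qed
qed

lemma continuous_on_H: "continuous_on {-1..1} (H \<beta> h p)"
proof -
  have 1: "continuous_on {-1..1} (\<lambda>x::real. (1 + x) * ln (1 + x))"
    by (rule continuous_on_compose2[OF continuous_on_mult_ln]) (auto intro!: continuous_intros)
  have 2: "continuous_on {-1..1} (\<lambda>x::real. (1 - x) * ln (1 - x))"
    by (rule continuous_on_compose2[OF continuous_on_mult_ln]) (auto intro!: continuous_intros)
  show ?thesis unfolding H_def[abs_def] I_fun_def by (intro continuous_intros 1 2) auto
qed

text \<open>The first derivative of \<open>H\<close> on (-1,1); its logarithmic part is artanh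
  x.\<close>

definition H1 :: "real \<Rightarrow> real \<Rightarrow> nat \<Rightarrow> real \<Rightarrow> real" where
  "H1 \<beta> h p x = \<beta> * (real p * x ^ (p - 1)) + h - (ln (1 + x) - ln (1 - x)) / 2"

lemma DERIV_H: "\<bar>x\<bar> < 1 \<Longrightarrow> (H \<beta> h p has_real_derivative H1 \<beta> h p x) (at x)"
  unfolding H_def[abs_def] I_fun_def H1_def
  by (auto intro!: derivative_eq_intros)

lemma DERIV_H1_explicit:
  "\<bar>x\<bar> < 1 \<Longrightarrow> (H1 \<beta> h p has_real_derivative \<beta> * (real p * (real (p - 1) * x ^ (p - 2))) - 1 / (1 - x\<^sup>2)) (at x)"
proof -
  assume x: "\<bar>x\<bar> < 1"
  have "1 - x\<^sup>2 = (1 + x) * (1 - x)" by (simp add: power2_eq_square algebra_simps)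
  moreover have "1 / ((1 + x) * (1 - x)) = (1 / (1 + x) + 1 / (1 - x)) / 2"
  proof -
    have "1 + x \<noteq> 0" "1 - x \<noteq> 0" using x by auto
    then show ?thesis by (simp add: divide_simps)
  qed
  ultimately have e: "1 / (1 - x\<^sup>2) = (1 / (1 + x) + 1 / (1 - x)) / 2" by simp
  show ?thesis unfolding H1_def[abs_def] e using x
    by (auto intro!: derivative_eq_intros simp: numeral_2_eq_2)
qed

lemma H2_eq:
  assumes "\<bar>x\<bar> < 1"
  shows "H2 \<beta> h p x = \<beta> * (real p * (real (p - 1) * x ^ (p - 2))) - 1 / (1 - x\<^sup>2)"
proof -
  have "\<forall>\<^sub>F y in nhds x. y \<in> {-1<..<1}"
    using assms by (intro eventually_nhds_in_open) auto
  then have "\<forall>\<^sub>F y in nhds x. deriv (H \<beta> h p) y = H1 \<beta> h p y"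
    by eventually_elim (auto intro!: DERIV_imp_deriv DERIV_H)
  then have "deriv (deriv (H \<beta> h p)) x = deriv (H1 \<beta> h p) x"
    by (intro deriv_cong_ev) auto
  also have "\<dots> = \<beta> * (real p * (real (p - 1) * x ^ (p - 2))) - 1 / (1 - x\<^sup>2)"
    by (intro DERIV_imp_deriv DERIV_H1_explicit assms)
  finally show ?thesis by (simp add: H2_def)
qed

lemma DERIV_H1: "\<bar>x\<bar> < 1 \<Longrightarrow> (H1 \<beta> h p has_real_derivative H2 \<beta> h p x) (at x)"
  using DERIV_H1_explicit by (simp add: H2_eq)

lemma isCont_H2:
  assumes "\<bar>x\<bar> < 1" shows "isCont (H2 \<beta> h p) x"
proof -
  have "\<forall>\<^sub>F y in nhds x. y \<in> {-1<..<1}"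
    using assms by (intro eventually_nhds_in_open) auto
  then have ev: "\<forall>\<^sub>F y in nhds x. H2 \<beta> h p y = \<beta> * (real p * (real (p - 1) * y ^ (p - 2))) - 1 / (1 - y\<^sup>2)"
    by eventually_elim (rule H2_eq, auto)
  have "x\<^sup>2 \<noteq> 1" using assms by (auto simp: power2_eq_1_iff)
  then have "isCont (\<lambda>y. \<beta> * (real p * (real (p - 1) * y ^ (p - 2))) - 1 / (1 - y\<^sup>2)) x"
    by (intro continuous_intros) auto
  then show ?thesis using isCont_cong[OF ev] by simp
qed

text \<open>The intermediate point is described twice: the weak bound also covers x = m and is used
  for limits, the strict one places it between two distinct points.\<close>

lemma H_Taylor:
  assumes "\<bar>m\<bar> < 1" "\<bar>x\<bar> < 1"
  obtains \<xi> where "\<bar>\<xi> - m\<bar> \<le> \<bar>x - m\<bar>" "x \<noteq> m \<Longrightarrow> \<xi> \<in> {min x m<..<max x m}"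
    "H \<beta> h p x = H \<beta> h p m + H1 \<beta> h p m * (x - m) + H2 \<beta> h p \<xi> / 2 * (x - m)\<^sup>2"
proof (cases "x = m")
  case True
  then show ?thesis using that[of m] assms by simp
next
  case False
  define diff where "diff n = (if n = 0 then H \<beta> h p else if n = 1 then H1 \<beta> h p else H2 \<beta> h p)" for n :: nat
  have "\<exists>t. (if x < m then x < t \<and> t < m else m < t \<and> t < x) \<and>
      H \<beta> h p x = (\<Sum>n<2. diff n m / fact n * (x - m) ^ n) + diff 2 t / fact 2 * (x - m) ^ 2"
  proof (rule Taylor[where a="min x m" and b="max x m"])
    show "\<forall>n t. n < 2 \<and> min x m \<le> t \<and> t \<le> max x m \<longrightarrow> (diff n has_real_derivative diff (Suc n) t) (at t)"
    proof (intro allI impI, elim conjE)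
      fix n :: nat and t assume "n < 2" and t: "min x m \<le> t" "t \<le> max x m"
      then consider "n = 0" | "n = 1" by linarith
      moreover have "\<bar>t\<bar> < 1" using t assms by (auto simp: min_def max_def split: if_splits)
      ultimately show "(diff n has_real_derivative diff (Suc n) t) (at t)"
        by cases (auto simp: diff_def intro: DERIV_H DERIV_H1)
    qed
  qed (use False in \<open>auto simp: diff_def\<close>)
  then obtain t where t: "if x < m then x < t \<and> t < m else m < t \<and> t < x"
    "H \<beta> h p x = H \<beta> h p m + H1 \<beta> h p m * (x - m) + H2 \<beta> h p t / 2 * (x - m)\<^sup>2"
    by (auto simp: diff_def numeral_2_eq_2)
  show ?thesis
    by (rule that[OF _ _ t(2)]) (use t(1) assms in \<open>auto simp: min_def max_def split: if_splits\<close>)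
qed

text \<open>The logarithm in H' diverges at the endpoints while the polynomial part stays bounded,
  which pushes all maximizers into the interior.\<close>

lemma H1_near_endpoints:
  "\<exists>x\<in>{0<..<1}. \<forall>y\<in>{x<..<1}. H1 \<beta> h p y < 0" "\<exists>x\<in>{-1<..<0}. \<forall>y\<in>{-1<..<x}. H1 \<beta> h p y > 0"
proof -
  \<comment> \<open>\<open>B\<close> strictly exceeds the polynomial part of \<open>H1\<close> in
    absolute value. Within \<delta> of an endpoint, half of the divergent logarithm is below
    -B.\<close>
  define B where "B = \<bar>\<beta>\<bar> * real p + \<bar>h\<bar> + 1"
  define \<delta> where "\<delta> = exp (- 2 * B)"
  have B: "B \<ge> 1" by (simp add: B_def)
  have \<delta>: "0 < \<delta>" "\<delta> < 1" using B by (auto simp: \<delta>_def)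
  define Q where "Q y = \<beta> * (real p * y ^ (p - 1)) + h" for y
  have H1Q: "H1 \<beta> h p y = Q y - (ln (1 + y) - ln (1 - y)) / 2" for y
    by (simp add: H1_def Q_def)
  have lin: "H1 \<beta> h p y < 0" if "ln (1 - y) < - (2 * B)" "0 \<le> ln (1 + y)" "Q y < B" for y
  proof -
    have "u - (w - v) / 2 < 0" if "v < - (2 * B)" "0 \<le> w" "u < B" for u v w :: real
      using that by simp
    from this[OF that] show ?thesis unfolding H1Q .
  qed
  have lin': "H1 \<beta> h p y > 0" if "ln (1 + y) < - (2 * B)" "0 \<le> ln (1 - y)" "- B < Q y" for y
  proof -
    have "u - (v - w) / 2 > 0" if "v < - (2 * B)" "0 \<le> w" "- B < u" for u v w :: real
      using that by simp
    from this[OF that] show ?thesis unfolding H1Q .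
  qed
  have p: "\<bar>Q y\<bar> < B" if "\<bar>y\<bar> < 1" for y
    unfolding Q_def
  proof -
    have "\<bar>\<beta> * (real p * y ^ (p - 1)) + h\<bar> \<le> \<bar>\<beta>\<bar> * (real p * \<bar>y\<bar> ^ (p - 1)) + \<bar>h\<bar>"
      by (rule order_trans[OF abs_triangle_ineq]) (simp add: abs_mult power_abs)
    also have "\<dots> \<le> \<bar>\<beta>\<bar> * (real p * 1) + \<bar>h\<bar>"
      using that by (intro add_right_mono mult_left_mono power_le_one) auto
    finally show "\<bar>\<beta> * (real p * y ^ (p - 1)) + h\<bar> < B" unfolding B_def by linarith
  qed
  have l: "ln z < - (2 * B)" if "0 < z" "z < \<delta>" for z
    using that ln_less_cancel_iff[of z \<delta>] by (simp add: \<delta>_def)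
  show "\<exists>x\<in>{0<..<1}. \<forall>y\<in>{x<..<1}. H1 \<beta> h p y < 0"
  proof (rule bexI[of _ "1 - \<delta>"], rule ballI)
    fix y assume y: "y \<in> {1 - \<delta><..<1}"
    then have "ln (1 - y) < - (2 * B)" "ln (1 + y) \<ge> 0" using \<delta> by (auto intro!: l)
    moreover have "\<bar>Q y\<bar> < B" using y \<delta> by (intro p) auto
    then have "Q y < B" "- B < Q y" by (simp_all only: abs_less_iff, linarith)
    ultimately show "H1 \<beta> h p y < 0" using lin by blast
  qed (use \<delta> in auto)
  show "\<exists>x\<in>{-1<..<0}. \<forall>y\<in>{-1<..<x}. H1 \<beta> h p y > 0"
  proof (rule bexI[of _ "\<delta> - 1"], rule ballI)
    fix y assume y: "y \<in> {-1<..<\<delta> - 1}"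
    then have "ln (1 + y) < - (2 * B)" "ln (1 - y) \<ge> 0" using \<delta> by (auto intro!: l)
    moreover have "\<bar>Q y\<bar> < B" using y \<delta> by (intro p) auto
    then have "Q y < B" "- B < Q y" by (simp_all only: abs_less_iff, linarith)
    ultimately show "H1 \<beta> h p y > 0" using lin' by blast
  qed (use \<delta> in auto)
qed

section \<open>Maximizers are interior critical points\<close>

lemma global_maximizer_interior:
  assumes "m \<in> global_maximizers \<beta> h p" shows "\<bar>m\<bar> < 1"
proof (rule ccontr)
  assume "\<not> \<bar>m\<bar> < 1"
  with assms consider "m = 1" | "m = -1" by (force simp: global_maximizers_def)
  moreover have max: "H \<beta> h p y \<le> H \<beta> h p m" if "y \<in> {-1..1}" for y
    using assms that by (simp add: global_maximizers_def)
  ultimately show False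
  proof cases
    case 1
    obtain x where x: "x \<in> {0<..<1}" "\<And>y. y \<in> {x<..<1} \<Longrightarrow> H1 \<beta> h p y < 0"
      using H1_near_endpoints(1) by blast
    have "H \<beta> h p 1 < H \<beta> h p x"
    proof (rule DERIV_neg_imp_decreasing_open[of x 1])
      show "continuous_on {x..1} (H \<beta> h p)"
        by (rule continuous_on_subset[OF continuous_on_H]) (use x in auto)
    qed (use x in \<open>auto intro!: exI[of _ "H1 \<beta> h p _"] DERIV_H\<close>)
    then show False using max[of x] x 1 by auto
  next
    case 2
    obtain x where x: "x \<in> {-1<..<0}" "\<And>y. y \<in> {-1<..<x} \<Longrightarrow> H1 \<beta> h p y > 0"
      using H1_near_endpoints(2) by blast
    have "H \<beta> h p (-1) < H \<beta> h p x"
    proof (rule DERIV_pos_imp_increasing_open[of "-1" x])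
      show "continuous_on {-1..x} (H \<beta> h p)"
        by (rule continuous_on_subset[OF continuous_on_H]) (use x in auto)
    qed (use x in \<open>auto intro!: exI[of _ "H1 \<beta> h p _"] DERIV_H\<close>)
    then show False using max[of x] x 2 by auto
  qed
qed

lemma global_maximizer_H1:
  assumes "m \<in> global_maximizers \<beta> h p" shows "H1 \<beta> h p m = 0"
proof (rule DERIV_local_max)
  show "(H \<beta> h p has_real_derivative H1 \<beta> h p m) (at m)"
    using global_maximizer_interior[OF assms] by (rule DERIV_H)
  show "0 < 1 - \<bar>m\<bar>" using global_maximizer_interior[OF assms] by simp
  show "\<forall>y. \<bar>m - y\<bar> < 1 - \<bar>m\<bar> \<longrightarrow> H \<beta> h p y \<le> H \<beta> h p m"
  proof (intro allI impI)
    fix y assume "\<bar>m - y\<bar> < 1 - \<bar>m\<bar>"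
    then have "y \<in> {-1..1}" by auto
    then show "H \<beta> h p y \<le> H \<beta> h p m" using assms by (simp add: global_maximizers_def)
  qed
qed

text \<open>Up to the positive factor 1 / (1 - x^2), H'' equals K q(x) - 1 with K = \<beta> p (p -
  1) and q(x) = x^(p-2) (1 - x^2). On (0,1) the function q first rises and then falls, so an inner
  value exceeds one of the two outer values. The condition on \<open>a\<close> keeps negative points
  away: for odd p, q is negative there, and for even p only the right half is considered.\<close>

lemma H2_nonneg_interval:
  assumes p: "p \<ge> 3" and \<beta>: "\<beta> \<ge> 0" and lo: "odd p \<or> 0 \<le> a"
    and abc: "a < b" "b < c" "- 1 < a" "c < 1"
    and a: "H2 \<beta> h p a \<ge> 0" and c: "H2 \<beta> h p c \<ge> 0"
  shows "H2 \<beta> h p b > 0"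
proof -
  define n where "n = p - 2"
  define K where "K = \<beta> * (real p * real (p - 1))"
  define q where "q x = x ^ n * (1 - x\<^sup>2)" for x :: real
  have n: "n \<ge> 1" using p by (simp add: n_def)
  have H2q: "H2 \<beta> h p x = (K * q x - 1) / (1 - x\<^sup>2)" and x1: "1 - x\<^sup>2 > 0" if "\<bar>x\<bar> < 1" for x
  proof -
    show *: "1 - x\<^sup>2 > 0" using that by (simp add: abs_square_less_1)
    show "H2 \<beta> h p x = (K * q x - 1) / (1 - x\<^sup>2)"
      unfolding H2_eq[OF that] K_def q_def n_def using * by (simp add: field_simps)
  qed
  have ab: "\<bar>a\<bar> < 1" "\<bar>b\<bar> < 1" "\<bar>c\<bar> < 1" using abc by auto
  have Ka: "K * q a \<ge> 1" and Kc: "K * q c \<ge> 1"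
    using a c H2q[OF ab(1)] H2q[OF ab(3)] x1[OF ab(1)] x1[OF ab(3)] by (auto simp: zero_le_divide_iff)
  have K: "K > 0"
    using Ka \<beta> p by (auto simp: K_def less_le)
  have qa: "q a > 0" using Ka K by (smt (verit) mult_nonneg_nonpos)
  have a0: "a > 0"
  proof (rule ccontr)
    assume "\<not> a > 0"
    moreover have "a \<noteq> 0" using qa n by (cases n) (auto simp: q_def)
    ultimately have "a < 0" by simp
    with lo have "odd n" using p by (auto simp: n_def)
    then have "a ^ n < 0" using \<open>a < 0\<close> by (simp add: power_less_zero_eq)
    then have "q a < 0" unfolding q_def using x1[OF ab(1)] by (rule mult_neg_pos)
    then show False using qa by simp
  qed
  have dq: "(q has_real_derivative x ^ (n - 1) * (real n - (real n + 2) * x\<^sup>2)) (at x)" if "x > 0" for x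
  proof -
    have "x ^ n = x ^ (n - 1) * x" using n by (cases n) auto
    then show ?thesis unfolding q_def[abs_def]
      by (auto intro!: derivative_eq_intros simp: power2_eq_square algebra_simps)
  qed
  \<comment> \<open>\<open>H''\<close> has the sign of \<open>K q - 1\<close>, and \<open>q\<close> increases up to \<open>sqrt (n / (n + 2))\<close> and decreases afterwards.\<close>
  have "q b > q a \<or> q b > q c"
  proof (cases "(real n + 2) * b\<^sup>2 \<le> real n")
    case True
    have "q a < q b"
    proof (rule DERIV_pos_imp_increasing_open[OF abc(1)])
      fix x assume x: "a < x" "x < b"
      then have "x\<^sup>2 < b\<^sup>2" using a0 by (intro power_strict_mono) auto
      then have "(real n + 2) * x\<^sup>2 < (real n + 2) * b\<^sup>2" by (intro mult_strict_left_mono) auto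
      then have "real n - (real n + 2) * x\<^sup>2 > 0" using True by linarith
      then show "\<exists>y. (q has_real_derivative y) (at x) \<and> 0 < y"
        using dq[of x] x a0 by (intro exI[of _ "x ^ (n - 1) * (real n - (real n + 2) * x\<^sup>2)"] conjI) (auto intro!: mult_pos_pos)
    qed (use a0 in \<open>auto simp: q_def[abs_def] intro!: continuous_intros\<close>)
    then show ?thesis ..
  next
    case False
    have "q c < q b"
    proof (rule DERIV_neg_imp_decreasing_open[OF abc(2)])
      fix x assume x: "b < x" "x < c"
      then have "b\<^sup>2 < x\<^sup>2" using a0 abc by (intro power_strict_mono) auto
      then have "(real n + 2) * b\<^sup>2 < (real n + 2) * x\<^sup>2" by (intro mult_strict_left_mono) auto
      then have "real n - (real n + 2) * x\<^sup>2 < 0" using False by linarith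
      then show "\<exists>y. (q has_real_derivative y) (at x) \<and> y < 0"
        using dq[of x] x a0 abc by (intro exI[of _ "x ^ (n - 1) * (real n - (real n + 2) * x\<^sup>2)"] conjI) (auto intro!: mult_pos_neg)
    qed (use a0 in \<open>auto simp: q_def[abs_def] intro!: continuous_intros\<close>)
    then show ?thesis ..
  qed
  then have "K * q b > 1" using K Ka Kc mult_strict_left_mono[of "q a" "q b" K] mult_strict_left_mono[of "q c" "q b" K]
    by linarith
  then show ?thesis using H2q[OF ab(2)] x1[OF ab(2)] by auto
qed


text \<open>If H'' were nonpositive in between, H' would decrease from 0 to 0 and hence vanish, and
  H'' with it; but then \<open>conv\<close> makes H'' positive at an inner point.\<close>

lemma critical_points_H2_pos:
  assumes "m < m'" "- 1 < m" "m' < 1" "H1 \<beta> h p m = 0" "H1 \<beta> h p m' = 0"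
    and conv: "\<And>a b c. \<lbrakk>m \<le> a; a < b; b < c; c \<le> m'; H2 \<beta> h p a \<ge> 0; H2 \<beta> h p c \<ge> 0\<rbrakk> \<Longrightarrow> H2 \<beta> h p b > 0"
  obtains c where "m < c" "c < m'" "H2 \<beta> h p c > 0"
proof (rule ccontr)
  assume no: "\<not> thesis"
  have np: "H2 \<beta> h p c \<le> 0" if "m < c" "c < m'" for c
    using no \<open>\<And>c. \<lbrakk>m < c; c < m'; 0 < H2 \<beta> h p c\<rbrakk> \<Longrightarrow> thesis\<close> that by force
  have cont: "continuous_on {a..b} (H1 \<beta> h p)" if "m \<le> a" "b \<le> m'" for a b
    using that assms by (intro DERIV_continuous_on[of _ _ "H2 \<beta> h p"] DERIV_subset[OF DERIV_H1]) auto
  have dec: "H1 \<beta> h p b \<le> H1 \<beta> h p a" if "m \<le> a" "a \<le> b" "b \<le> m'" for a b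
  proof (cases "a = b")
    case False
    show ?thesis
      by (rule DERIV_nonpos_imp_decreasing_open[OF that(2)])
        (use that assms np in \<open>auto intro!: exI[of _ "H2 \<beta> h p _"] DERIV_H1 cont\<close>)
  qed simp
  have z: "H1 \<beta> h p x = 0" if "x \<in> {m..m'}" for x
    using dec[of m x] dec[of x m'] that assms by auto
  have H20: "H2 \<beta> h p x = 0" if x: "x \<in> {m<..<m'}" for x
  proof -
    have "(H1 \<beta> h p has_real_derivative 0) (at x)"
    proof (rule has_field_derivative_transform_within_open[of "\<lambda>_. 0"])
      show "open {m<..<m'}" by simp
    qed (use x z in auto)
    moreover have "(H1 \<beta> h p has_real_derivative H2 \<beta> h p x) (at x)"
      using x assms by (intro DERIV_H1) auto
    ultimately show ?thesis by (rule DERIV_unique[rotated])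
  qed
  \<comment> \<open>Four equal parts give three inner points at which H'' vanishes;
    \<open>conv\<close> applied to the outer two contradicts the value at the middle one.\<close>
  define d where "d = (m' - m) / 4"
  have "4 * d = m' - m" unfolding d_def by simp
  then have d: "d > 0" "m' = m + 4 * d" using assms(1) by auto
  have "H2 \<beta> h p (m + 2 * d) > 0"
    by (rule conv[of "m + d" _ "m + 3 * d"]) (use d H20 in auto)
  then show False using H20[of "m + 2 * d"] d by auto
qed

text \<open>With H'' \<ge> 0 at m, \<open>conv\<close> would make H'' positive strictly between c
  and m. Since H' vanishes at m, Taylor's formula would then put H(c) above the maximum.\<close>

lemma global_maximizer_H2_neg:
  assumes m: "m \<in> global_maximizers \<beta> h p" and c: "\<bar>c\<bar> < 1" "c \<noteq> m" "H2 \<beta> h p c > 0"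
    and conv: "\<And>a b c'. \<lbrakk>min c m \<le> a; a < b; b < c'; c' \<le> max c m; H2 \<beta> h p a \<ge> 0; H2 \<beta> h p c' \<ge> 0\<rbrakk> \<Longrightarrow> H2 \<beta> h p b > 0"
  shows "H2 \<beta> h p m < 0"
proof (rule ccontr)
  assume "\<not> ?thesis"
  then have ge: "H2 \<beta> h p m \<ge> 0" by simp
  note m1 = global_maximizer_interior[OF m]
  obtain \<xi> where \<xi>: "H \<beta> h p c = H \<beta> h p m + H1 \<beta> h p m * (c - m) + H2 \<beta> h p \<xi> / 2 * (c - m)\<^sup>2"
    "\<xi> \<in> {min c m<..<max c m}"
    by (rule H_Taylor[OF m1 c(1), of \<beta> h p]) (use c(2) that in auto)
  have "H2 \<beta> h p \<xi> > 0"
    by (rule conv[of "min c m" \<xi> "max c m"]) (use \<xi>(2) c ge in \<open>auto simp: min_def max_def split: if_splits\<close>)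
  then have "H2 \<beta> h p \<xi> / 2 * (c - m)\<^sup>2 > 0" using c by simp
  then have "H \<beta> h p c > H \<beta> h p m" using \<xi>(1) global_maximizer_H1[OF m] by simp
  moreover have "H \<beta> h p c \<le> H \<beta> h p m" using m c(1) by (auto simp: global_maximizers_def abs_less_iff)
  ultimately show False by simp
qed

text \<open>Between two critical points lies a point of strict convexity. Hence a third maximizer, or a
  maximizer with \<open>H'' \<ge> 0\<close>, would be flanked by points of convexity, contradicting the maximum.\<close>

lemma two_global_maximizers:
  fixes J :: "real set"
  assumes crit: "p_critical p \<beta> h" and J: "global_maximizers \<beta> h p \<subseteq> J" "J \<subseteq> {-1<..<1}"
    and ivl: "\<And>a b c. \<lbrakk>a \<in> J; c \<in> J; a < b; b < c\<rbrakk> \<Longrightarrow> b \<in> J"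
    and conv: "\<And>a b c. \<lbrakk>a \<in> J; c \<in> J; a < b; b < c; H2 \<beta> h p a \<ge> 0; H2 \<beta> h p c \<ge> 0\<rbrakk> \<Longrightarrow> H2 \<beta> h p b > 0"
  shows "card (global_maximizers \<beta> h p) = 2" "\<forall>m\<in>global_maximizers \<beta> h p. H2 \<beta> h p m < 0"
proof -
  let ?M = "global_maximizers \<beta> h p"
  have J': "b \<in> J" if "a \<in> J" "c \<in> J" "a \<le> b" "b \<le> c" for a b c
    using that ivl[of a c b] by (cases "a = b \<or> b = c") auto
  have J1: "\<bar>x\<bar> < 1" if "x \<in> J" for x using J(2) that by (auto simp: abs_less_iff)
  have between: "\<exists>c. m < c \<and> c < m' \<and> H2 \<beta> h p c > 0" if "m \<in> ?M" "m' \<in> ?M" "m < m'" for m m'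
  proof -
    have mJ: "m \<in> J" "m' \<in> J" using that J by auto
    show ?thesis
    proof (rule critical_points_H2_pos[of m m' \<beta> h p])
      fix a b c assume "m \<le> a" "a < b" "b < c" "c \<le> m'" "H2 \<beta> h p a \<ge> 0" "H2 \<beta> h p c \<ge> 0"
      then show "H2 \<beta> h p b > 0" using J'[OF mJ] by (intro conv[of a c b]) auto
    qed (use that global_maximizer_H1 mJ J in auto)
  qed
  have neg: "H2 \<beta> h p m < 0" if m: "m \<in> ?M" "c \<in> J" "c \<noteq> m" "H2 \<beta> h p c > 0" for m c
  proof (rule global_maximizer_H2_neg[of m \<beta> h p c])
    fix a b c' assume *: "min c m \<le> a" "a < b" "b < c'" "c' \<le> max c m" "H2 \<beta> h p a \<ge> 0" "H2 \<beta> h p c' \<ge> 0"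
    have "min c m \<in> J" "max c m \<in> J" using m J by (auto simp: min_def max_def)
    from J'[OF this] show "H2 \<beta> h p b > 0" using * by (intro conv[of a c' b]) auto
  qed (use m J1 in auto)
  obtain m m' where m: "m \<in> ?M" "m' \<in> ?M" "m < m'"
    using crit unfolding p_critical_def by (metis linorder_less_linear)
  have mid: False if abc: "a \<in> ?M" "b \<in> ?M" "c \<in> ?M" "a < b" "b < c" for a b c
  proof -
    obtain u v where "a < u" "u < b" "H2 \<beta> h p u > 0" "b < v" "v < c" "H2 \<beta> h p v > 0"
      using between[OF abc(1,2,4)] between[OF abc(2,3,5)] by blast
    moreover have "a \<in> J" "c \<in> J" using that J by auto
    moreover have "u \<in> J" "v \<in> J"
      using calculation ivl[of a c u] ivl[of a c v] abc by auto
    ultimately have "H2 \<beta> h p b < 0" "H2 \<beta> h p b > 0"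
      using neg[of b u] conv[of u v b] abc by auto
    then show False by simp
  qed
  have M: "?M = {m, m'}"
  proof -
    have "x = m \<or> x = m'" if "x \<in> ?M" for x
      using mid[of x m m'] mid[of m x m'] mid[of m m' x] that m by fastforce
    then show ?thesis using m by auto
  qed
  show "card ?M = 2" using m M by simp
  obtain c where c: "m < c" "c < m'" "H2 \<beta> h p c > 0" using between[OF m] by blast
  have "c \<in> J" using ivl[of m m' c] m J c by auto
  then show "\<forall>m\<in>?M. H2 \<beta> h p m < 0" using neg[of m c] neg[of m' c] m c M by auto
qed

lemma maximizers_odd:
  assumes "p_critical p \<beta> h" "p \<ge> 3" "\<beta> \<ge> 0" "odd p"
  shows "card (global_maximizers \<beta> h p) = 2" "\<forall>m\<in>global_maximizers \<beta> h p. H2 \<beta> h p m < 0"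
proof -
  have J: "global_maximizers \<beta> h p \<subseteq> {-1<..<1}"
    using global_maximizer_interior by (fastforce simp: abs_less_iff)
  note * = two_global_maximizers[OF assms(1) J order_refl]
  show "card (global_maximizers \<beta> h p) = 2" "\<forall>m\<in>global_maximizers \<beta> h p. H2 \<beta> h p m < 0"
    by (rule *; use assms in \<open>auto intro: H2_nonneg_interval\<close>)+
qed

section \<open>Even exponents and reflection symmetry\<close>

lemma H_minus_even: "even p \<Longrightarrow> H \<beta> h p (- x) = H \<beta> h p x - 2 * h * x"
  by (simp add: H_def I_fun_def)

lemma H2_minus_even:
  assumes "even p" "\<bar>x\<bar> < 1" shows "H2 \<beta> h p (- x) = H2 \<beta> h p x"
proof -
  have "(- x) ^ (p - 2) = x ^ (p - 2)" using assms(1) by (intro power_minus_even) auto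
  then show ?thesis using assms by (simp add: H2_eq)
qed

text \<open>Reflection changes H by -2 h x, so every maximizer has the sign of h, and H'(0) = h
  excludes 0. The set \<open>J\<close> is therefore one open half of the interval; the left half
  inherits convexity from the evenness of H''.\<close>

lemma maximizers_even_field:
  assumes "p_critical p \<beta> h" "p \<ge> 3" "\<beta> \<ge> 0" "even p" "h \<noteq> 0"
  shows "card (global_maximizers \<beta> h p) = 2" "\<forall>m\<in>global_maximizers \<beta> h p. H2 \<beta> h p m < 0"
proof -
  have nz: "m \<noteq> 0 \<and> \<bar>m\<bar> < 1 \<and> h * m \<ge> 0" if m: "m \<in> global_maximizers \<beta> h p" for m
  proof -
    have "H \<beta> h p (- m) \<le> H \<beta> h p m"
      using m by (auto simp: global_maximizers_def)
    moreover have "H1 \<beta> h p 0 = h" using assms by (simp add: H1_def)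
    ultimately show ?thesis
      using global_maximizer_H1[OF m] global_maximizer_interior[OF m] assms
      by (auto simp: H_minus_even)
  qed
  have conv: "H2 \<beta> h p b > 0" if "0 < a" "a < b" "b < c" "c < 1" "H2 \<beta> h p a \<ge> 0" "H2 \<beta> h p c \<ge> 0" for a b c
    using that assms by (intro H2_nonneg_interval[of p \<beta> a b c]) auto
  have "card (global_maximizers \<beta> h p) = 2 \<and> (\<forall>m\<in>global_maximizers \<beta> h p. H2 \<beta> h p m < 0)"
  proof (cases "h > 0")
    case True
    have J: "global_maximizers \<beta> h p \<subseteq> {0<..<1}"
      using nz True by (force simp: zero_le_mult_iff)
    show ?thesis
      by (intro conjI; rule two_global_maximizers[OF assms(1) J]) (auto intro: conv)
  next
    case False
    have J: "global_maximizers \<beta> h p \<subseteq> {-1<..<0}"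
      using nz False assms(5) by (force simp: zero_le_mult_iff)
    have "H2 \<beta> h p b > 0" if "a \<in> {-1<..<0}" "c \<in> {-1<..<0}" "a < b" "b < c" "H2 \<beta> h p a \<ge> 0" "H2 \<beta> h p c \<ge> 0" for a b c
      using conv[of "- c" "- b" "- a"] that assms H2_minus_even[of p a \<beta> h] H2_minus_even[of p b \<beta> h] H2_minus_even[of p c \<beta> h]
      by auto
    then show ?thesis
      by (intro conjI; intro two_global_maximizers[OF assms(1) J]) auto
  qed
  then show "card (global_maximizers \<beta> h p) = 2" "\<forall>m\<in>global_maximizers \<beta> h p. H2 \<beta> h p m < 0"
    by auto
qed

text \<open>The point 0 is always critical with H'' = -1, so it can stand in for the left maximizer
  in the search for a point of convexity. This makes a positive maximizer nondegenerate and unique,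
  and reflection supplies the negative one. Whether 0 is itself a maximizer is decided by
  \<open>beta_tilde\<close>.\<close>

lemma maximizers_even_no_field:
  assumes crit: "p_critical p \<beta> 0" and p: "p \<ge> 3" "\<beta> \<ge> 0" "even p"
  obtains ms where "ms > 0" "ms \<in> global_maximizers \<beta> 0 p" "- ms \<in> global_maximizers \<beta> 0 p"
    "global_maximizers \<beta> 0 p \<subseteq> {- ms, 0, ms}" "\<forall>m\<in>global_maximizers \<beta> 0 p. H2 \<beta> 0 p m < 0"
proof -
  let ?M = "global_maximizers \<beta> 0 p"
  have sym: "- m \<in> ?M" if "m \<in> ?M" for m
    using that p by (auto simp: global_maximizers_def H_minus_even)
  have conv: "H2 \<beta> 0 p b > 0" if "0 \<le> a" "a < b" "b < c" "c < 1" "H2 \<beta> 0 p a \<ge> 0" "H2 \<beta> 0 p c \<ge> 0" for a b c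
    using that assms by (intro H2_nonneg_interval[of p \<beta> a b c]) auto
  have H10: "H1 \<beta> 0 p 0 = 0" using p by (simp add: H1_def)
  have H20: "H2 \<beta> 0 p 0 = -1" using p by (simp add: H2_eq)
  have between: "\<exists>c. m < c \<and> c < m' \<and> H2 \<beta> 0 p c > 0"
    if "m \<in> insert 0 ?M" "m' \<in> ?M" "m < m'" "0 \<le> m" for m m'
  proof (rule critical_points_H2_pos[of m m' \<beta> 0 p])
    fix a b c assume "m \<le> a" "a < b" "b < c" "c \<le> m'" "H2 \<beta> 0 p a \<ge> 0" "H2 \<beta> 0 p c \<ge> 0"
    then show "H2 \<beta> 0 p b > 0"
      using that global_maximizer_interior[of m' \<beta> 0 p] by (intro conv[of a b c]) auto
  qed (use that global_maximizer_H1 global_maximizer_interior[of m' \<beta> 0 p] H10 in auto)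
  have neg: "H2 \<beta> 0 p m < 0" if m: "m \<in> ?M" "m > 0" for m
  proof -
    obtain c where c: "0 < c" "c < m" "H2 \<beta> 0 p c > 0" using between[of 0 m] m by auto
    show ?thesis
    proof (rule global_maximizer_H2_neg[of m \<beta> 0 p c])
      fix a b c' assume "min c m \<le> a" "a < b" "b < c'" "c' \<le> max c m" "H2 \<beta> 0 p a \<ge> 0" "H2 \<beta> 0 p c' \<ge> 0"
      then show "H2 \<beta> 0 p b > 0"
        using c m global_maximizer_interior[OF m(1)] by (intro conv[of a b c']) auto
    qed (use m c global_maximizer_interior[OF m(1)] in auto)
  qed
  have unique: "\<not> m < m'" if m: "m \<in> ?M" "m' \<in> ?M" "0 < m" for m m'
  proof
    assume "m < m'"
    then obtain c d where "0 < c" "c < m" "H2 \<beta> 0 p c > 0" "m < d" "d < m'" "H2 \<beta> 0 p d > 0"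
      using between[of 0 m] between[of m m'] m by auto
    then have "H2 \<beta> 0 p m > 0" using global_maximizer_interior[OF m(2)] by (intro conv[of c m d]) auto
    with neg[of m] m show False by simp
  qed
  obtain m m' where "m \<in> ?M" "m' \<in> ?M" "m \<noteq> m'"
    using crit unfolding p_critical_def by metis
  then obtain ms where ms: "ms \<in> ?M" "ms > 0"
    using sym by (metis linorder_neqE_linordered_idom neg_0_less_iff_less)
  have sub: "?M \<subseteq> {- ms, 0, ms}"
  proof
    fix x assume x: "x \<in> ?M"
    consider "x = 0" | "x > 0" | "x < 0" by linarith
    then show "x \<in> {- ms, 0, ms}"
      using unique[of x ms] unique[of ms x] unique[of "- x" ms] unique[of ms "- x"] x ms sym[OF x] by cases auto
  qed
  have "H2 \<beta> 0 p (- ms) < 0"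
    using neg[of ms] ms H2_minus_even[of p ms \<beta> 0] p global_maximizer_interior[OF ms(1)] by simp
  then have "\<forall>m\<in>?M. H2 \<beta> 0 p m < 0" using sub neg[OF ms] H20 by force
  then show ?thesis using that[of ms] ms sym sub by blast
qed

section \<open>The threshold \<open>beta_tilde\<close> and the maximizer 0\<close>

lemma H_zero: "p \<ge> 1 \<Longrightarrow> H \<beta> h p 0 = 0"
  by (simp add: H_def I_fun_def power_0_left)

lemma bdd_above_H: "bdd_above (H \<beta> h p ` {-1..1})"
  by (intro bounded_imp_bdd_above compact_imp_bounded compact_continuous_image continuous_on_H) auto

lemma Sup_H_eq_0_iff:
  assumes "p \<ge> 1"
  shows "(SUP x\<in>{-1..1}. H \<beta> 0 p x) = 0 \<longleftrightarrow> (\<forall>x\<in>{-1..1}. H \<beta> 0 p x \<le> 0)"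
proof
  assume "(SUP x\<in>{-1..1}. H \<beta> 0 p x) = 0"
  then show "\<forall>x\<in>{-1..1}. H \<beta> 0 p x \<le> 0"
    using cSUP_upper[OF _ bdd_above_H] by metis
next
  assume le: "\<forall>x\<in>{-1..1}. H \<beta> 0 p x \<le> 0"
  show "(SUP x\<in>{-1..1}. H \<beta> 0 p x) = 0"
  proof (rule antisym)
    show "(SUP x\<in>{-1..1}. H \<beta> 0 p x) \<le> 0" using le by (intro cSUP_least) auto
    show "0 \<le> (SUP x\<in>{-1..1}. H \<beta> 0 p x)"
      using cSUP_upper[OF _ bdd_above_H, of 0 \<beta> 0 p] H_zero[OF assms, of \<beta> 0] by simp
  qed
qed

lemma zero_maximizer_iff:
  assumes "p \<ge> 1"
  shows "0 \<in> global_maximizers \<beta> 0 p \<longleftrightarrow> (\<forall>x\<in>{-1..1}. H \<beta> 0 p x \<le> 0)"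
  using H_zero[OF assms, of \<beta> 0] by (auto simp: global_maximizers_def)

text \<open>For each x the condition \<beta> x^p \<le> I(x) is closed in \<beta>, so it passes to
  the supremum, and 0 is still a maximizer at the threshold itself.\<close>

lemma zero_maximizer_beta_tilde:
  assumes "p \<ge> 1" "\<beta> \<ge> 0"
  shows "\<beta> > beta_tilde p \<Longrightarrow> 0 \<notin> global_maximizers \<beta> 0 p"
    and "\<beta> = beta_tilde p \<Longrightarrow> 0 \<in> global_maximizers \<beta> 0 p"
proof -
  define B where "B = {\<beta>::real. \<beta> \<ge> 0 \<and> (\<forall>x\<in>{-1..1}. H \<beta> 0 p x \<le> 0)}"
  have bt: "beta_tilde p = Sup B" unfolding beta_tilde_def B_def Sup_H_eq_0_iff[OF assms(1)] ..
  \<comment> \<open>At x = 1 the condition reads b \<le> I(1) = ln 2. This bound is what makes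
    \<open>Sup\<close> an upper bound of \<open>B\<close>.\<close>
  have up: "b \<le> ln 2" if "b \<in> B" for b
  proof -
    have "H b 0 p 1 \<le> 0" using that by (auto simp: B_def)
    then show ?thesis by (simp add: H_def I_fun_def)
  qed
  have bdd: "bdd_above B" by (rule bdd_aboveI[of _ "ln 2"]) (rule up)
  show "0 \<notin> global_maximizers \<beta> 0 p" if "\<beta> > beta_tilde p"
    using that cSup_upper[OF _ bdd, of \<beta>] assms(2)
    unfolding zero_maximizer_iff[OF assms(1)] bt by (auto simp: B_def)
  show "0 \<in> global_maximizers \<beta> 0 p" if \<beta>: "\<beta> = beta_tilde p"
    unfolding zero_maximizer_iff[OF assms(1)]
  proof
    fix x :: real assume x: "x \<in> {-1..1}"
    have lin: "H b 0 p x = b * x ^ p + H 0 0 p x" for b by (simp add: H_def)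
    \<comment> \<open>Add the inequalities t ln t \<ge> t - 1 for t = 1 + y and t = 1 - y.\<close>
    have I: "I_fun y \<ge> 0" if "y \<in> {-1..1}" for y :: real
    proof -
      have "t * ln t \<ge> t - 1" if "t \<ge> 0" for t :: real
      proof (cases "t = 0")
        case False
        then have "t * ln (1 / t) \<le> t * (1 / t - 1)" using that by (intro mult_left_mono ln_le_minus_one) auto
        then show ?thesis using that False by (simp add: ln_div algebra_simps)
      qed auto
      from this[of "1 + y"] this[of "1 - y"] show ?thesis using that unfolding I_fun_def by auto
    qed
    have ne: "B \<noteq> {}" using I by (auto simp: B_def H_def intro!: exI[of _ 0])
    show "H \<beta> 0 p x \<le> 0"
    proof (cases "x ^ p > 0")
      case True
      have "Sup B \<le> - H 0 0 p x / x ^ p"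
      proof (rule cSup_least[OF ne])
        fix b assume "b \<in> B"
        then have "H b 0 p x \<le> 0" using x by (simp add: B_def)
        then have "b * x ^ p \<le> - H 0 0 p x" using lin[of b] by linarith
        then show "b \<le> - H 0 0 p x / x ^ p" by (subst pos_le_divide_eq[OF True])
      qed
      then have "\<beta> * x ^ p \<le> - H 0 0 p x" unfolding \<beta> bt by (subst (asm) pos_le_divide_eq[OF True])
      then show ?thesis using lin[of \<beta>] by linarith
    next
      case False
      then have "\<beta> * x ^ p \<le> 0" using assms by (simp add: mult_nonneg_nonpos)
      then show ?thesis using I[OF x] by (simp add: H_def)
    qed
  qed
qed

section \<open>Laplace expansion of Gibbs sums\<close>

lemma integrable_gaussian:
  fixes b :: real assumes "b > 0" shows "integrable lborel (\<lambda>y. exp (- b * y\<^sup>2))"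
proof -
  define \<sigma> where "\<sigma> = sqrt (1 / (2 * b))"
  have \<sigma>: "\<sigma>\<^sup>2 = 1 / (2 * b)" using assms by (simp add: \<sigma>_def)
  have "integrable lborel (\<lambda>y. sqrt (2 * pi * \<sigma>\<^sup>2) * normal_density 0 \<sigma> y)"
    using assms by (intro integrable_mult_right integrable_normal_density) (simp add: \<sigma>_def)
  also have "(\<lambda>y. sqrt (2 * pi * \<sigma>\<^sup>2) * normal_density 0 \<sigma> y) = (\<lambda>y. exp (- b * y\<^sup>2))"
    using assms by (simp add: normal_density_def fun_eq_iff \<sigma>)
  finally show ?thesis .
qed

lemma H_quadratic_bound:
  assumes "\<bar>m\<bar> < 1" "H1 \<beta> h p m = 0" "H2 \<beta> h p m < 0"
  obtains c \<epsilon> where "c > 0" "\<epsilon> > 0" "\<bar>m\<bar> + \<epsilon> < 1"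
    "\<And>x. \<bar>x - m\<bar> \<le> \<epsilon> \<Longrightarrow> H \<beta> h p x \<le> H \<beta> h p m - c * (x - m)\<^sup>2"
proof -
  have "\<forall>\<^sub>F \<xi> in at m. H2 \<beta> h p \<xi> < H2 \<beta> h p m / 2"
    using isCont_H2[OF assms(1), of \<beta> h p] assms(3) by (intro order_tendstoD(2)) (auto simp: isCont_def)
  then obtain d where d: "d > 0" "\<And>\<xi>. \<xi> \<noteq> m \<Longrightarrow> \<bar>\<xi> - m\<bar> < d \<Longrightarrow> H2 \<beta> h p \<xi> < H2 \<beta> h p m / 2"
    unfolding eventually_at dist_real_def by auto
  define \<epsilon> where "\<epsilon> = min (d / 2) ((1 - \<bar>m\<bar>) / 2)"
  have \<epsilon>: "\<epsilon> > 0" "\<bar>m\<bar> + \<epsilon> < 1" "\<epsilon> < d" using d(1) assms(1) by (auto simp: \<epsilon>_def min_def field_simps)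
  show ?thesis
  \<comment> \<open>Near m, H'' stays below half its value at m, and the factor 1/2 in Taylor's
    formula halves this again; hence the quarter.\<close>
  proof (rule that[of "- H2 \<beta> h p m / 4" \<epsilon>])
    fix x assume x: "\<bar>x - m\<bar> \<le> \<epsilon>"
    have x1: "\<bar>x\<bar> < 1" using x \<epsilon> by linarith
    obtain \<xi> where \<xi>: "\<bar>\<xi> - m\<bar> \<le> \<bar>x - m\<bar>"
      "H \<beta> h p x = H \<beta> h p m + H1 \<beta> h p m * (x - m) + H2 \<beta> h p \<xi> / 2 * (x - m)\<^sup>2"
      using H_Taylor[OF assms(1) x1] by metis
    have "H2 \<beta> h p \<xi> \<le> H2 \<beta> h p m / 2"
      using d(2)[of \<xi>] \<xi>(1) x \<epsilon> assms(3) by (cases "\<xi> = m") auto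
    then have "H2 \<beta> h p \<xi> / 2 * (x - m)\<^sup>2 \<le> H2 \<beta> h p m / 2 / 2 * (x - m)\<^sup>2"
      by (intro mult_right_mono divide_right_mono) auto
    then show "H \<beta> h p x \<le> H \<beta> h p m - (- H2 \<beta> h p m / 4) * (x - m)\<^sup>2"
      using \<xi>(2) assms(2) by simp
  qed (use \<epsilon> assms in auto)
qed

lemma tendsto_of_scaled:
  assumes "(\<lambda>N. sqrt (real N) * (x N - m)) \<longlonglongrightarrow> y"
  shows "x \<longlonglongrightarrow> m"
proof -
  have "(\<lambda>N. 1 / sqrt (real N)) \<longlonglongrightarrow> 0"
    by (intro tendsto_divide_0[OF tendsto_const] filterlim_compose[OF sqrt_at_top] filterlim_at_top_imp_at_infinity filterlim_real_sequentially)
  from tendsto_add[OF tendsto_mult[OF this assms] tendsto_const[of m]]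
  have "(\<lambda>N. 1 / sqrt (real N) * (sqrt (real N) * (x N - m)) + m) \<longlonglongrightarrow> m" by simp
  moreover have "\<forall>\<^sub>F N in sequentially. 1 / sqrt (real N) * (sqrt (real N) * (x N - m)) + m = x N"
    using eventually_gt_at_top[of 0] by eventually_elim simp
  ultimately show ?thesis by (rule Lim_transform_eventually)
qed

lemma H_second_order_limit:
  assumes m: "\<bar>m\<bar> < 1" "H1 \<beta> h p m = 0" and y: "(\<lambda>N. sqrt (real N) * (x N - m)) \<longlonglongrightarrow> y"
  shows "(\<lambda>N. real N * (H \<beta> h p (x N) - H \<beta> h p m)) \<longlonglongrightarrow> H2 \<beta> h p m * y\<^sup>2 / 2"
proof -
  have x: "x \<longlonglongrightarrow> m" by (rule tendsto_of_scaled[OF y])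
  \<comment> \<open>The expansion is demanded only when \<open>x N\<close> lies inside the interval,
    so that a suitable point exists for every \<open>N\<close> and can be chosen for all of
    them.\<close>
  have "\<exists>\<xi>. \<bar>\<xi> - m\<bar> \<le> \<bar>x N - m\<bar> \<and> (\<bar>x N\<bar> < 1 \<longrightarrow>
     H \<beta> h p (x N) = H \<beta> h p m + H1 \<beta> h p m * (x N - m) + H2 \<beta> h p \<xi> / 2 * (x N - m)\<^sup>2)" for N
  proof (cases "\<bar>x N\<bar> < 1")
    case True
    show ?thesis using H_Taylor[OF m(1) True, of \<beta> h p] by metis
  next
    case False
    then show ?thesis by auto
  qed
  then obtain \<xi> where \<xi>: "\<And>N. \<bar>\<xi> N - m\<bar> \<le> \<bar>x N - m\<bar>"
     "\<And>N. \<bar>x N\<bar> < 1 \<Longrightarrow> H \<beta> h p (x N) = H \<beta> h p m + H1 \<beta> h p m * (x N - m) + H2 \<beta> h p (\<xi> N) / 2 * (x N - m)\<^sup>2"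
    by metis
  have "(\<lambda>N. \<bar>x N - m\<bar>) \<longlonglongrightarrow> 0" using x LIM_zero tendsto_rabs_zero by blast
  then have "(\<lambda>N. \<xi> N - m) \<longlonglongrightarrow> 0"
    by (rule Lim_null_comparison[rotated]) (simp add: \<xi>(1))
  then have "\<xi> \<longlonglongrightarrow> m" by (rule LIM_zero_cancel)
  then have "(\<lambda>N. H2 \<beta> h p (\<xi> N)) \<longlonglongrightarrow> H2 \<beta> h p m" by (rule isCont_tendsto_compose[OF isCont_H2[OF m(1)]])
  then have "(\<lambda>N. H2 \<beta> h p (\<xi> N) * (sqrt (real N) * (x N - m))\<^sup>2 / 2) \<longlonglongrightarrow> H2 \<beta> h p m * y\<^sup>2 / 2"
    by (intro tendsto_intros y) auto
  moreover have "\<forall>\<^sub>F N in sequentially. H2 \<beta> h p (\<xi> N) * (sqrt (real N) * (x N - m))\<^sup>2 / 2 = real N * (H \<beta> h p (x N) - H \<beta> h p m)"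
  proof -
    have "\<forall>\<^sub>F N in sequentially. \<bar>x N\<bar> < 1"
      using tendsto_rabs[OF x] m(1) by (rule order_tendstoD)
    then show ?thesis
      by eventually_elim (simp add: \<xi>(2) m(2) power_mult_distrib)
  qed
  ultimately show ?thesis by (rule Lim_transform_eventually)
qed

section \<open>Sums over the grid as integrals of step functions\<close>

lemma sum_eq_integral_steps:
  fixes G :: "nat \<Rightarrow> real"
  assumes "finite K"
  shows "(\<integral>z. (\<Sum>k\<in>K. indicator {real k..<real k + 1} z * G k) \<partial>lborel) = (\<Sum>k\<in>K. G k)"
proof -
  have "(\<integral>z. (\<Sum>k\<in>K. indicator {real k..<real k + 1} z * G k) \<partial>lborel)
    = (\<Sum>k\<in>K. \<integral>z. indicator {real k..<real k + 1} z * G k \<partial>lborel)"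
    by (rule Bochner_Integration.integral_sum) auto
  then show ?thesis by simp
qed

text \<open>At each z at most one step is active, that of the floor of z. The guard on the sign of z
  matters because \<open>nat\<close> sends negative floors to 0.\<close>

lemma steps_eq:
  fixes G :: "nat \<Rightarrow> real"
  assumes "finite K"
  shows "(\<Sum>k\<in>K. indicator {real k..<real k + 1} z * G k) = (if z \<ge> 0 \<and> nat \<lfloor>z\<rfloor> \<in> K then G (nat \<lfloor>z\<rfloor>) else 0)"
proof -
  have *: "indicator {real k..<real k + 1} z = (if z \<ge> 0 \<and> k = nat \<lfloor>z\<rfloor> then 1 else 0 :: real)" for k
    by (auto simp: indicator_def) linarith+
  have "(\<Sum>k\<in>K. indicator {real k..<real k + 1} z * G k) = (\<Sum>k\<in>K. if k = nat \<lfloor>z\<rfloor> then (if z \<ge> 0 then G k else 0) else 0)"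
    by (intro sum.cong refl) (auto simp: *)
  then show ?thesis using assms by (simp add: sum.delta)
qed

text \<open>The contribution to \<open>CW_Z\<close> of all configurations with exactly
  \<open>k\<close> spins equal to \<open>+1\<close>.\<close>

definition CW_term :: "real \<Rightarrow> real \<Rightarrow> nat \<Rightarrow> nat \<Rightarrow> nat \<Rightarrow> real" where
  "CW_term \<beta> h p N k = real (N choose k) / 2 ^ N * exp (real N * (\<beta> * grid N k ^ p + h * grid N k))"

lemma CW_term_le:
  assumes "k \<le> N" "N > 0"
  shows "CW_term \<beta> h p N k \<le> exp (real N * H \<beta> h p (grid N k))"
proof -
  have "CW_term \<beta> h p N k \<le> exp (- real N * I_fun (grid N k)) * exp (real N * (\<beta> * grid N k ^ p + h * grid N k))"
    unfolding CW_term_def using binomial_le_exp_I_fun[OF assms] by (intro mult_right_mono) auto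
  also have "\<dots> = exp (real N * H \<beta> h p (grid N k))"
    by (simp add: H_def exp_add[symmetric] algebra_simps)
  finally show ?thesis .
qed

lemma grid_bounds:
  assumes "N > 0" "\<bar>grid N k\<bar> < 1" shows "0 < k" "k < N"
proof -
  have "\<bar>2 * real k - real N\<bar> < real N"
    using assms by (simp add: grid_def abs_divide)
  then show "0 < k" "k < N" by auto
qed

text \<open>The factor sqrt N / 2 is the reciprocal mesh of the grid in the scale y = sqrt N (x -
  m), so this is the height of the step function in that scale.\<close>

lemma CW_term_stirling:
  assumes "N > 0" "\<bar>grid N k\<bar> < 1"
  shows "sqrt (real N) / 2 * CW_term \<beta> h p N k =
    stirling_ratio N / (stirling_ratio k * stirling_ratio (N - k)) / sqrt (1 - (grid N k)\<^sup>2) *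
    exp (real N * H \<beta> h p (grid N k))"
proof -
  note k = grid_bounds[OF assms]
  have e: "exp (real N * H \<beta> h p (grid N k)) =
    exp (- real N * I_fun (grid N k)) * exp (real N * (\<beta> * grid N k ^ p + h * grid N k))"
    by (simp add: H_def exp_add[symmetric] algebra_simps)
  show ?thesis
    unfolding CW_term_def binomial_stirling[OF k] e using assms(1) by simp
qed


text \<open>Rounding to the grid moves y by at most 2. A quarter of the quadratic term is spent on
  replacing u by y; the other three quarters absorb the resulting linear term (c + a) |u|.\<close>

lemma gaussian_majorant:
  fixes c a :: real
  assumes "c > 0" "\<bar>u - y\<bar> \<le> 2"
  shows "- c * u\<^sup>2 + a * \<bar>u\<bar> \<le> c + (c + a)\<^sup>2 / (3 * c) - (c / 4) * y\<^sup>2"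
proof -
  have "y\<^sup>2 \<le> (\<bar>u\<bar> + 2)\<^sup>2" using assms(2) by (intro power2_le_iff_abs_le[THEN iffD2]) auto
  then have "(c / 4) * y\<^sup>2 \<le> (c / 4) * (\<bar>u\<bar> + 2)\<^sup>2" using assms(1) by (intro mult_left_mono) auto
  moreover have "0 \<le> (3 * c / 4) * (\<bar>u\<bar> - 2 * (c + a) / (3 * c))\<^sup>2" using assms(1) by simp
  moreover have "(3 * c / 4) * (\<bar>u\<bar> - 2 * (c + a) / (3 * c))\<^sup>2
      = (3 * c / 4) * \<bar>u\<bar>\<^sup>2 - (c + a) * \<bar>u\<bar> + (c + a)\<^sup>2 / (3 * c)"
    using assms(1) by (simp add: power2_eq_square field_simps)
  moreover have "(c / 4) * (\<bar>u\<bar> + 2)\<^sup>2 = c * \<bar>u\<bar>\<^sup>2 / 4 + c * \<bar>u\<bar> + c"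
    by (simp add: power2_eq_square algebra_simps)
  ultimately show ?thesis by (simp add: algebra_simps)
qed

text \<open>The growth rate of g admits tilts of the field by t / sqrt N, and convergence for almost
  every y admits indicators with a moving threshold. Both are affordable because \<open>quad\<close>
  provides a Gaussian majorant.\<close>

lemma local_laplace:
  fixes g :: "nat \<Rightarrow> real \<Rightarrow> real" and f :: "real \<Rightarrow> real"
  assumes m: "\<bar>m\<bar> < 1" "H1 \<beta> h p m = 0" "H2 \<beta> h p m < 0"
    and c: "c > 0" and \<epsilon>: "\<epsilon> > 0" "\<bar>m\<bar> + \<epsilon> < 1"
    and quad: "\<And>x. \<bar>x - m\<bar> \<le> \<epsilon> \<Longrightarrow> H \<beta> h p x \<le> H \<beta> h p m - c * (x - m)\<^sup>2"
    and f: "f \<in> borel_measurable borel"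
    and A: "A \<ge> 0" "a \<ge> 0"
    and bound: "\<And>N x. N > 0 \<Longrightarrow> \<bar>x\<bar> \<le> 1 \<Longrightarrow> \<bar>g N x\<bar> \<le> A * exp (a * (sqrt (real N) * \<bar>x - m\<bar>))"
    and lim: "AE y in lborel. \<forall>x. (\<lambda>N. sqrt (real N) * (x N - m)) \<longlonglongrightarrow> y \<longrightarrow> (\<lambda>N. g N (x N)) \<longlonglongrightarrow> f y"
  shows "(\<lambda>N. \<Sum>k | k \<le> N \<and> \<bar>grid N k - m\<bar> \<le> \<epsilon>.
      CW_term \<beta> h p N k * exp (- real N * H \<beta> h p m) * g N (grid N k)) \<longlonglongrightarrow>
    1 / stirling_const / sqrt (1 - m\<^sup>2) * (\<integral>y. exp (H2 \<beta> h p m * y\<^sup>2 / 2) * f y \<partial>lborel)"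
proof -
  define C where "C = stirling_const"
  note C = stirling_const[folded C_def]
  define K where "K N = {k. k \<le> N \<and> \<bar>grid N k - m\<bar> \<le> \<epsilon>}" for N
  have fin: "finite (K N)" for N by (rule finite_subset[of _ "{..N}"]) (auto simp: K_def)
  define G where "G N k = CW_term \<beta> h p N k * exp (- real N * H \<beta> h p m) * g N (grid N k)" for N k
  \<comment> \<open>In the scale \<open>y = sqrt N (x - m)\<close> the sum is the integral of a step function with mesh \<open>2 / sqrt N\<close>,
    to which dominated convergence applies.\<close>
  define z where "z N y = real N * (1 + m) / 2 + sqrt (real N) / 2 * y" for N :: nat and y :: real
  define kk where "kk N y = nat \<lfloor>z N y\<rfloor>" for N y
  define s where "s N y = sqrt (real N) / 2 * (\<Sum>k\<in>K N. indicator {real k..<real k + 1} (z N y) * G N k)" for N y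
  define l where "l y = 1 / C / sqrt (1 - m\<^sup>2) * (exp (H2 \<beta> h p m * y\<^sup>2 / 2) * f y)" for y
  \<comment> \<open>\<open>R\<close> dominates the prefactor: the ratio in the numerator is at most
    its value at 1, those in the denominator are at least \<open>C\<close>, and \<bar>x\<bar> is at
    most \<bar>m\<bar> + \<epsilon>.\<close>
  define R where "R = stirling_ratio 1 / (C * C) / sqrt (1 - (\<bar>m\<bar> + \<epsilon>)\<^sup>2)"
  define w where "w y = R * A * exp (c + (c + a)\<^sup>2 / (3 * c)) * exp (- (c / 4) * y\<^sup>2)" for y
  have grid1: "\<bar>grid N k\<bar> < 1" if "k \<in> K N" for N k using that \<epsilon> by (auto simp: K_def)
  have s_eq: "s N y = (if z N y \<ge> 0 \<and> kk N y \<in> K N then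
      stirling_ratio N / (stirling_ratio (kk N y) * stirling_ratio (N - kk N y)) / sqrt (1 - (grid N (kk N y))\<^sup>2) *
      exp (real N * (H \<beta> h p (grid N (kk N y)) - H \<beta> h p m)) * g N (grid N (kk N y)) else 0)"
    if "N > 0" for N y
  proof (cases "z N y \<ge> 0 \<and> kk N y \<in> K N")
    case True
    have "exp (real N * (H \<beta> h p (grid N (kk N y)) - H \<beta> h p m))
        = exp (real N * H \<beta> h p (grid N (kk N y))) * exp (- real N * H \<beta> h p m)"
      by (simp add: exp_add[symmetric] algebra_simps)
    moreover have "s N y = (sqrt (real N) / 2 * CW_term \<beta> h p N (kk N y)) *
        exp (- real N * H \<beta> h p m) * g N (grid N (kk N y))"
      unfolding s_def steps_eq[OF fin] kk_def[symmetric] G_def using True by simp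
    ultimately show ?thesis
      using True CW_term_stirling[OF that grid1, of "kk N y" \<beta> h p] by (simp only: mult.assoc if_True simp_thms)
  qed (auto simp: s_def steps_eq[OF fin] kk_def[symmetric])
  \<comment> \<open>The index is rounded by at most 1, and one index step moves the grid by 2/N,
    that is by 2 / sqrt N after scaling.\<close>
  have close: "\<bar>sqrt (real N) * (grid N (kk N y) - m) - y\<bar> \<le> 2 / sqrt (real N)" if "N > 0" "z N y \<ge> 0" for N y
  proof -
    define fr where "fr = z N y - real (kk N y)"
    have fr: "0 \<le> fr" "fr \<le> 1" unfolding fr_def kk_def using that by (auto simp: of_nat_nat) linarith+
    have k: "real (kk N y) = z N y - fr" by (simp add: fr_def)
    have ss: "sqrt (real N) * sqrt (real N) = real N" by simp
    have "grid N (kk N y) - m = (sqrt (real N) * y - 2 * fr) / real N"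
      using that unfolding grid_def k z_def by (simp add: field_simps)
    also have "sqrt (real N) * \<dots> = (sqrt (real N) * sqrt (real N)) / real N * y - 2 * fr * (sqrt (real N) / real N)"
      by (simp add: algebra_simps diff_divide_distrib)
    also have "\<dots> = y - 2 * fr * (1 / sqrt (real N))"
      using that ss by (simp add: sqrt_divide_self_eq inverse_eq_divide)
    finally have "sqrt (real N) * (grid N (kk N y) - m) - y = - (fr * (2 / sqrt (real N)))" by simp
    moreover have "fr * (2 / sqrt (real N)) \<le> 1 * (2 / sqrt (real N))"
      using fr by (intro mult_right_mono) auto
    ultimately show ?thesis using fr by (simp add: abs_mult)
  qed
  have int_eq: "(\<Sum>k\<in>K N. G N k) = (\<integral>y. s N y \<partial>lborel)" if "N > 0" for N
  proof -
    have "(\<Sum>k\<in>K N. G N k) = (\<integral>z. (\<Sum>k\<in>K N. indicator {real k..<real k + 1} z * G N k) \<partial>lborel)"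
      by (rule sum_eq_integral_steps[symmetric, OF fin])
    also have "\<dots> = (\<integral>y. s N y \<partial>lborel)"
      using that unfolding s_def z_def
      by (subst lborel_integral_real_affine[where c="sqrt (real N) / 2" and t="real N * (1 + m) / 2"]) auto
    finally show ?thesis .
  qed
  have bnd: "\<bar>s N y\<bar> \<le> w y" if N: "N > 0" for N y
  proof (cases "z N y \<ge> 0 \<and> kk N y \<in> K N")
    case True
    define x u where "x = grid N (kk N y)" and "u = sqrt (real N) * (x - m)"
    have x: "\<bar>x - m\<bar> \<le> \<epsilon>" "\<bar>x\<bar> < 1" "\<bar>x\<bar> \<le> \<bar>m\<bar> + \<epsilon>" using True \<epsilon> by (auto simp: K_def x_def)
    note k = grid_bounds[OF N x(2)[unfolded x_def]]
    have "2 / sqrt (real N) \<le> 2 / 1" using N by (intro divide_left_mono) auto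
    then have uy: "\<bar>u - y\<bar> \<le> 2" using close[OF N, of y] True unfolding u_def x_def by auto
    have "x\<^sup>2 \<le> (\<bar>m\<bar> + \<epsilon>)\<^sup>2" using x(3) by (intro power2_le_iff_abs_le[THEN iffD2]) auto
    moreover have "(\<bar>m\<bar> + \<epsilon>)\<^sup>2 < 1" using \<epsilon> by (subst abs_square_less_1) auto
    ultimately have sq: "0 < sqrt (1 - (\<bar>m\<bar> + \<epsilon>)\<^sup>2)" "sqrt (1 - (\<bar>m\<bar> + \<epsilon>)\<^sup>2) \<le> sqrt (1 - x\<^sup>2)" by auto
    have sr: "0 < stirling_ratio N" "0 < stirling_ratio (kk N y)" "0 < stirling_ratio (N - kk N y)"
      "C \<le> stirling_ratio (kk N y)" "C \<le> stirling_ratio (N - kk N y)" "stirling_ratio N \<le> stirling_ratio 1"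
      using N k C(4)[OF N] by (auto intro!: stirling_ratio_pos C(3))
    have R0: "0 \<le> stirling_ratio 1 / (C * C)" using C(1) stirling_ratio_pos[of 1] by auto
    have "stirling_ratio N / (stirling_ratio (kk N y) * stirling_ratio (N - kk N y)) \<le> stirling_ratio 1 / (C * C)"
      using C(1) sr by (intro frac_le mult_mono mult_pos_pos) auto
    then have "stirling_ratio N / (stirling_ratio (kk N y) * stirling_ratio (N - kk N y)) / sqrt (1 - x\<^sup>2) \<le> R"
      unfolding R_def by (rule frac_le[OF R0 _ sq])
    moreover have "0 \<le> stirling_ratio N / (stirling_ratio (kk N y) * stirling_ratio (N - kk N y)) / sqrt (1 - x\<^sup>2)"
      using sr sq by auto
    moreover have "exp (real N * (H \<beta> h p x - H \<beta> h p m)) \<le> exp (- c * u\<^sup>2)"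
    proof -
      have "real N * (H \<beta> h p x - H \<beta> h p m) \<le> real N * (- c * (x - m)\<^sup>2)"
        using quad[OF x(1)] by (intro mult_left_mono) auto
      also have "\<dots> = - c * u\<^sup>2" by (simp add: u_def power_mult_distrib)
      finally show ?thesis by simp
    qed
    moreover have "\<bar>g N x\<bar> \<le> A * exp (a * \<bar>u\<bar>)"
      using bound[OF N, of x] x by (simp add: u_def abs_mult)
    ultimately have "\<bar>s N y\<bar> \<le> R * exp (- c * u\<^sup>2) * (A * exp (a * \<bar>u\<bar>))"
      unfolding s_eq[OF N] if_P[OF True] x_def[symmetric] abs_mult
      by (intro mult_mono) (auto simp: abs_of_nonneg)
    also have "\<dots> = R * A * exp (- c * u\<^sup>2 + a * \<bar>u\<bar>)" by (simp only: exp_add mult_ac)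
    also have "\<dots> \<le> R * A * exp (c + (c + a)\<^sup>2 / (3 * c) - (c / 4) * y\<^sup>2)"
    proof -
      have "R \<ge> 0" unfolding R_def using C sq stirling_ratio_pos[of 1]
        by (intro divide_nonneg_nonneg) auto
      then show ?thesis using A gaussian_majorant[OF c uy, of a] by (intro mult_left_mono) auto
    qed
    also have "\<dots> = w y" unfolding w_def diff_conv_add_uminus exp_add by simp
    finally show ?thesis .
  next
    case False
    have "R \<ge> 0" unfolding R_def using C stirling_ratio_pos[of 1] \<epsilon>
      by (intro divide_nonneg_nonneg) (auto simp: abs_square_le_1)
    then show ?thesis using False A unfolding s_eq[OF N] w_def by auto
  qed
  have ptw: "AE y in lborel. (\<lambda>N. s (Suc N) y) \<longlonglongrightarrow> l y"
    using lim
  proof eventually_elim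
    fix y assume gf: "\<forall>x. (\<lambda>N. sqrt (real N) * (x N - m)) \<longlonglongrightarrow> y \<longrightarrow> (\<lambda>N. g N (x N)) \<longlonglongrightarrow> f y"
    define x where "x N = grid N (kk N y)" for N
    have zN: "filterlim (\<lambda>N. z N y) at_top sequentially"
    proof -
      have "filterlim (\<lambda>N. sqrt (real N) * (y / 2 + (1 + m) / 2 * sqrt (real N))) at_top sequentially"
        using m(1) by (intro filterlim_at_top_mult_at_top filterlim_compose[OF sqrt_at_top] filterlim_real_sequentially
          filterlim_tendsto_add_at_top[OF tendsto_const] filterlim_tendsto_pos_mult_at_top[OF tendsto_const]) auto
      moreover have "sqrt (real N) * (y / 2 + (1 + m) / 2 * sqrt (real N)) = z N y" for N
        by (simp add: z_def algebra_simps)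
      ultimately show ?thesis by simp
    qed
    have z0: "\<forall>\<^sub>F N in sequentially. z N y \<ge> 0" using zN by (auto simp: filterlim_at_top)
    have xy: "(\<lambda>N. sqrt (real N) * (x N - m)) \<longlonglongrightarrow> y"
    proof (rule LIM_zero_cancel, rule Lim_null_comparison)
      show "\<forall>\<^sub>F N in sequentially. norm (sqrt (real N) * (x N - m) - y) \<le> 2 / sqrt (real N)"
        using z0 eventually_gt_at_top[of 0] by eventually_elim (simp add: close x_def)
      show "(\<lambda>N. 2 / sqrt (real N)) \<longlonglongrightarrow> 0"
        by (intro tendsto_divide_0[OF tendsto_const] filterlim_compose[OF sqrt_at_top] filterlim_at_top_imp_at_infinity filterlim_real_sequentially)
    qed
    have xm: "x \<longlonglongrightarrow> m" by (rule tendsto_of_scaled[OF xy])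
    have inK: "\<forall>\<^sub>F N in sequentially. \<bar>x N - m\<bar> \<le> \<epsilon> \<and> \<bar>x N\<bar> < 1"
    proof -
      have "\<forall>\<^sub>F N in sequentially. dist (x N) m < \<epsilon>" using xm \<epsilon>(1) by (rule tendstoD)
      then show ?thesis by eventually_elim (use \<epsilon> in \<open>auto simp: dist_real_def\<close>)
    qed
    have kk_top: "filterlim (\<lambda>N. kk N y) at_top sequentially"
      unfolding kk_def
      by (rule filterlim_compose[OF filterlim_nat_sequentially filterlim_compose[OF filterlim_floor_sequentially zN]])
    \<comment> \<open>All three Stirling ratios converge only if \<open>kk\<close> and
      \<open>N - kk\<close> both tend to infinity; here m < 1 enters.\<close>
    have Nkk_top: "filterlim (\<lambda>N. N - kk N y) at_top sequentially"
    proof -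
      have "filterlim (\<lambda>N. (1 - x N) / 2 * real N) at_top sequentially"
        using m(1) by (intro filterlim_tendsto_pos_mult_at_top[where c="(1 - m) / 2"] tendsto_intros xm filterlim_real_sequentially) auto
      moreover have "\<forall>\<^sub>F N in sequentially. (1 - x N) / 2 * real N = real (N - kk N y)"
        using inK eventually_gt_at_top[of 0]
      proof eventually_elim
        case (elim N)
        then have "real (N - kk N y) = real N - real (kk N y)"
          using grid_bounds[of N "kk N y"] by (simp add: x_def of_nat_diff)
        then show ?case using elim(2) by (simp add: x_def grid_def field_simps)
      qed
      ultimately have "filterlim (\<lambda>N. real (N - kk N y)) at_top sequentially"
        using filterlim_cong[OF refl refl] by fast
      then show ?thesis by (simp add: filterlim_sequentially_iff_filterlim_real)
    qed
    note SN = C(2) filterlim_compose[OF C(2) kk_top] filterlim_compose[OF C(2) Nkk_top]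
    have m2: "1 - m\<^sup>2 > 0" using m(1) by (simp add: abs_square_less_1)
    have "(\<lambda>N. stirling_ratio N / (stirling_ratio (kk N y) * stirling_ratio (N - kk N y)) / sqrt (1 - (x N)\<^sup>2) *
      exp (real N * (H \<beta> h p (x N) - H \<beta> h p m)) * g N (x N)) \<longlonglongrightarrow>
      C / (C * C) / sqrt (1 - m\<^sup>2) * exp (H2 \<beta> h p m * y\<^sup>2 / 2) * f y"
      using C(1) m2 by (intro tendsto_intros SN xm H_second_order_limit[OF m(1,2) xy] gf[rule_format, OF xy]) auto
    moreover have "\<forall>\<^sub>F N in sequentially. stirling_ratio N / (stirling_ratio (kk N y) * stirling_ratio (N - kk N y)) / sqrt (1 - (x N)\<^sup>2) *
      exp (real N * (H \<beta> h p (x N) - H \<beta> h p m)) * g N (x N) = s N y"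
      using inK z0 eventually_gt_at_top[of 0]
    proof eventually_elim
      case (elim N)
      then have "kk N y \<in> K N" using grid_bounds[of N "kk N y"] by (auto simp: K_def x_def)
      then show ?case using elim by (simp add: s_eq x_def)
    qed
    ultimately have "(\<lambda>N. s N y) \<longlonglongrightarrow> C / (C * C) / sqrt (1 - m\<^sup>2) * exp (H2 \<beta> h p m * y\<^sup>2 / 2) * f y"
      by (rule Lim_transform_eventually)
    then show "(\<lambda>N. s (Suc N) y) \<longlonglongrightarrow> l y" using C(1) by (intro LIMSEQ_Suc) (simp add: l_def)
  qed
  \<comment> \<open>The shift to \<open>Suc N\<close> supplies N > 0, which the majorant requires,
    at every index of the dominated sequence.\<close>
  have "(\<lambda>N. \<integral>y. s (Suc N) y \<partial>lborel) \<longlonglongrightarrow> (\<integral>y. l y \<partial>lborel)"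
  proof (rule integral_dominated_convergence[where w=w])
    show "l \<in> borel_measurable lborel" unfolding l_def using f by measurable
    show "s (Suc N) \<in> borel_measurable lborel" for N unfolding s_def z_def by measurable
    show "integrable lborel w" unfolding w_def using c
      by (intro integrable_mult_right integrable_gaussian) auto
    show "AE y in lborel. norm (s (Suc N) y) \<le> w y" for N using bnd by simp
  qed (rule ptw)
  then have "(\<lambda>N. \<Sum>k\<in>K (Suc N). G (Suc N) k) \<longlonglongrightarrow> (\<integral>y. l y \<partial>lborel)" by (simp add: int_eq)
  then have "(\<lambda>N. \<Sum>k\<in>K N. G N k) \<longlonglongrightarrow> (\<integral>y. l y \<partial>lborel)" by (rule LIMSEQ_imp_Suc)
  then show ?thesis unfolding K_def G_def l_def C_def by simp
qed

text \<open>Completing the square gives b sqrt N \<le> \<eta> N / 2 + b^2 / (2 \<eta>), which leaves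
  half of the exponential rate to beat the factor N + 1.\<close>

lemma linear_exp_decay:
  assumes "\<eta> > 0"
  shows "(\<lambda>N. real (N + 1) * exp (- \<eta> * real N + b * sqrt (real N))) \<longlonglongrightarrow> 0"
proof -
  define q where "q = exp (- \<eta> / 2)"
  have q: "norm q < 1" using assms by (simp add: q_def)
  have "(\<lambda>N. exp (b\<^sup>2 / (2 * \<eta>)) * (real N * q ^ N + q ^ N)) \<longlonglongrightarrow> exp (b\<^sup>2 / (2 * \<eta>)) * (0 + 0)"
    by (intro tendsto_intros powser_times_n_limit_0[OF q] LIMSEQ_power_zero[OF q])
  then have *: "(\<lambda>N. exp (b\<^sup>2 / (2 * \<eta>)) * (real N * q ^ N + q ^ N)) \<longlonglongrightarrow> 0" by simp
  show ?thesis
  proof (rule Lim_null_comparison[OF _ *], rule always_eventually, rule allI)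
    fix N
    have "0 \<le> (\<eta> / 2) * (sqrt (real N) - b / \<eta>)\<^sup>2" using assms by simp
    also have "\<dots> = \<eta> / 2 * (sqrt (real N))\<^sup>2 - b * sqrt (real N) + b\<^sup>2 / (2 * \<eta>)"
      using assms by (simp add: power2_eq_square field_simps)
    also have "(sqrt (real N))\<^sup>2 = real N" by simp
    finally have "- \<eta> * real N + b * sqrt (real N) \<le> b\<^sup>2 / (2 * \<eta>) + real N * (- \<eta> / 2)"
      by (simp add: algebra_simps)
    then have "exp (- \<eta> * real N + b * sqrt (real N)) \<le> exp (b\<^sup>2 / (2 * \<eta>)) * q ^ N"
      unfolding q_def exp_of_nat_mult[symmetric] exp_add[symmetric] by simp
    then have "real (N + 1) * exp (- \<eta> * real N + b * sqrt (real N)) \<le> real (N + 1) * (exp (b\<^sup>2 / (2 * \<eta>)) * q ^ N)"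
      by (intro mult_left_mono) auto
    then show "norm (real (N + 1) * exp (- \<eta> * real N + b * sqrt (real N))) \<le> exp (b\<^sup>2 / (2 * \<eta>)) * (real N * q ^ N + q ^ N)"
      by (simp add: algebra_simps)
  qed
qed

lemma grid_abs_le: "k \<le> N \<Longrightarrow> \<bar>grid N k\<bar> \<le> 1"
  by (cases "N = 0") (auto simp: grid_def abs_divide divide_le_eq abs_le_iff)

lemma CW_term_nonneg: "CW_term \<beta> h p N k \<ge> 0"
  by (simp add: CW_term_def)

text \<open>The points at distance at least \<epsilon> from all maximizers form a compact set, on
  which H attains its largest value, strictly below the maximum. If that set is empty, any gap will
  do.\<close>

lemma H_gap:
  assumes M: "m0 \<in> global_maximizers \<beta> h p" and \<epsilon>: "\<epsilon> > 0"
  obtains \<eta> where "\<eta> > 0" "\<And>x. \<bar>x\<bar> \<le> 1 \<Longrightarrow> (\<And>m. m \<in> global_maximizers \<beta> h p \<Longrightarrow> \<bar>x - m\<bar> \<ge> \<epsilon>) \<Longrightarrow> H \<beta> h p x \<le> H \<beta> h p m0 - \<eta>"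
proof -
  let ?M = "global_maximizers \<beta> h p"
  define X where "X = {-1..1} - (\<Union>m\<in>?M. ball m \<epsilon>)"
  have X: "x \<in> X \<longleftrightarrow> \<bar>x\<bar> \<le> 1 \<and> (\<forall>m\<in>?M. \<bar>x - m\<bar> \<ge> \<epsilon>)" for x
    by (auto simp: X_def dist_real_def abs_le_iff)
  have cX: "compact X" unfolding X_def by (intro compact_diff) auto
  show ?thesis
  proof (cases "X = {}")
    case True
    then show ?thesis using X by (intro that[of 1]) auto
  next
    case False
    have "continuous_on X (H \<beta> h p)" by (rule continuous_on_subset[OF continuous_on_H]) (auto simp: X_def)
    then obtain x0 where x0: "x0 \<in> X" "\<And>x. x \<in> X \<Longrightarrow> H \<beta> h p x \<le> H \<beta> h p x0"
      using continuous_attains_sup[OF cX False] by blast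
    have "H \<beta> h p x0 < H \<beta> h p m0"
    proof (rule ccontr)
      assume n: "\<not> ?thesis"
      have "x0 \<in> ?M" using x0(1) M n by (force simp: X global_maximizers_def abs_le_iff)
      then show False using x0(1) \<epsilon> X by force
    qed
    then show ?thesis using x0 X by (intro that[of "H \<beta> h p m0 - H \<beta> h p x0"]) auto
  qed
qed

text \<open>Grid points near the maximizers form disjoint groups treated by
  \<open>local_laplace\<close>. At most N + 1 points remain, and the gap \<eta> beats their number
  and the growth of g. The growth bound is required around every maximizer because each group is
  measured from its own centre.\<close>

theorem laplace_sum:
  fixes g :: "nat \<Rightarrow> real \<Rightarrow> real" and f :: "real \<Rightarrow> real \<Rightarrow> real" and \<beta> h :: real and p :: nat
  defines "M \<equiv> global_maximizers \<beta> h p"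
  assumes fin: "finite M" and m0: "m0 \<in> M" and neg: "\<forall>m\<in>M. H2 \<beta> h p m < 0"
    and f: "\<And>m. m \<in> M \<Longrightarrow> f m \<in> borel_measurable borel"
    and A: "A \<ge> 0" "a \<ge> 0"
    and bound: "\<And>N x m. m \<in> M \<Longrightarrow> N > 0 \<Longrightarrow> \<bar>x\<bar> \<le> 1 \<Longrightarrow> \<bar>g N x\<bar> \<le> A * exp (a * (sqrt (real N) * \<bar>x - m\<bar>))"
    and lim: "\<And>m. m \<in> M \<Longrightarrow> AE y in lborel. \<forall>x. (\<lambda>N. sqrt (real N) * (x N - m)) \<longlonglongrightarrow> y \<longrightarrow> (\<lambda>N. g N (x N)) \<longlonglongrightarrow> f m y"
  shows "(\<lambda>N. exp (- real N * H \<beta> h p m0) * (\<Sum>k\<le>N. CW_term \<beta> h p N k * g N (grid N k))) \<longlonglongrightarrow>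
    (\<Sum>m\<in>M. 1 / stirling_const / sqrt (1 - m\<^sup>2) * (\<integral>y. exp (H2 \<beta> h p m * y\<^sup>2 / 2) * f m y \<partial>lborel))"
proof -
  have m1: "\<bar>m\<bar> < 1" and H1m: "H1 \<beta> h p m = 0" if "m \<in> M" for m
    using that global_maximizer_interior global_maximizer_H1 by (auto simp: M_def)
  have S: "H \<beta> h p m = H \<beta> h p m0" if "m \<in> M" for m
    using that m0 by (auto simp: M_def global_maximizers_def intro!: antisym)
  have "\<forall>m\<in>M. \<exists>c e. c > 0 \<and> e > 0 \<and> \<bar>m\<bar> + e < 1 \<and> (\<forall>x. \<bar>x - m\<bar> \<le> e \<longrightarrow> H \<beta> h p x \<le> H \<beta> h p m - c * (x - m)\<^sup>2)"
  proof
    fix m assume m: "m \<in> M"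
    show "\<exists>c e. c > 0 \<and> e > 0 \<and> \<bar>m\<bar> + e < 1 \<and> (\<forall>x. \<bar>x - m\<bar> \<le> e \<longrightarrow> H \<beta> h p x \<le> H \<beta> h p m - c * (x - m)\<^sup>2)"
      by (rule H_quadratic_bound[OF m1[OF m] H1m[OF m] bspec[OF neg m]]) blast
  qed
  then obtain c e where ce: "\<And>m. m \<in> M \<Longrightarrow> c m > 0" "\<And>m. m \<in> M \<Longrightarrow> e m > 0" "\<And>m. m \<in> M \<Longrightarrow> \<bar>m\<bar> + e m < 1"
    "\<And>m x. m \<in> M \<Longrightarrow> \<bar>x - m\<bar> \<le> e m \<Longrightarrow> H \<beta> h p x \<le> H \<beta> h p m - c m * (x - m)\<^sup>2"
    by metis
  have "\<forall>m. \<exists>d>0. \<forall>x\<in>M. x \<noteq> m \<longrightarrow> d \<le> dist m x" using finite_set_avoid[OF fin] by blast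
  then obtain d where d: "\<And>m. d m > 0" "\<And>m x. x \<in> M \<Longrightarrow> x \<noteq> m \<Longrightarrow> d m \<le> dist m x" by metis
  \<comment> \<open>A third of the separation keeps the groups disjoint: a common point would put
    two centres within 2 \<epsilon> < d m.\<close>
  define \<epsilon> where "\<epsilon> = Min ((\<lambda>m. min (e m) (d m / 3)) ` M)"
  have \<epsilon>le: "\<epsilon> \<le> e m" "\<epsilon> \<le> d m / 3" if "m \<in> M" for m
    using that fin Min_le[of "(\<lambda>m. min (e m) (d m / 3)) ` M" "min (e m) (d m / 3)"] by (auto simp: \<epsilon>_def)
  have \<epsilon>: "\<epsilon> > 0" using fin m0 ce(2) d(1) by (subst \<epsilon>_def, subst Min_gr_iff) auto
  obtain \<eta> where \<eta>: "\<eta> > 0" "\<And>x. \<bar>x\<bar> \<le> 1 \<Longrightarrow> (\<And>m. m \<in> M \<Longrightarrow> \<bar>x - m\<bar> \<ge> \<epsilon>) \<Longrightarrow> H \<beta> h p x \<le> H \<beta> h p m0 - \<eta>"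
    using H_gap[OF m0[unfolded M_def] \<epsilon>] unfolding M_def by blast
  define T where "T N k = CW_term \<beta> h p N k * exp (- real N * H \<beta> h p m0) * g N (grid N k)" for N k
  define K where "K m N = {k. k \<le> N \<and> \<bar>grid N k - m\<bar> \<le> \<epsilon>}" for m N
  define F where "F N = {k. k \<le> N \<and> (\<forall>m\<in>M. \<bar>grid N k - m\<bar> > \<epsilon>)}" for N
  have finK: "finite (K m N)" "finite (F N)" for m N
    by (auto simp: K_def F_def intro: finite_subset[of _ "{..N}"])
  have disj: "K m N \<inter> K m' N = {}" if "m \<in> M" "m' \<in> M" "m \<noteq> m'" for m m' N
  proof (rule ccontr)
    assume "\<not> ?thesis"
    then obtain k where "\<bar>grid N k - m\<bar> \<le> \<epsilon>" "\<bar>grid N k - m'\<bar> \<le> \<epsilon>" by (auto simp: K_def)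
    then have "dist m m' \<le> 2 * \<epsilon>" by (simp add: dist_real_def)
    also have "\<dots> < d m" using \<epsilon>le(2)[OF that(1)] \<epsilon> by simp
    finally show False using d(2)[of m' m] that by simp
  qed
  have split: "exp (- real N * H \<beta> h p m0) * (\<Sum>k\<le>N. CW_term \<beta> h p N k * g N (grid N k))
      = (\<Sum>m\<in>M. \<Sum>k\<in>K m N. T N k) + (\<Sum>k\<in>F N. T N k)" for N
  proof -
    have "exp (- real N * H \<beta> h p m0) * (\<Sum>k\<le>N. CW_term \<beta> h p N k * g N (grid N k)) = (\<Sum>k\<le>N. T N k)"
      by (simp add: T_def sum_distrib_left mult_ac)
    also have "\<dots> = (\<Sum>k\<in>(\<Union>m\<in>M. K m N) \<union> F N. T N k)"
      by (rule sum.cong) (auto simp: K_def F_def not_le)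
    also have "\<dots> = (\<Sum>k\<in>(\<Union>m\<in>M. K m N). T N k) + (\<Sum>k\<in>F N. T N k)"
      using fin finK by (intro sum.union_disjoint) (auto simp: K_def F_def)
    also have "(\<Sum>k\<in>(\<Union>m\<in>M. K m N). T N k) = (\<Sum>m\<in>M. \<Sum>k\<in>K m N. T N k)"
      using fin finK disj by (intro sum.UNION_disjoint) auto
    finally show ?thesis .
  qed
  have near: "(\<lambda>N. \<Sum>k\<in>K m N. T N k) \<longlonglongrightarrow>
      1 / stirling_const / sqrt (1 - m\<^sup>2) * (\<integral>y. exp (H2 \<beta> h p m * y\<^sup>2 / 2) * f m y \<partial>lborel)" if m: "m \<in> M" for m
    unfolding K_def T_def S[OF m, symmetric]
  proof (rule local_laplace[where c="c m" and A=A and a=a])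
    show "\<bar>m\<bar> + \<epsilon> < 1" using ce(3)[OF m] \<epsilon>le(1)[OF m] by simp
    show "H \<beta> h p x \<le> H \<beta> h p m - c m * (x - m)\<^sup>2" if "\<bar>x - m\<bar> \<le> \<epsilon>" for x
      using ce(4)[OF m] that \<epsilon>le(1)[OF m] by force
  qed (use m m1 H1m neg ce \<epsilon> f A bound lim in auto)
  have far: "(\<lambda>N. \<Sum>k\<in>F N. T N k) \<longlonglongrightarrow> 0"
  proof (rule Lim_null_comparison)
    show "(\<lambda>N. A * (real (N + 1) * exp (- \<eta> * real N + 2 * a * sqrt (real N)))) \<longlonglongrightarrow> 0"
      using tendsto_mult[OF tendsto_const linear_exp_decay[OF \<eta>(1)]] by fastforce
    show "\<forall>\<^sub>F N in sequentially. norm (\<Sum>k\<in>F N. T N k) \<le> A * (real (N + 1) * exp (- \<eta> * real N + 2 * a * sqrt (real N)))"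
      using eventually_gt_at_top[of 0]
    proof eventually_elim
      case (elim N)
      have "norm (T N k) \<le> A * exp (- \<eta> * real N + 2 * a * sqrt (real N))" if k: "k \<in> F N" for k
      proof -
        let ?x = "grid N k"
        have kN: "k \<le> N" and x1: "\<bar>?x\<bar> \<le> 1" using k grid_abs_le by (auto simp: F_def)
        have "real N * H \<beta> h p ?x \<le> real N * (H \<beta> h p m0 - \<eta>)"
          using k x1 by (intro mult_left_mono \<eta>(2)) (auto simp: F_def less_imp_le)
        then have "CW_term \<beta> h p N k \<le> exp (real N * (H \<beta> h p m0 - \<eta>))"
          using CW_term_le[OF kN elim, of \<beta> h p] by (meson exp_le_cancel_iff order_trans)
        then have 1: "CW_term \<beta> h p N k * exp (- real N * H \<beta> h p m0) \<le> exp (real N * (H \<beta> h p m0 - \<eta>)) * exp (- real N * H \<beta> h p m0)"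
          by (intro mult_right_mono) auto
        also have "\<dots> = exp (- \<eta> * real N)" by (simp add: exp_add[symmetric] algebra_simps)
        finally have 1: "CW_term \<beta> h p N k * exp (- real N * H \<beta> h p m0) \<le> exp (- \<eta> * real N)" .
        have "\<bar>?x - m0\<bar> \<le> 2" using x1 m1[OF m0] by linarith
        then have "a * (sqrt (real N) * \<bar>?x - m0\<bar>) \<le> a * (sqrt (real N) * 2)"
          using A by (intro mult_left_mono) auto
        then have "A * exp (a * (sqrt (real N) * \<bar>?x - m0\<bar>)) \<le> A * exp (2 * a * sqrt (real N))"
          using A by (intro mult_left_mono) (auto simp: mult_ac)
        with bound[OF m0 elim x1] have 2: "\<bar>g N ?x\<bar> \<le> A * exp (2 * a * sqrt (real N))" by linarith
        have "norm (T N k) = (CW_term \<beta> h p N k * exp (- real N * H \<beta> h p m0)) * \<bar>g N ?x\<bar>"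
          by (simp add: T_def abs_mult CW_term_nonneg)
        also have "\<dots> \<le> exp (- \<eta> * real N) * (A * exp (2 * a * sqrt (real N)))"
          by (intro mult_mono 1 2) auto
        also have "\<dots> = A * exp (- \<eta> * real N + 2 * a * sqrt (real N))" by (simp only: exp_add mult_ac)
        finally show ?thesis .
      qed
      then have "norm (\<Sum>k\<in>F N. T N k) \<le> real (card (F N)) * (A * exp (- \<eta> * real N + 2 * a * sqrt (real N)))"
        by (rule sum_norm_bound)
      also have "\<dots> \<le> real (N + 1) * (A * exp (- \<eta> * real N + 2 * a * sqrt (real N)))"
      proof (rule mult_right_mono)
        have "card (F N) \<le> card {..N}" by (rule card_mono) (auto simp: F_def)
        then show "real (card (F N)) \<le> real (N + 1)" by simp
      qed (use A in auto)
      finally show ?case by (simp only: mult_ac)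
    qed
  qed
  have "(\<lambda>N. (\<Sum>m\<in>M. \<Sum>k\<in>K m N. T N k) + (\<Sum>k\<in>F N. T N k)) \<longlonglongrightarrow>
    (\<Sum>m\<in>M. 1 / stirling_const / sqrt (1 - m\<^sup>2) * (\<integral>y. exp (H2 \<beta> h p m * y\<^sup>2 / 2) * f m y \<partial>lborel)) + 0"
    by (intro tendsto_add tendsto_sum near far)
  then show ?thesis unfolding split by simp
qed

section \<open>The likelihood equation\<close>

text \<open>Completing the square turns the integrand into a multiple of the normal density with
  mean t/a and variance 1/a. The quotient t/a of the two integrals is the shift of the magnetization
  caused by the tilt.\<close>

lemma gaussian_tilted_integrals:
  fixes a t :: real assumes a: "a > 0"
  shows "(\<integral>y. exp (- a * y\<^sup>2 / 2) * exp (t * y) \<partial>lborel) = sqrt (2 * pi / a) * exp (t\<^sup>2 / (2 * a))"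
    and "(\<integral>y. exp (- a * y\<^sup>2 / 2) * (y * exp (t * y)) \<partial>lborel) = t / a * (sqrt (2 * pi / a) * exp (t\<^sup>2 / (2 * a)))"
proof -
  define c where "c = sqrt (2 * pi / a) * exp (t\<^sup>2 / (2 * a))"
  have e: "exp (- a * y\<^sup>2 / 2) * exp (t * y) = c * normal_density (t / a) (1 / sqrt a) y" for y
  proof -
    have "- a * y\<^sup>2 / 2 + t * y = t\<^sup>2 / (2 * a) + - (y - t / a)\<^sup>2 / (2 * (1 / sqrt a)\<^sup>2)"
      using a by (simp add: power2_eq_square field_simps)
    moreover have "1 / sqrt (2 * pi * (1 / sqrt a)\<^sup>2) * sqrt (2 * pi / a) = 1"
      using a by (simp add: power_divide)
    ultimately show ?thesis unfolding normal_density_def c_def exp_add[symmetric]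
      by (simp add: exp_add[symmetric] mult.assoc[symmetric] mult.commute)
  qed
  have s: "1 / sqrt a > 0" using a by simp
  show "(\<integral>y. exp (- a * y\<^sup>2 / 2) * exp (t * y) \<partial>lborel) = sqrt (2 * pi / a) * exp (t\<^sup>2 / (2 * a))"
    unfolding e using integral_normal_density[OF s] by (simp add: c_def)
  have e': "exp (- a * y\<^sup>2 / 2) * (y * exp (t * y)) = c * (normal_density (t / a) (1 / sqrt a) y * y)" for y
    using e[of y] by (simp add: mult_ac)
  show "(\<integral>y. exp (- a * y\<^sup>2 / 2) * (y * exp (t * y)) \<partial>lborel) = t / a * (sqrt (2 * pi / a) * exp (t\<^sup>2 / (2 * a)))"
    unfolding e' using integral_normal_moment_nz_1[OF s, of "t / a"] by (simp add: c_def)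
qed

lemma cdf_normal_law:
  "measure (normal_law a) {..t} = (\<integral>z. normal_density 0 (sqrt a) z * indicator {..t} z \<partial>lborel)"
proof -
  have "emeasure (normal_law a) {..t} = (\<integral>\<^sup>+z. ennreal (normal_density 0 (sqrt a) z * indicator {..t} z) \<partial>lborel)"
    unfolding normal_law_def
    by (subst emeasure_density) (auto intro!: nn_integral_cong simp: indicator_def)
  then show ?thesis unfolding measure_def
    by (subst integral_eq_nn_integral) (auto intro!: arg_cong[where f=enn2real])
qed

text \<open>The substitution z = a y turns the fluctuations of the mean, of variance 1/a, into a
  normal law of variance a.\<close>

lemma gaussian_partial_integral:
  fixes a t :: real assumes a: "a > 0"
  shows "(\<integral>y. exp (- a * y\<^sup>2 / 2) * (if y \<le> t / a then 1 else 0) \<partial>lborel)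
    = sqrt (2 * pi / a) * measure (normal_law a) {..t}"
proof -
  have "measure (normal_law a) {..t} = a * (\<integral>y. normal_density 0 (sqrt a) (0 + a * y) * indicator {..t} (0 + a * y) \<partial>lborel)"
    unfolding cdf_normal_law using a by (subst lborel_integral_real_affine[where c=a and t=0]) auto
  also have "\<dots> = (\<integral>y. a * (normal_density 0 (sqrt a) (0 + a * y) * indicator {..t} (0 + a * y)) \<partial>lborel)"
    by simp
  also have "\<dots> = (\<integral>y. sqrt (a / (2 * pi)) * (exp (- a * y\<^sup>2 / 2) * (if y \<le> t / a then 1 else 0)) \<partial>lborel)"
  proof (rule Bochner_Integration.integral_cong[OF refl])
    fix y
    have sq: "a / sqrt (2 * pi * a) = sqrt (a / (2 * pi))"
      using a by (simp add: real_sqrt_mult real_sqrt_divide field_simps)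
    have nd: "normal_density 0 (sqrt a) (0 + a * y) = 1 / sqrt (2 * pi * a) * exp (- a * y\<^sup>2 / 2)"
      using a by (simp add: normal_density_def power2_eq_square)
    have ind: "indicator {..t} (0 + a * y) = (if y \<le> t / a then 1 else 0 :: real)"
      using a by (simp add: indicator_def pos_le_divide_eq mult.commute)
    show "a * (normal_density 0 (sqrt a) (0 + a * y) * indicator {..t} (0 + a * y)) =
        sqrt (a / (2 * pi)) * (exp (- a * y\<^sup>2 / 2) * (if y \<le> t / a then 1 else 0))"
      unfolding nd ind sq[symmetric] by simp
  qed
  also have "\<dots> = sqrt (a / (2 * pi)) * (\<integral>y. exp (- a * y\<^sup>2 / 2) * (if y \<le> t / a then 1 else 0) \<partial>lborel)"
    by simp
  finally have "sqrt (2 * pi / a) * measure (normal_law a) {..t} =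
     (sqrt (2 * pi / a) * sqrt (a / (2 * pi))) * (\<integral>y. exp (- a * y\<^sup>2 / 2) * (if y \<le> t / a then 1 else 0) \<partial>lborel)"
    by simp
  also have "sqrt (2 * pi / a) * sqrt (a / (2 * pi)) = 1" using a by (simp add: real_sqrt_mult[symmetric])
  finally show ?thesis by simp
qed

section \<open>The law of the mean magnetization as a sum over levels\<close>

lemma CW_term_pos: "k \<le> N \<Longrightarrow> CW_term \<beta> h p N k > 0"
  by (simp add: CW_term_def)

lemma CW_term_sum_pos: "(\<Sum>k\<le>N. CW_term \<beta> h p N k) > 0"
  by (intro sum_pos) (auto simp: CW_term_pos)

lemma CW_term_tilt:
  "CW_term \<beta> (h + s) p N k = CW_term \<beta> h p N k * exp (real N * s * grid N k)"
  by (simp add: CW_term_def exp_add[symmetric] algebra_simps)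

lemma CW_sum:
  assumes "N > 0"
  shows "(\<Sum>x\<in>cfgs N. CW_weight \<beta> h p N x * G (mean N x)) = 2 ^ N * (\<Sum>k\<le>N. CW_term \<beta> h p N k * G (grid N k))"
proof -
  have "(\<Sum>x\<in>cfgs N. CW_weight \<beta> h p N x * G (mean N x)) =
    (\<Sum>x\<in>cfgs N. (\<lambda>v. exp (real N * (\<beta> * v ^ p + h * v)) * G v) (mean N x))"
    by (simp add: CW_weight_def)
  also have "\<dots> = (\<Sum>k\<le>N. real (N choose k) * (exp (real N * (\<beta> * grid N k ^ p + h * grid N k)) * G (grid N k)))"
    by (rule sum_cfgs[OF assms])
  also have "\<dots> = 2 ^ N * (\<Sum>k\<le>N. CW_term \<beta> h p N k * G (grid N k))"
    by (simp add: CW_term_def sum_distrib_left mult.assoc)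
  finally show ?thesis .
qed

lemma CW_Z_eq: "N > 0 \<Longrightarrow> CW_Z \<beta> h p N = (\<Sum>k\<le>N. CW_term \<beta> h p N k)"
  using CW_sum[of N \<beta> h p "\<lambda>_. 1"] by (simp add: CW_Z_def)

lemma CW_prob_sum:
  assumes "N > 0"
  shows "(\<Sum>x\<in>cfgs N. CW_prob \<beta> h p N x * G (mean N x)) =
    (\<Sum>k\<le>N. CW_term \<beta> h p N k * G (grid N k)) / (\<Sum>k\<le>N. CW_term \<beta> h p N k)"
proof -
  have "(\<Sum>x\<in>cfgs N. CW_prob \<beta> h p N x * G (mean N x)) =
    (\<Sum>x\<in>cfgs N. CW_weight \<beta> h p N x * G (mean N x)) / (2 ^ N * CW_Z \<beta> h p N)"
    by (simp add: CW_prob_def sum_divide_distrib)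
  then show ?thesis unfolding CW_sum[OF assms] CW_Z_eq[OF assms] by simp
qed

lemma finite_cfgs: "finite (cfgs N)"
  unfolding cfgs_def by (intro finite_PiE) auto

lemma CW_prob_nonneg: "CW_prob \<beta> h p N x \<ge> 0"
  unfolding CW_prob_def CW_Z_def CW_weight_def by (auto intro!: divide_nonneg_nonneg mult_nonneg_nonneg sum_nonneg)

lemma measure_CW:
  assumes "N > 0"
  shows "measure (CW_measure \<beta> h p N) {x \<in> cfgs N. P (mean N x)} =
    (\<Sum>k\<le>N. CW_term \<beta> h p N k * (if P (grid N k) then 1 else 0)) / (\<Sum>k\<le>N. CW_term \<beta> h p N k)"
proof -
  have "measure (CW_measure \<beta> h p N) {x \<in> cfgs N. P (mean N x)} = (\<Sum>x | x \<in> cfgs N \<and> P (mean N x). CW_prob \<beta> h p N x)"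
    unfolding CW_measure_def measure_def
    by (subst emeasure_point_measure_finite) (auto simp: finite_cfgs CW_prob_nonneg sum_ennreal sum_nonneg)
  also have "\<dots> = (\<Sum>x\<in>cfgs N. CW_prob \<beta> h p N x * (if P (mean N x) then 1 else 0))"
    using finite_cfgs by (auto intro!: sum.mono_neutral_cong_left split: if_splits)
  finally show ?thesis using CW_prob_sum[OF assms, of \<beta> h p "\<lambda>v. if P v then 1 else 0"] by simp
qed

lemma CW_expect_mean_eq:
  assumes "N > 0"
  shows "CW_expect_mean \<beta> h p N = (\<Sum>k\<le>N. CW_term \<beta> h p N k * grid N k) / (\<Sum>k\<le>N. CW_term \<beta> h p N k)"
proof -
  have "CW_expect_mean \<beta> h p N = (\<Sum>x\<in>cfgs N. CW_prob \<beta> h p N x * mean N x)"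
    unfolding CW_expect_mean_def CW_measure_def
    by (subst lebesgue_integral_point_measure_finite) (auto simp: finite_cfgs CW_prob_nonneg)
  then show ?thesis using CW_prob_sum[OF assms, of \<beta> h p "\<lambda>v. v"] by simp
qed

text \<open>A positive multiple of the mean magnetization minus \<open>v\<close>, written so that every summand is
  nondecreasing in \<open>h\<close>.\<close>

definition score :: "real \<Rightarrow> nat \<Rightarrow> nat \<Rightarrow> real \<Rightarrow> real \<Rightarrow> real" where
  "score \<beta> p N v h = (\<Sum>k\<le>N. CW_term \<beta> 0 p N k * ((grid N k - v) * exp (real N * h * (grid N k - v))))"

text \<open>Multiplying the score by exp (N h v) gives (E - v) Z, where E is the expected mean at
  field h and Z > 0 the partition sum.\<close>

lemma score_sign:
  assumes "N > 0"
  shows "score \<beta> p N v h \<ge> 0 \<longleftrightarrow> v \<le> CW_expect_mean \<beta> h p N" "score \<beta> p N v h = 0 \<longleftrightarrow> CW_expect_mean \<beta> h p N = v"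
proof -
  let ?Z = "\<Sum>k\<le>N. CW_term \<beta> h p N k"
  have T: "CW_term \<beta> h p N k = CW_term \<beta> 0 p N k * exp (real N * h * grid N k)" for k
    using CW_term_tilt[of \<beta> 0 h p N k] by simp
  have "exp (real N * h * v) * score \<beta> p N v h = (\<Sum>k\<le>N. CW_term \<beta> h p N k * (grid N k - v))"
    unfolding score_def T sum_distrib_left
  proof (rule sum.cong[OF refl])
    fix k
    have "exp (real N * h * grid N k) = exp (real N * h * v) * exp (real N * h * (grid N k - v))"
      by (simp add: exp_add[symmetric] algebra_simps)
    then show "exp (real N * h * v) * (CW_term \<beta> 0 p N k * ((grid N k - v) * exp (real N * h * (grid N k - v)))) =
      CW_term \<beta> 0 p N k * exp (real N * h * grid N k) * (grid N k - v)" by simp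
  qed
  also have "\<dots> = (\<Sum>k\<le>N. CW_term \<beta> h p N k * grid N k) - v * ?Z"
    by (simp add: algebra_simps sum_subtractf sum_distrib_left)
  also have "\<dots> = (CW_expect_mean \<beta> h p N - v) * ?Z"
    using CW_term_sum_pos[of \<beta> h p N] unfolding CW_expect_mean_eq[OF assms] by (simp add: algebra_simps)
  finally have eq: "exp (real N * h * v) * score \<beta> p N v h = (CW_expect_mean \<beta> h p N - v) * ?Z" .
  define r where "r = ?Z / exp (real N * h * v)"
  have "score \<beta> p N v h = (CW_expect_mean \<beta> h p N - v) * r"
    using eq by (simp add: r_def field_simps)
  moreover have "r > 0" using CW_term_sum_pos[of \<beta> h p N] by (simp add: r_def)
  ultimately show "score \<beta> p N v h \<ge> 0 \<longleftrightarrow> v \<le> CW_expect_mean \<beta> h p N" "score \<beta> p N v h = 0 \<longleftrightarrow> CW_expect_mean \<beta> h p N = v"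
    by (auto simp: zero_le_mult_iff)
qed

section \<open>Monotonicity of the score, its root, and the estimate\<close>

lemma mult_exp_mono:
  fixes d :: real assumes "h \<le> h'" "n \<ge> 0"
  shows "d * exp (n * h * d) \<le> d * exp (n * h' * d)"
proof (cases "d \<ge> 0")
  case True
  then show ?thesis using assms by (intro mult_left_mono) (auto intro!: mult_right_mono mult_left_mono)
next
  case False
  then show ?thesis using assms by (intro mult_left_mono_neg) (auto intro!: mult_right_mono_neg mult_left_mono)
qed

text \<open>Every summand is nondecreasing in the field, so the increase of any single one bounds
  that of the sum from below. It is used at the extreme levels 0 and \<open>N\<close>, where the
  grid takes the values -1 and 1.\<close>

lemma score_diff:
  assumes "h \<le> h'" "j \<le> N"
  shows "score \<beta> p N v h' - score \<beta> p N v h \<ge>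
    CW_term \<beta> 0 p N j * ((grid N j - v) * exp (real N * h' * (grid N j - v)) - (grid N j - v) * exp (real N * h * (grid N j - v)))"
proof -
  let ?t = "\<lambda>h k. CW_term \<beta> 0 p N k * ((grid N k - v) * exp (real N * h * (grid N k - v)))"
  have mono: "?t h k \<le> ?t h' k" for k
    using assms(1) by (intro mult_left_mono mult_exp_mono CW_term_nonneg) auto
  have "?t h' j - ?t h j \<le> (\<Sum>k\<le>N. ?t h' k - ?t h k)"
  proof (rule member_le_sum[where f="\<lambda>k. ?t h' k - ?t h k"])
    show "0 \<le> ?t h' k - ?t h k" for k by (simp only: diff_ge_0_iff_ge mono)
  qed (use assms in auto)
  then show ?thesis by (simp add: score_def sum_subtractf right_diff_distrib)
qed

lemma grid_ends: "N > 0 \<Longrightarrow> grid N N = 1" "N > 0 \<Longrightarrow> grid N 0 = - 1"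
  by (simp_all add: grid_def)

lemma score_strict_mono:
  assumes "N > 0" "v < 1" "h < h'"
  shows "score \<beta> p N v h < score \<beta> p N v h'"
proof -
  have "real N * h * (1 - v) < real N * h' * (1 - v)" using assms by simp
  then have "0 < CW_term \<beta> 0 p N N * ((1 - v) * exp (real N * h' * (1 - v)) - (1 - v) * exp (real N * h * (1 - v)))"
    using assms by (intro mult_pos_pos CW_term_pos) auto
  then show ?thesis using score_diff[of h h' N N \<beta> p v] assms by (simp add: grid_ends)
qed

lemma score_root:
  assumes N: "N > 0" and v: "\<bar>v\<bar> < 1"
  obtains h where "score \<beta> p N v h = 0"
proof -
  define B where "B = \<bar>score \<beta> p N v 0\<bar>"
  \<comment> \<open>By exp s \<ge> 1 + s, the summand of level \<open>N\<close> gains at least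
    \<open>B\<close> between the fields 0 and \<open>hi\<close>, and that of level 0 loses at least
    \<open>B\<close> from 0 down to \<open>lo\<close>. So the score is nonnegative at
    \<open>hi\<close> and nonpositive at \<open>lo\<close>.\<close>
  define hi where "hi = B / (CW_term \<beta> 0 p N N * (1 - v)\<^sup>2 * real N)"
  define lo where "lo = - B / (CW_term \<beta> 0 p N 0 * (1 + v)\<^sup>2 * real N)"
  have T: "CW_term \<beta> 0 p N N > 0" "CW_term \<beta> 0 p N 0 > 0" by (auto intro: CW_term_pos)
  have v': "1 - v > 0" "1 + v > 0" using v by auto
  have hi0: "hi \<ge> 0" and lo0: "lo \<le> 0" using T by (auto simp: hi_def lo_def B_def intro!: divide_nonneg_nonneg divide_nonpos_nonneg)
  have "score \<beta> p N v hi - score \<beta> p N v 0 \<ge> CW_term \<beta> 0 p N N * ((1 - v) * exp (real N * hi * (1 - v)) - (1 - v))"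
    using score_diff[OF hi0, of N N \<beta> p v] N by (simp add: grid_ends)
  moreover have "CW_term \<beta> 0 p N N * ((1 - v) * exp (real N * hi * (1 - v)) - (1 - v)) \<ge>
      CW_term \<beta> 0 p N N * ((1 - v) * (1 + real N * hi * (1 - v)) - (1 - v))"
    using T v' by (intro mult_left_mono diff_right_mono exp_ge_add_one_self) auto
  moreover have "CW_term \<beta> 0 p N N * ((1 - v) * (1 + real N * hi * (1 - v)) - (1 - v)) = hi * (CW_term \<beta> 0 p N N * (1 - v)\<^sup>2 * real N)"
    by (simp add: power2_eq_square algebra_simps)
  moreover have "\<dots> = B" unfolding hi_def using T v' N by simp
  ultimately have up: "score \<beta> p N v hi \<ge> 0" by (simp add: B_def)
  have "score \<beta> p N v 0 - score \<beta> p N v lo \<ge> CW_term \<beta> 0 p N 0 * ((- 1 - v) - (- 1 - v) * exp (real N * lo * (- 1 - v)))"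
    using score_diff[OF lo0, of 0 N \<beta> p v] N by (simp add: grid_ends)
  moreover have "CW_term \<beta> 0 p N 0 * ((- 1 - v) - (- 1 - v) * exp (real N * lo * (- 1 - v))) \<ge>
      CW_term \<beta> 0 p N 0 * ((- 1 - v) - (- 1 - v) * (1 + real N * lo * (- 1 - v)))"
    using T v' by (intro mult_left_mono diff_left_mono mult_left_mono_neg exp_ge_add_one_self) auto
  moreover have "CW_term \<beta> 0 p N 0 * ((- 1 - v) - (- 1 - v) * (1 + real N * lo * (- 1 - v))) = - (lo * (CW_term \<beta> 0 p N 0 * (1 + v)\<^sup>2 * real N))"
    by (simp add: power2_eq_square algebra_simps)
  moreover have "\<dots> = B" unfolding lo_def using T v' N by simp
  ultimately have dn: "score \<beta> p N v lo \<le> 0" by (simp add: B_def)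
  have "continuous_on {lo..hi} (score \<beta> p N v)"
    unfolding score_def[abs_def] by (intro continuous_intros)
  from IVT'[OF dn up _ this] hi0 lo0 that show ?thesis by auto
qed

text \<open>\<open>hhat\<close> depends on the configuration only through its mean; this is that
  function of the mean.\<close>

definition hhat_of :: "real \<Rightarrow> nat \<Rightarrow> nat \<Rightarrow> real \<Rightarrow> real" where
  "hhat_of \<beta> p N v = (THE h. CW_expect_mean \<beta> h p N = v)"

text \<open>For an interior value v the score is strictly increasing and has a root, so the
  \<open>THE\<close> denotes this root, and its position relative to h is read off from the sign of
  the score at h.\<close>

lemma hhat_of_le_iff:
  assumes N: "N > 0" and v: "\<bar>v\<bar> < 1"
  shows "hhat_of \<beta> p N v \<le> h \<longleftrightarrow> v \<le> CW_expect_mean \<beta> h p N"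
proof -
  obtain h0 where h0: "score \<beta> p N v h0 = 0" using score_root[OF N v] .
  have sm: "strict_mono (score \<beta> p N v)"
    using score_strict_mono[OF N] v by (auto intro!: strict_monoI)
  have "hhat_of \<beta> p N v = h0"
    unfolding hhat_of_def score_sign(2)[OF N, symmetric]
    by (rule the_equality[of _ h0]) (use h0 strict_mono_eq[OF sm, of _ h0] in auto)
  then show ?thesis using strict_mono_less_eq[OF sm, of h0 h] h0 score_sign(1)[OF N, of \<beta> p v h] by simp
qed

lemma cdf_hhat_law:
  assumes "N > 0"
  shows "cdf (hhat_law \<beta> h p N) t =
    (\<Sum>k\<le>N. CW_term \<beta> h p N k * (if sqrt (real N) * (hhat_of \<beta> p N (grid N k) - h) \<le> t then 1 else 0)) /
    (\<Sum>k\<le>N. CW_term \<beta> h p N k)"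
proof -
  have "cdf (hhat_law \<beta> h p N) t = measure (CW_measure \<beta> h p N)
    {x \<in> cfgs N. (\<lambda>v. sqrt (real N) * (hhat_of \<beta> p N v - h) \<le> t) (mean N x)}"
    unfolding cdf_def hhat_law_def
    by (subst measure_distr) (auto simp: CW_measure_def space_point_measure hhat_def hhat_of_def intro!: arg_cong[where f="measure _"])
  then show ?thesis using measure_CW[OF assms, of \<beta> h p "\<lambda>v. sqrt (real N) * (hhat_of \<beta> p N v - h) \<le> t"] by simp
qed

section \<open>Limits of the distribution functions\<close>

text \<open>Two and three maximizers are treated alike: the limits rest on finiteness and
  nondegeneracy, and the number of maximizers returns only in the final mixtures.\<close>

locale nondegenerate_maximizers =
  fixes \<beta> h :: real and p :: nat
  assumes finite_M: "finite (global_maximizers \<beta> h p)"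
    and nonempty_M: "global_maximizers \<beta> h p \<noteq> {}"
    and H2_neg: "\<forall>m\<in>global_maximizers \<beta> h p. H2 \<beta> h p m < 0"
begin

abbreviation "M \<equiv> global_maximizers \<beta> h p"
abbreviation "W \<equiv> mweight \<beta> h p"
abbreviation "partition_sum N \<equiv> (\<Sum>k\<le>N. CW_term \<beta> h p N k)"

lemma mweight_eq:
  assumes "m \<in> M"
  shows "W m = 1 / (sqrt (1 - m\<^sup>2) * sqrt (- H2 \<beta> h p m))" "W m > 0"
proof -
  have 1: "1 - m\<^sup>2 > 0" using global_maximizer_interior[OF assms] by (simp add: abs_square_less_1)
  have 2: "- H2 \<beta> h p m > 0" using H2_neg assms by simp
  have e: "(m\<^sup>2 - 1) * H2 \<beta> h p m = (1 - m\<^sup>2) * (- H2 \<beta> h p m)" by (simp add: algebra_simps)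
  have pos: "(1 - m\<^sup>2) * (- H2 \<beta> h p m) > 0" using 1 2 by (rule mult_pos_pos)
  have "W m = inverse (((1 - m\<^sup>2) * (- H2 \<beta> h p m)) powr (1/2))"
    unfolding mweight_def e by (simp add: powr_minus[symmetric])
  also have "\<dots> = 1 / sqrt ((1 - m\<^sup>2) * (- H2 \<beta> h p m))" using pos by (simp add: powr_half_sqrt inverse_eq_divide)
  also have "\<dots> = 1 / (sqrt (1 - m\<^sup>2) * sqrt (- H2 \<beta> h p m))" by (simp only: real_sqrt_mult)
  finally show "W m = 1 / (sqrt (1 - m\<^sup>2) * sqrt (- H2 \<beta> h p m))" .
  then show "W m > 0" using 1 2 by simp
qed

text \<open>The factor 1 / sqrt (1 - m^2) of the binomial weight and 1 / sqrt (-H'') of the Gaussian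
  integral combine to \<open>W m\<close>.\<close>

lemma laplace_factor:
  assumes "m \<in> M"
  shows "1 / stirling_const / sqrt (1 - m\<^sup>2) * (sqrt (2 * pi / (- H2 \<beta> h p m)) * r)
    = sqrt (2 * pi) / stirling_const * (W m * r)"
  unfolding mweight_eq(1)[OF assms] real_sqrt_divide by simp

lemma sum_W_pos: "(\<Sum>m\<in>M. W m) > 0"
  using finite_M nonempty_M mweight_eq(2) by (intro sum_pos) auto

lemma partition_limit:
  assumes "m0 \<in> M"
  shows "(\<lambda>N. exp (- real N * H \<beta> h p m0) * partition_sum N) \<longlonglongrightarrow> sqrt (2 * pi) / stirling_const * (\<Sum>m\<in>M. W m)"
proof -
  have "(\<lambda>N. exp (- real N * H \<beta> h p m0) * (\<Sum>k\<le>N. CW_term \<beta> h p N k * 1)) \<longlonglongrightarrow>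
    (\<Sum>m\<in>M. 1 / stirling_const / sqrt (1 - m\<^sup>2) * (\<integral>y. exp (H2 \<beta> h p m * y\<^sup>2 / 2) * 1 \<partial>lborel))"
    by (rule laplace_sum[where A=1 and a=0, OF finite_M assms H2_neg]) auto
  also have "(\<Sum>m\<in>M. 1 / stirling_const / sqrt (1 - m\<^sup>2) * (\<integral>y. exp (H2 \<beta> h p m * y\<^sup>2 / 2) * 1 \<partial>lborel))
    = (\<Sum>m\<in>M. sqrt (2 * pi) / stirling_const * (W m * 1))"
  proof (rule sum.cong[OF refl])
    fix m assume m: "m \<in> M"
    have "(\<integral>y. exp (H2 \<beta> h p m * y\<^sup>2 / 2) * 1 \<partial>lborel) = sqrt (2 * pi / (- H2 \<beta> h p m)) * 1"
      using gaussian_tilted_integrals(1)[of "- H2 \<beta> h p m" 0] H2_neg m by simp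
    then show "1 / stirling_const / sqrt (1 - m\<^sup>2) * (\<integral>y. exp (H2 \<beta> h p m * y\<^sup>2 / 2) * 1 \<partial>lborel)
      = sqrt (2 * pi) / stirling_const * (W m * 1)"
      using laplace_factor[OF m, of 1] by simp
  qed
  finally show ?thesis by (simp add: sum_distrib_left)
qed

text \<open>\<open>r m\<close> is the mean of \<open>f m\<close> under the normal law of variance -1
  / H''(m). The limit averages these means with weights proportional to \<open>W\<close>; the
  division by the partition sum cancels the Stirling constant.\<close>

lemma gibbs_limit:
  assumes f: "\<And>m. m \<in> M \<Longrightarrow> f m \<in> borel_measurable borel"
    and A: "A \<ge> 0" "a \<ge> 0"
    and bound: "\<And>N x m. m \<in> M \<Longrightarrow> N > 0 \<Longrightarrow> \<bar>x\<bar> \<le> 1 \<Longrightarrow> \<bar>g N x\<bar> \<le> A * exp (a * (sqrt (real N) * \<bar>x - m\<bar>))"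
    and lim: "\<And>m. m \<in> M \<Longrightarrow> AE y in lborel. \<forall>x. (\<lambda>N. sqrt (real N) * (x N - m)) \<longlonglongrightarrow> y \<longrightarrow> (\<lambda>N. g N (x N)) \<longlonglongrightarrow> f m y"
    and r: "\<And>m. m \<in> M \<Longrightarrow> (\<integral>y. exp (H2 \<beta> h p m * y\<^sup>2 / 2) * f m y \<partial>lborel) = sqrt (2 * pi / (- H2 \<beta> h p m)) * r m"
  shows "(\<lambda>N. (\<Sum>k\<le>N. CW_term \<beta> h p N k * g N (grid N k)) / partition_sum N) \<longlonglongrightarrow> (\<Sum>m\<in>M. W m * r m) / (\<Sum>m\<in>M. W m)"
proof -
  obtain m0 where m0: "m0 \<in> M" using nonempty_M by blast
  have "(\<lambda>N. exp (- real N * H \<beta> h p m0) * (\<Sum>k\<le>N. CW_term \<beta> h p N k * g N (grid N k))) \<longlonglongrightarrow>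
    (\<Sum>m\<in>M. 1 / stirling_const / sqrt (1 - m\<^sup>2) * (\<integral>y. exp (H2 \<beta> h p m * y\<^sup>2 / 2) * f m y \<partial>lborel))"
    by (rule laplace_sum[where A=A and a=a, OF finite_M m0 H2_neg]) (use f A bound lim in auto)
  also have "(\<Sum>m\<in>M. 1 / stirling_const / sqrt (1 - m\<^sup>2) * (\<integral>y. exp (H2 \<beta> h p m * y\<^sup>2 / 2) * f m y \<partial>lborel))
    = sqrt (2 * pi) / stirling_const * (\<Sum>m\<in>M. W m * r m)"
    unfolding sum_distrib_left by (rule sum.cong[OF refl]) (simp only: r laplace_factor)
  finally have "(\<lambda>N. exp (- real N * H \<beta> h p m0) * (\<Sum>k\<le>N. CW_term \<beta> h p N k * g N (grid N k)) /
      (exp (- real N * H \<beta> h p m0) * partition_sum N)) \<longlonglongrightarrow>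
    sqrt (2 * pi) / stirling_const * (\<Sum>m\<in>M. W m * r m) / (sqrt (2 * pi) / stirling_const * (\<Sum>m\<in>M. W m))"
    using sum_W_pos stirling_const(1) by (intro tendsto_divide partition_limit[OF m0]) auto
  then show ?thesis using stirling_const(1) by simp
qed

text \<open>By \<open>sep\<close>, \<open>ms\<close> is the smallest maximizer if t < 0 and the
  largest if t > 0. Near any other maximizer the tilt centred at \<open>ms\<close> decays
  exponentially in sqrt N, which is negligible even against the factor sqrt N contained in
  \<open>g2\<close>.\<close>

lemma mean_limit:
  assumes ms: "ms \<in> M" and t: "t \<noteq> 0" and sep: "\<And>m. m \<in> M \<Longrightarrow> m \<noteq> ms \<Longrightarrow> t * (m - ms) < 0"
  shows "(\<lambda>N. sqrt (real N) * (CW_expect_mean \<beta> (h + t / sqrt (real N)) p N - ms)) \<longlonglongrightarrow> t / (- H2 \<beta> h p ms)"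
proof -
  define z where "z N x = sqrt (real N) * (x - ms)" for N x
  define g1 where "g1 N x = exp (t * z N x)" for N x
  define g2 where "g2 N x = z N x * exp (t * z N x)" for N x
  define a where "a = - H2 \<beta> h p ms"
  have a: "a > 0" using H2_neg ms by (simp add: a_def)
  \<comment> \<open>Recentring the tilt at another maximizer m splits off sqrt N t (m - ms), which
    is nonpositive by \<open>sep\<close>; so the growth bound holds around every maximizer.\<close>
  have tz: "t * z N x \<le> \<bar>t\<bar> * (sqrt (real N) * \<bar>x - m\<bar>)" if "m \<in> M" for N x m
  proof -
    have "t * (m - ms) \<le> 0" using sep[OF that] by (cases "m = ms") auto
    then have "sqrt (real N) * (t * (m - ms)) \<le> 0" by (rule mult_nonneg_nonpos[OF real_sqrt_ge_zero[OF of_nat_0_le_iff]])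
    moreover have "sqrt (real N) * (t * (x - m)) \<le> sqrt (real N) * (\<bar>t\<bar> * \<bar>x - m\<bar>)"
      by (intro mult_left_mono) (auto simp: abs_mult[symmetric])
    ultimately show ?thesis by (simp add: z_def algebra_simps)
  qed
  have b1: "\<bar>g1 N x\<bar> \<le> 1 * exp (\<bar>t\<bar> * (sqrt (real N) * \<bar>x - m\<bar>))" if "m \<in> M" for N x m
    using tz[OF that] by (simp add: g1_def)
  have b2: "\<bar>g2 N x\<bar> \<le> (1 / \<bar>t\<bar> + 1) * exp ((\<bar>t\<bar> + 1) * (sqrt (real N) * \<bar>x - m\<bar>))" if m: "m \<in> M" for N x m
  proof -
    define u where "u = sqrt (real N) * \<bar>x - m\<bar>"
    have u: "u \<ge> 0" by (simp add: u_def)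
    have e1: "exp ((\<bar>t\<bar> + 1) * u) \<ge> 1" using u by simp
    \<comment> \<open>If t z is nonpositive, s exp (-s) \<le> 1 bounds |z| exp (t z) by 1 / |t|.
      Otherwise |z| \<le> u \<le> exp u, at the price of one more unit in the exponent.\<close>
    have "\<bar>g2 N x\<bar> \<le> 1 / \<bar>t\<bar> \<or> \<bar>g2 N x\<bar> \<le> exp ((\<bar>t\<bar> + 1) * u)"
    proof (cases "t * z N x \<le> 0")
      case True
      have "- (t * z N x) \<le> exp (- (t * z N x))" using exp_ge_add_one_self[of "- (t * z N x)"] by linarith
      then have "- (t * z N x) * exp (t * z N x) \<le> exp (- (t * z N x)) * exp (t * z N x)"
        by (intro mult_right_mono) auto
      also have "\<dots> = 1" by (simp add: exp_add[symmetric])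
      finally have "\<bar>t * z N x\<bar> * exp (t * z N x) \<le> 1" unfolding abs_of_nonpos[OF True] .
      then have "\<bar>t\<bar> * \<bar>g2 N x\<bar> \<le> 1" by (simp add: g2_def abs_mult)
      then have "\<bar>g2 N x\<bar> \<le> 1 / \<bar>t\<bar>" using t by (simp add: field_simps)
      then show ?thesis ..
    next
      case False
      have "\<bar>t\<bar> * \<bar>z N x\<bar> = t * z N x" using False by (simp add: abs_mult[symmetric])
      also have "\<dots> \<le> \<bar>t\<bar> * u" using tz[OF m] by (simp add: u_def)
      finally have "\<bar>z N x\<bar> \<le> u" using t by simp
      also have "\<dots> \<le> exp u" using exp_ge_add_one_self[of u] by linarith
      finally have "\<bar>z N x\<bar> * exp (t * z N x) \<le> exp u * exp (\<bar>t\<bar> * u)"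
        using tz[OF m, of N x] by (intro mult_mono) (auto simp: u_def)
      then have "\<bar>g2 N x\<bar> \<le> exp ((\<bar>t\<bar> + 1) * u)" by (simp add: g2_def abs_mult exp_add[symmetric] algebra_simps)
      then show ?thesis ..
    qed
    moreover have "1 / \<bar>t\<bar> \<le> 1 / \<bar>t\<bar> * exp ((\<bar>t\<bar> + 1) * u)" using mult_left_mono[OF e1, of "1 / \<bar>t\<bar>"] by simp
    moreover have "1 / \<bar>t\<bar> * exp ((\<bar>t\<bar> + 1) * u) \<ge> 0" by simp
    ultimately show ?thesis unfolding u_def[symmetric] distrib_right[of "1 / \<bar>t\<bar>" 1] using e1 by linarith
  qed
  have lim: "(\<lambda>N. g1 N (x N)) \<longlonglongrightarrow> (if m = ms then exp (t * y) else 0) \<and> (\<lambda>N. g2 N (x N)) \<longlonglongrightarrow> (if m = ms then y * exp (t * y) else 0)"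
    if m: "m \<in> M" and xy: "(\<lambda>N. sqrt (real N) * (x N - m)) \<longlonglongrightarrow> y" for m x y
  proof (cases "m = ms")
    case True
    then show ?thesis using xy unfolding g1_def g2_def z_def by (auto intro!: tendsto_intros)
  next
    case False
    define w where "w N = - (t * z N (x N))" for N
    have "filterlim (\<lambda>N. - t * (sqrt (real N) * (x N - m)) + - (t * (m - ms)) * sqrt (real N)) at_top sequentially"
      using sep[OF m False] by (intro filterlim_tendsto_add_at_top[OF tendsto_mult[OF tendsto_const xy]]
        filterlim_tendsto_pos_mult_at_top[OF tendsto_const] filterlim_compose[OF sqrt_at_top] filterlim_real_sequentially) auto
    moreover have "- t * (sqrt (real N) * (x N - m)) + - (t * (m - ms)) * sqrt (real N) = w N" for N
      by (simp add: w_def z_def algebra_simps)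
    ultimately have w: "filterlim w at_top sequentially" by simp
    have l0: "(\<lambda>N. w N ^ 0 / exp (w N)) \<longlonglongrightarrow> 0" by (rule filterlim_compose[OF tendsto_power_div_exp_0 w])
    have l1: "(\<lambda>N. w N ^ 1 / exp (w N)) \<longlonglongrightarrow> 0" by (rule filterlim_compose[OF tendsto_power_div_exp_0 w])
    have g1w: "g1 N (x N) = w N ^ 0 / exp (w N)" for N by (simp add: g1_def w_def exp_minus inverse_eq_divide)
    have g2w: "g2 N (x N) = (- 1 / t) * (w N ^ 1 / exp (w N))" for N using t by (simp add: g2_def w_def exp_minus inverse_eq_divide)
    have "(\<lambda>N. g2 N (x N)) \<longlonglongrightarrow> (- 1 / t) * 0" unfolding g2w by (intro tendsto_mult tendsto_const l1)
    then show ?thesis using False l0 unfolding g1w by simp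
  qed
  have L1: "(\<lambda>N. (\<Sum>k\<le>N. CW_term \<beta> h p N k * g1 N (grid N k)) / partition_sum N) \<longlonglongrightarrow>
    (\<Sum>m\<in>M. W m * (if m = ms then exp (t\<^sup>2 / (2 * a)) else 0)) / (\<Sum>m\<in>M. W m)"
    by (rule gibbs_limit[where f="\<lambda>m y. if m = ms then exp (t * y) else 0" and A=1 and a="\<bar>t\<bar>"])
      (use b1 lim gaussian_tilted_integrals(1)[OF a, of t] in \<open>auto simp: a_def\<close>)
  have L2: "(\<lambda>N. (\<Sum>k\<le>N. CW_term \<beta> h p N k * g2 N (grid N k)) / partition_sum N) \<longlonglongrightarrow>
    (\<Sum>m\<in>M. W m * (if m = ms then t / a * exp (t\<^sup>2 / (2 * a)) else 0)) / (\<Sum>m\<in>M. W m)"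
    by (rule gibbs_limit[where f="\<lambda>m y. if m = ms then y * exp (t * y) else 0" and A="1 / \<bar>t\<bar> + 1" and a="\<bar>t\<bar> + 1"])
      (use b2 lim gaussian_tilted_integrals(2)[OF a, of t] in \<open>auto simp: a_def mult_ac\<close>)
  have s: "(\<Sum>m\<in>M. W m * (if m = ms then c else 0)) = W ms * c" for c
  proof -
    have "(\<Sum>m\<in>M. W m * (if m = ms then c else 0)) = (\<Sum>m\<in>M. if m = ms then W m * c else 0)"
      by (intro sum.cong) auto
    then show ?thesis using ms finite_M by simp
  qed
  have "(\<lambda>N. ((\<Sum>k\<le>N. CW_term \<beta> h p N k * g2 N (grid N k)) / partition_sum N) / ((\<Sum>k\<le>N. CW_term \<beta> h p N k * g1 N (grid N k)) / partition_sum N)) \<longlonglongrightarrow>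
    (W ms * (t / a * exp (t\<^sup>2 / (2 * a))) / (\<Sum>m\<in>M. W m)) / (W ms * exp (t\<^sup>2 / (2 * a)) / (\<Sum>m\<in>M. W m))"
    using sum_W_pos mweight_eq(2)[OF ms] by (intro tendsto_divide[OF L2[unfolded s] L1[unfolded s]]) auto
  also have "(W ms * (t / a * exp (t\<^sup>2 / (2 * a))) / (\<Sum>m\<in>M. W m)) / (W ms * exp (t\<^sup>2 / (2 * a)) / (\<Sum>m\<in>M. W m)) = t / a"
    using sum_W_pos mweight_eq(2)[OF ms] by simp
  finally have L: "(\<lambda>N. ((\<Sum>k\<le>N. CW_term \<beta> h p N k * g2 N (grid N k)) / partition_sum N) / ((\<Sum>k\<le>N. CW_term \<beta> h p N k * g1 N (grid N k)) / partition_sum N)) \<longlonglongrightarrow> t / a" .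
  have eq: "((\<Sum>k\<le>N. CW_term \<beta> h p N k * g2 N (grid N k)) / partition_sum N) / ((\<Sum>k\<le>N. CW_term \<beta> h p N k * g1 N (grid N k)) / partition_sum N)
      = sqrt (real N) * (CW_expect_mean \<beta> (h + t / sqrt (real N)) p N - ms)" if N: "N > 0" for N
  proof -
    let ?h = "h + t / sqrt (real N)"
    let ?c = "exp (t * (sqrt (real N) * ms))"
    have "real N * (t / sqrt (real N)) = t * (real N / sqrt (real N))" by simp
    also have "\<dots> = t * sqrt (real N)" by (simp only: real_div_sqrt of_nat_0_le_iff)
    finally have Nt: "real N * (t / sqrt (real N)) = t * sqrt (real N)" .
    \<comment> \<open>The factor \<open>?c\<close> is the same for all levels and cancels in the
      expectation, so the tilt may be centred at \<open>ms\<close>.\<close>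
    have T: "CW_term \<beta> ?h p N k = ?c * (CW_term \<beta> h p N k * g1 N (grid N k))" for k
      unfolding CW_term_tilt Nt g1_def z_def by (simp add: exp_add[symmetric] algebra_simps)
    define Z where "Z = (\<Sum>k\<le>N. CW_term \<beta> h p N k * g1 N (grid N k))"
    have ZT: "(\<Sum>k\<le>N. CW_term \<beta> ?h p N k) = ?c * Z" unfolding T Z_def by (simp add: sum_distrib_left)
    have Z: "Z > 0" using CW_term_sum_pos[of \<beta> ?h p N] unfolding ZT by (simp add: zero_less_mult_iff)
    have "CW_expect_mean \<beta> ?h p N = ?c * (\<Sum>k\<le>N. CW_term \<beta> h p N k * g1 N (grid N k) * grid N k) / (?c * Z)"
      unfolding CW_expect_mean_eq[OF N] ZT by (simp add: T sum_distrib_left mult.assoc)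
    then have E: "CW_expect_mean \<beta> ?h p N * Z = (\<Sum>k\<le>N. CW_term \<beta> h p N k * g1 N (grid N k) * grid N k)"
      using Z by simp
    have "(\<Sum>k\<le>N. CW_term \<beta> h p N k * g2 N (grid N k)) = sqrt (real N) * ((\<Sum>k\<le>N. CW_term \<beta> h p N k * g1 N (grid N k) * grid N k) - ms * Z)"
      unfolding Z_def sum_distrib_left sum_subtractf[symmetric] by (intro sum.cong refl) (simp add: g1_def g2_def z_def algebra_simps)
    also have "\<dots> = sqrt (real N) * (CW_expect_mean \<beta> ?h p N - ms) * Z" unfolding E[symmetric] by (simp add: algebra_simps)
    finally show ?thesis unfolding Z_def[symmetric] using Z CW_term_sum_pos[of \<beta> h p N] by simp
  qed
  show ?thesis
    by (rule Lim_transform_eventually[OF L[unfolded a_def]])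
      (use eventually_gt_at_top[of 0] in eventually_elim, rule eq)
qed

text \<open>Away from \<open>ms\<close> the indicator is eventually constant, since the threshold
  tends to \<open>ms\<close>. At \<open>ms\<close> the threshold tends to t / (-H'') in the scale y,
  and the single y where the indicator may oscillate is a null set.\<close>

lemma mean_cdf_limit:
  assumes ms: "ms \<in> M" and u: "(\<lambda>N. sqrt (real N) * (u N - ms)) \<longlonglongrightarrow> t / (- H2 \<beta> h p ms)"
  shows "(\<lambda>N. (\<Sum>k\<le>N. CW_term \<beta> h p N k * (if grid N k \<le> u N then 1 else 0)) / partition_sum N) \<longlonglongrightarrow>
    ((\<Sum>m\<in>{m\<in>M. m < ms}. W m) + W ms * measure (normal_law (- H2 \<beta> h p ms)) {..t}) / (\<Sum>m\<in>M. W m)"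
proof -
  define \<Phi> where "\<Phi> = measure (normal_law (- H2 \<beta> h p ms)) {..t}"
  define c where "c = t / (- H2 \<beta> h p ms)"
  define f where "f m y = (if m = ms then (if y \<le> c then 1 else 0) else if m < ms then 1 else 0 :: real)" for m y
  have um: "u \<longlonglongrightarrow> ms" by (rule tendsto_of_scaled[OF u])
  have "(\<lambda>N. (\<Sum>k\<le>N. CW_term \<beta> h p N k * (if grid N k \<le> u N then 1 else 0)) / partition_sum N) \<longlonglongrightarrow>
    (\<Sum>m\<in>M. W m * (if m = ms then \<Phi> else if m < ms then 1 else 0)) / (\<Sum>m\<in>M. W m)"
  proof (rule gibbs_limit[where A=1 and a=0 and f=f and g="\<lambda>N x. if x \<le> u N then 1 else 0"])
    fix m assume m: "m \<in> M"
    show "f m \<in> borel_measurable borel" unfolding f_def by measurable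
    have "AE y in lborel. y \<noteq> c" by (rule AE_lborel_singleton)
    then show "AE y in lborel. \<forall>x. (\<lambda>N. sqrt (real N) * (x N - m)) \<longlonglongrightarrow> y \<longrightarrow>
        (\<lambda>N. if x N \<le> u N then 1 else 0) \<longlonglongrightarrow> f m y"
    proof (eventually_elim, intro allI impI)
      fix y x assume y: "y \<noteq> c" and xy: "(\<lambda>N. sqrt (real N) * (x N - m)) \<longlonglongrightarrow> y"
      have xm: "x \<longlonglongrightarrow> m" by (rule tendsto_of_scaled[OF xy])
      have cases: "(\<forall>\<^sub>F N in sequentially. x N \<le> u N) \<and> f m y = 1 \<or> (\<forall>\<^sub>F N in sequentially. \<not> x N \<le> u N) \<and> f m y = 0"
      proof (cases "m = ms")
        case True
        have uc: "(\<lambda>N. sqrt (real N) * (u N - m)) \<longlonglongrightarrow> c" using u True by (simp add: c_def)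
        from tendsto_diff[OF uc xy] have d: "(\<lambda>N. sqrt (real N) * (u N - x N)) \<longlonglongrightarrow> c - y"
          by (simp add: algebra_simps)
        show ?thesis
        proof (cases "y < c")
          case yc: True
          have "\<forall>\<^sub>F N in sequentially. sqrt (real N) * (u N - x N) > 0"
            using d yc by (intro order_tendstoD) auto
          then have "\<forall>\<^sub>F N in sequentially. x N \<le> u N"
            by eventually_elim (simp add: zero_less_mult_iff)
          then show ?thesis using True yc by (simp add: f_def)
        next
          case False
          have "\<forall>\<^sub>F N in sequentially. sqrt (real N) * (u N - x N) < 0"
            using d False y by (intro order_tendstoD) auto
          then have "\<forall>\<^sub>F N in sequentially. \<not> x N \<le> u N"
            by eventually_elim (simp add: mult_less_0_iff)
          then show ?thesis using True False y by (simp add: f_def)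
        qed
      next
        case False
        have d: "(\<lambda>N. u N - x N) \<longlonglongrightarrow> ms - m" by (intro tendsto_diff um xm)
        show ?thesis
        proof (cases "m < ms")
          case True
          have "\<forall>\<^sub>F N in sequentially. u N - x N > 0" using d True by (intro order_tendstoD) auto
          then have "\<forall>\<^sub>F N in sequentially. x N \<le> u N" by eventually_elim simp
          then show ?thesis using False True by (simp add: f_def)
        next
          case F: False
          have "\<forall>\<^sub>F N in sequentially. u N - x N < 0" using d F False by (intro order_tendstoD) auto
          then have "\<forall>\<^sub>F N in sequentially. \<not> x N \<le> u N" by eventually_elim simp
          then show ?thesis using False F by (simp add: f_def)
        qed
      qed
      show "(\<lambda>N. if x N \<le> u N then 1 else 0) \<longlonglongrightarrow> f m y"
        using cases by (elim disjE conjE; intro tendsto_eventually; elim eventually_mono) auto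
    qed
    show "(\<integral>y. exp (H2 \<beta> h p m * y\<^sup>2 / 2) * f m y \<partial>lborel) =
      sqrt (2 * pi / - H2 \<beta> h p m) * (if m = ms then \<Phi> else if m < ms then 1 else 0)"
      using gaussian_partial_integral[of "- H2 \<beta> h p ms" t] gaussian_tilted_integrals(1)[of "- H2 \<beta> h p m" 0] H2_neg m
      by (auto simp: f_def \<Phi>_def c_def)
  qed auto
  also have "(\<Sum>m\<in>M. W m * (if m = ms then \<Phi> else if m < ms then 1 else 0)) = (\<Sum>m\<in>{m\<in>M. m < ms}. W m) + W ms * \<Phi>"
  proof -
    have "(\<Sum>m\<in>M. W m * (if m = ms then \<Phi> else if m < ms then 1 else 0))
      = W ms * \<Phi> + (\<Sum>m\<in>M - {ms}. W m * (if m = ms then \<Phi> else if m < ms then 1 else 0))"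
      using finite_M ms by (subst sum.remove[of _ ms]) auto
    also have "(\<Sum>m\<in>M - {ms}. W m * (if m = ms then \<Phi> else if m < ms then 1 else 0)) = (\<Sum>m\<in>{m\<in>M. m < ms}. W m)"
      using finite_M by (intro sum.mono_neutral_cong_right) auto
    finally show ?thesis by simp
  qed
  finally show ?thesis unfolding \<Phi>_def .
qed

text \<open>All maximizers are interior, so a sequence that tends to one of them eventually avoids
  the boundary.\<close>

lemma boundary_limit:
  "(\<lambda>N. (\<Sum>k\<le>N. CW_term \<beta> h p N k * (if \<bar>grid N k\<bar> \<ge> 1 then 1 else 0)) / partition_sum N) \<longlonglongrightarrow> 0"
proof -
  have "(\<lambda>N. (\<Sum>k\<le>N. CW_term \<beta> h p N k * (if \<bar>grid N k\<bar> \<ge> 1 then 1 else 0)) / partition_sum N) \<longlonglongrightarrow>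
    (\<Sum>m\<in>M. W m * 0) / (\<Sum>m\<in>M. W m)"
  proof (rule gibbs_limit[where A=1 and a=0 and f="\<lambda>_ _. 0" and g="\<lambda>N x. if \<bar>x\<bar> \<ge> 1 then 1 else 0"])
    fix m assume m: "m \<in> M"
    have "(\<lambda>N. if \<bar>x N\<bar> \<ge> 1 then 1 else 0 :: real) \<longlonglongrightarrow> 0" if xy: "(\<lambda>N. sqrt (real N) * (x N - m)) \<longlonglongrightarrow> y" for x y
    proof (rule tendsto_eventually)
      have "\<forall>\<^sub>F N in sequentially. \<bar>x N\<bar> < 1"
        using tendsto_rabs[OF tendsto_of_scaled[OF xy]] global_maximizer_interior[OF m] by (rule order_tendstoD)
      then show "\<forall>\<^sub>F N in sequentially. (if \<bar>x N\<bar> \<ge> 1 then 1 else 0 :: real) = 0" by eventually_elim auto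
    qed
    then show "AE y in lborel. \<forall>x. (\<lambda>N. sqrt (real N) * (x N - m)) \<longlonglongrightarrow> y \<longrightarrow>
        (\<lambda>N. if \<bar>x N\<bar> \<ge> 1 then 1 else 0) \<longlonglongrightarrow> (0::real)" by auto
  qed auto
  then show ?thesis by simp
qed

theorem cdf_hhat_limit:
  assumes ms: "ms \<in> M" and t: "t \<noteq> 0" and sep: "\<And>m. m \<in> M \<Longrightarrow> m \<noteq> ms \<Longrightarrow> t * (m - ms) < 0"
  shows "(\<lambda>N. cdf (hhat_law \<beta> h p N) t) \<longlonglongrightarrow>
    ((\<Sum>m\<in>{m\<in>M. m < ms}. W m) + W ms * measure (normal_law (- H2 \<beta> h p ms)) {..t}) / (\<Sum>m\<in>M. W m)"
proof -
  define u where "u N = CW_expect_mean \<beta> (h + t / sqrt (real N)) p N" for N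
  define R where "R N = (\<Sum>k\<le>N. CW_term \<beta> h p N k * (if grid N k \<le> u N then 1 else 0)) / partition_sum N" for N
  define b where "b N = (\<Sum>k\<le>N. CW_term \<beta> h p N k * (if \<bar>grid N k\<bar> \<ge> 1 then 1 else 0)) / partition_sum N" for N
  have R: "R \<longlonglongrightarrow> ((\<Sum>m\<in>{m\<in>M. m < ms}. W m) + W ms * measure (normal_law (- H2 \<beta> h p ms)) {..t}) / (\<Sum>m\<in>M. W m)"
    unfolding R_def[abs_def] by (rule mean_cdf_limit[OF ms]) (unfold u_def, rule mean_limit[OF ms t sep])
  \<comment> \<open>The estimate is unspecified when the mean is \<open>1\<close> or \<open>-1\<close>; such configurations have vanishing probability.\<close>
  have "(\<lambda>N. cdf (hhat_law \<beta> h p N) t - R N) \<longlonglongrightarrow> 0"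
  proof (rule Lim_null_comparison)
    show "b \<longlonglongrightarrow> 0" unfolding b_def[abs_def] by (rule boundary_limit)
    show "\<forall>\<^sub>F N in sequentially. norm (cdf (hhat_law \<beta> h p N) t - R N) \<le> b N"
      using eventually_gt_at_top[of 0]
    proof eventually_elim
      case (elim N)
      let ?P = "\<lambda>k. sqrt (real N) * (hhat_of \<beta> p N (grid N k) - h) \<le> t"
      have "?P k \<longleftrightarrow> grid N k \<le> u N" if "\<bar>grid N k\<bar> < 1" for k
      proof -
        have "?P k \<longleftrightarrow> hhat_of \<beta> p N (grid N k) \<le> h + t / sqrt (real N)"
          using elim by (simp add: field_simps)
        then show ?thesis unfolding hhat_of_le_iff[OF elim that] u_def .
      qed
      then have le: "\<bar>CW_term \<beta> h p N k * (if ?P k then 1 else 0) - CW_term \<beta> h p N k * (if grid N k \<le> u N then 1 else 0)\<bar>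
         \<le> CW_term \<beta> h p N k * (if \<bar>grid N k\<bar> \<ge> 1 then 1 else 0)" for k
        using CW_term_nonneg[of \<beta> h p N k] by (cases "\<bar>grid N k\<bar> < 1") auto
      have eq: "cdf (hhat_law \<beta> h p N) t - R N =
        (\<Sum>k\<le>N. CW_term \<beta> h p N k * (if ?P k then 1 else 0) - CW_term \<beta> h p N k * (if grid N k \<le> u N then 1 else 0)) / partition_sum N"
        unfolding cdf_hhat_law[OF elim] R_def sum_subtractf diff_divide_distrib ..
      have "norm (cdf (hhat_law \<beta> h p N) t - R N) = \<bar>\<Sum>k\<le>N. CW_term \<beta> h p N k * (if ?P k then 1 else 0) - CW_term \<beta> h p N k * (if grid N k \<le> u N then 1 else 0)\<bar> / partition_sum N"
        unfolding eq using CW_term_sum_pos[of \<beta> h p N] by (simp add: abs_divide)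
      also have "\<dots> \<le> b N" unfolding b_def
        using CW_term_sum_pos[of \<beta> h p N] le by (intro divide_right_mono order_trans[OF sum_abs] sum_mono) auto
      finally show ?case .
    qed
  qed
  from tendsto_add[OF this R] show ?thesis by simp
qed

end

section \<open>Weak convergence to the mixtures\<close>

lemma suminf_sum_list_ennreal:
  fixes f :: "'b \<Rightarrow> nat \<Rightarrow> ennreal"
  shows "(\<Sum>i. \<Sum>x\<leftarrow>xs. f x i) = (\<Sum>x\<leftarrow>xs. \<Sum>i. f x i)"
  by (induction xs) (simp_all add: suminf_add[symmetric])

text \<open>\<open>mixture\<close> is built by \<open>measure_of\<close>, so the weighted sum is its
  value only after countable additivity has been checked.\<close>

lemma emeasure_mixture:
  assumes "\<And>w N. (w, N) \<in> set ws \<Longrightarrow> sets N = sets borel" and A: "A \<in> sets borel"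
  shows "emeasure (mixture ws) A = (\<Sum>(w, N)\<leftarrow>ws. ennreal w * emeasure N A)"
proof (rule emeasure_measure_of[OF mixture_def])
  show "positive (sets (mixture ws)) (\<lambda>A. \<Sum>(w, N)\<leftarrow>ws. ennreal w * emeasure N A)"
    by (auto simp: positive_def sum_list_0 case_prod_beta)
  show "countably_additive (sets (mixture ws)) (\<lambda>A. \<Sum>(w, N)\<leftarrow>ws. ennreal w * emeasure N A)"
    unfolding countably_additive_def
  proof (intro allI impI)
    fix B :: "nat \<Rightarrow> real set"
    assume B: "range B \<subseteq> sets (mixture ws)" "disjoint_family B"
    have sb: "sets (mixture ws) = sets borel"
      unfolding mixture_def by (subst sets_measure_of) (auto simp: sets.sigma_sets_eq[of borel, simplified])
    have "(\<Sum>i. \<Sum>(w, N)\<leftarrow>ws. ennreal w * emeasure N (B i)) = (\<Sum>(w, N)\<leftarrow>ws. \<Sum>i. ennreal w * emeasure N (B i))"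
      by (simp only: case_prod_beta' suminf_sum_list_ennreal)
    also have "\<dots> = (\<Sum>(w, N)\<leftarrow>ws. ennreal w * emeasure N (\<Union> (range B)))"
    proof (intro arg_cong[where f=sum_list] map_cong refl)
      fix x assume "x \<in> set ws"
      moreover obtain w N where x: "x = (w, N)" by (cases x)
      ultimately have N: "sets N = sets borel" using assms(1)[of w N] by simp
      show "(case x of (w, N) \<Rightarrow> \<Sum>i. ennreal w * emeasure N (B i)) = (case x of (w, N) \<Rightarrow> ennreal w * emeasure N (\<Union> (range B)))"
        using B suminf_emeasure[of B N] by (simp add: x N sb ennreal_suminf_cmult)
    qed
    finally show "(\<Sum>i. \<Sum>(w, N)\<leftarrow>ws. ennreal w * emeasure N (B i)) = (\<Sum>(w, N)\<leftarrow>ws. ennreal w * emeasure N (\<Union> (range B)))" .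
  qed
qed (use A in \<open>auto simp: sets.sigma_sets_eq[of borel, simplified] mixture_def\<close>)

lemma sets_mixture: "sets (mixture ws) = sets borel"
  unfolding mixture_def by (subst sets_measure_of) (auto simp: sets.sigma_sets_eq[of borel, simplified])

text \<open>\<open>ennreal\<close> truncates negative weights to 0; nonnegative weights allow the
  passage to real-valued measures.\<close>

lemma emeasure_mixture_prob:
  assumes ws: "\<And>w N. (w, N) \<in> set ws \<Longrightarrow> sets N = sets borel \<and> prob_space N \<and> w \<ge> 0" and A: "A \<in> sets borel"
  shows "emeasure (mixture ws) A = ennreal (\<Sum>(w, N)\<leftarrow>ws. w * measure N A)"
proof -
  have "(\<Sum>(w, N)\<leftarrow>ws. ennreal w * emeasure N A) = ennreal (\<Sum>(w, N)\<leftarrow>ws. w * measure N A)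
     \<and> (\<Sum>(w, N)\<leftarrow>ws. w * measure N A) \<ge> 0"
    using ws
  proof (induction ws)
    case (Cons x ws)
    obtain w N where x: "x = (w, N)" by (cases x)
    then have wN: "prob_space N" "w \<ge> 0" using Cons.prems[of w N] by auto
    interpret prob_space N by (rule wN)
    have "(\<Sum>(w, N)\<leftarrow>ws. ennreal w * emeasure N A) = ennreal (\<Sum>(w, N)\<leftarrow>ws. w * measure N A)
     \<and> (\<Sum>(w, N)\<leftarrow>ws. w * measure N A) \<ge> 0"
      by (rule Cons.IH) (use Cons.prems in auto)
    then show ?case using wN by (auto simp: x emeasure_eq_measure ennreal_mult[symmetric] ennreal_plus[symmetric] simp del: ennreal_plus)
  qed simp
  then show ?thesis using emeasure_mixture[OF _ A] ws by simp
qed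

lemma measure_mixture:
  assumes ws: "\<And>w N. (w, N) \<in> set ws \<Longrightarrow> sets N = sets borel \<and> prob_space N \<and> w \<ge> 0" and A: "A \<in> sets borel"
  shows "measure (mixture ws) A = (\<Sum>(w, N)\<leftarrow>ws. w * measure N A)"
proof -
  have "(\<Sum>(w, N)\<leftarrow>ws. w * measure N A) \<ge> 0"
    using ws by (intro sum_list_nonneg) (force intro: mult_nonneg_nonneg)
  then show ?thesis unfolding measure_def[of "mixture ws"] by (subst emeasure_mixture_prob[OF ws A]) simp_all
qed

lemma finite_measure_mixture:
  assumes "\<And>w N. (w, N) \<in> set ws \<Longrightarrow> sets N = sets borel \<and> prob_space N \<and> w \<ge> 0"
  shows "finite_measure (mixture ws)"
proof
  have "space (mixture ws) = UNIV" using sets_eq_imp_space_eq[OF sets_mixture, of ws] by simp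
  then show "emeasure (mixture ws) (space (mixture ws)) \<noteq> \<infinity>"
    using emeasure_mixture_prob[of ws UNIV, OF assms] by simp
qed

text \<open>\<open>weak_conv\<close> concerns only continuity points of the limiting distribution
  function, and the atom removes 0 from them.\<close>

lemma weak_conv_m_atom:
  assumes "finite_measure L" "sets L = sets borel" "measure L {0} > 0"
    and "\<And>t. t \<noteq> 0 \<Longrightarrow> (\<lambda>n. cdf (\<mu> n) t) \<longlonglongrightarrow> cdf L t"
  shows "weak_conv_m \<mu> L"
proof -
  interpret finite_borel_measure L
    using assms by (auto simp: finite_borel_measure_def finite_borel_measure_axioms_def)
  show ?thesis unfolding weak_conv_m_def weak_conv_def
    using assms(3,4) isCont_cdf by (metis less_irrefl)
qed

section \<open>Distribution functions of the normal and half-normal laws\<close>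

lemma prob_space_normal_law: "a > 0 \<Longrightarrow> prob_space (normal_law a)"
  unfolding normal_law_def by (intro prob_space_normal_density) simp

lemma sets_normal_law [simp]: "sets (normal_law a) = sets borel"
  by (simp add: normal_law_def)

lemma space_normal_law [simp]: "space (normal_law a) = UNIV"
  by (simp add: normal_law_def)

lemma normal_law_symmetric:
  assumes "A \<in> sets borel"
  shows "measure (normal_law a) (uminus -` A) = measure (normal_law a) A"
proof -
  have "(uminus :: real \<Rightarrow> real) -` A \<in> sets borel" using measurable_sets[OF borel_measurable_uminus[OF measurable_ident] assms] by simp
  have m: "emeasure (normal_law a) B = (\<integral>\<^sup>+z. ennreal (normal_density 0 (sqrt a) z) * indicator B z \<partial>lborel)"
    if "B \<in> sets borel" for B
    unfolding normal_law_def using that by (subst emeasure_density) auto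
  have "emeasure (normal_law a) A = (\<integral>\<^sup>+z. ennreal (normal_density 0 (sqrt a) (0 + (-1) * z)) * indicator A (0 + (-1) * z) \<partial>lborel)"
    unfolding m[OF assms] using assms by (subst nn_integral_real_affine[where c="-1" and t=0]) auto
  also have "\<dots> = emeasure (normal_law a) (uminus -` A)"
    unfolding m[OF \<open>uminus -` A \<in> sets borel\<close>]
    by (intro nn_integral_cong) (auto simp: normal_density_def indicator_def)
  finally show ?thesis by (simp add: measure_def)
qed

lemma normal_law_tails:
  assumes "a > 0"
  shows "measure (normal_law a) {-t..} = measure (normal_law a) {..t}"
    and "measure (normal_law a) {t<..} = 1 - measure (normal_law a) {..t}"
    and "measure (normal_law a) {..<-t} = 1 - measure (normal_law a) {..t}"
proof -
  interpret prob_space "normal_law a" by (rule prob_space_normal_law[OF assms])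
  have "uminus -` {..t} = {-t..}" by auto
  then show "measure (normal_law a) {-t..} = measure (normal_law a) {..t}"
    using normal_law_symmetric[of "{..t}" a] by simp
  have "UNIV - {..t} = {t<..}" by auto
  then show 1: "measure (normal_law a) {t<..} = 1 - measure (normal_law a) {..t}"
    using prob_compl[of "{..t}"] by simp
  have "uminus -` {t<..} = {..<-t}" by auto
  then show "measure (normal_law a) {..<-t} = 1 - measure (normal_law a) {..t}"
    using normal_law_symmetric[of "{t<..}" a] 1 by simp
qed

lemma cdf_normal_minus:
  assumes a: "a > 0"
  shows "measure (normal_minus a) {..t} = (if t < 0 then 2 * measure (normal_law a) {..t} else 1)"
proof -
  interpret prob_space "normal_law a" by (rule prob_space_normal_law[OF a])
  have "measure (normal_minus a) {..t} = measure (normal_law a) ((\<lambda>z. - \<bar>z\<bar>) -` {..t})"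
    unfolding normal_minus_def by (subst measure_distr) (auto simp: normal_law_def)
  also have "\<dots> = (if t < 0 then 2 * measure (normal_law a) {..t} else 1)"
  proof (cases "t < 0")
    case True
    have "(\<lambda>z. - \<bar>z\<bar>) -` {..t} = {..t} \<union> {-t..}" by auto
    moreover have "measure (normal_law a) ({..t} \<union> {-t..}) = measure (normal_law a) {..t} + measure (normal_law a) {-t..}"
      using True by (intro finite_measure_Union) auto
    ultimately show ?thesis using True normal_law_tails(1)[OF a] by simp
  next
    case False
    then have "(\<lambda>z. - \<bar>z\<bar>) -` {..t} = UNIV" by auto
    then show ?thesis using False prob_space by simp
  qed
  finally show ?thesis .
qed

lemma cdf_normal_plus:
  assumes a: "a > 0" and t: "t \<noteq> 0"
  shows "measure (normal_plus a) {..t} = (if t < 0 then 0 else 2 * measure (normal_law a) {..t} - 1)"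
proof -
  interpret prob_space "normal_law a" by (rule prob_space_normal_law[OF a])
  have "measure (normal_plus a) {..t} = measure (normal_law a) ((\<lambda>z. \<bar>z\<bar>) -` {..t})"
    unfolding normal_plus_def by (subst measure_distr) (auto simp: normal_law_def)
  also have "\<dots> = (if t < 0 then 0 else 2 * measure (normal_law a) {..t} - 1)"
  proof (cases "t < 0")
    case True
    then have "(\<lambda>z. \<bar>z\<bar>) -` {..t} = {}" by auto
    then show ?thesis using True by simp
  next
    case False
    have "(\<lambda>z. \<bar>z\<bar>) -` {..t} = UNIV - ({t<..} \<union> {..<-t})" by auto
    moreover have "measure (normal_law a) (UNIV - ({t<..} \<union> {..<-t})) = 1 - measure (normal_law a) ({t<..} \<union> {..<-t})"
      using prob_compl[of "{t<..} \<union> {..<-t}"] by simp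
    moreover have "measure (normal_law a) ({t<..} \<union> {..<-t}) = measure (normal_law a) {t<..} + measure (normal_law a) {..<-t}"
      using False by (intro finite_measure_Union) auto
    ultimately show ?thesis using False normal_law_tails(2,3)[OF a, of t] by simp
  qed
  finally show ?thesis .
qed

lemma prob_space_normal_pm:
  assumes "a > 0" shows "prob_space (normal_minus a)" "prob_space (normal_plus a)" "prob_space dirac0"
proof -
  show "prob_space (normal_minus a)" "prob_space (normal_plus a)"
    unfolding normal_minus_def normal_plus_def
    by (rule prob_space.prob_space_distr[OF prob_space_normal_law[OF assms]]; simp add: normal_law_def)+
  show "prob_space dirac0" unfolding dirac0_def by (rule prob_space_return) simp
qed

lemma sets_normal_pm [simp]: "sets (normal_minus a) = sets borel" "sets (normal_plus a) = sets borel" "sets dirac0 = sets borel"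
  by (simp_all add: normal_minus_def normal_plus_def dirac0_def)

lemma cdf_dirac0: "measure dirac0 {..t} = (if t < 0 then 0 else 1)" "measure dirac0 {0} = 1"
  by (simp_all add: dirac0_def measure_return indicator_def)

text \<open>For t < 0 only the first component contributes, with twice the normal distribution
  function. For t > 0 the first component and the atom count fully, and the second contributes 2 q2
  times the normal distribution function, minus q2.\<close>

lemma weak_conv_m_two_sided:
  assumes a: "a1 > 0" "a2 > 0" and q: "0 \<le> q1" "0 \<le> q2" "0 < q0"
    and q0: "q0 = 1 - q1 - q2"
    and neg: "\<And>t. t < 0 \<Longrightarrow> (\<lambda>n. cdf (\<mu> n) t) \<longlonglongrightarrow> 2 * q1 * measure (normal_law a1) {..t}"
    and pos: "\<And>t. t > 0 \<Longrightarrow> (\<lambda>n. cdf (\<mu> n) t) \<longlonglongrightarrow> 1 - 2 * q2 + 2 * q2 * measure (normal_law a2) {..t}"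
  shows "weak_conv_m \<mu> (mixture [(q1, normal_minus a1), (q2, normal_plus a2), (q0, dirac0)])"
proof -
  let ?ws = "[(q1, normal_minus a1), (q2, normal_plus a2), (q0, dirac0)]"
  have ws: "sets N = sets borel \<and> prob_space N \<and> w \<ge> 0" if "(w, N) \<in> set ?ws" for w N
    using that q a prob_space_normal_pm by auto
  have cdf: "cdf (mixture ?ws) t = q1 * measure (normal_minus a1) {..t} + q2 * measure (normal_plus a2) {..t} + q0 * measure dirac0 {..t}" for t
    unfolding cdf_def by (subst measure_mixture[OF ws]) auto
  show ?thesis
  proof (rule weak_conv_m_atom)
    show "finite_measure (mixture ?ws)" by (rule finite_measure_mixture[OF ws])
    have "measure (mixture ?ws) {0} = q1 * measure (normal_minus a1) {0} + q2 * measure (normal_plus a2) {0} + q0"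
      by (subst measure_mixture[OF ws]) (auto simp: cdf_dirac0)
    also have "\<dots> > 0" using q by (intro add_nonneg_pos add_nonneg_nonneg mult_nonneg_nonneg) auto
    finally show "measure (mixture ?ws) {0} > 0" .
    fix t :: real assume "t \<noteq> 0"
    then consider "t < 0" | "t > 0" by linarith
    then show "(\<lambda>n. cdf (\<mu> n) t) \<longlonglongrightarrow> cdf (mixture ?ws) t"
    proof cases
      case 1
      then show ?thesis using neg[of t] a by (simp add: cdf cdf_normal_minus cdf_normal_plus cdf_dirac0 mult_ac)
    next
      case 2
      have "q1 * 1 + q2 * (2 * measure (normal_law a2) {..t} - 1) + q0 * 1 = 1 - 2 * q2 + 2 * q2 * measure (normal_law a2) {..t}"
        unfolding q0 by (simp add: algebra_simps)
      then show ?thesis using pos[of t] a 2 by (simp add: cdf cdf_normal_minus cdf_normal_plus cdf_dirac0)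
    qed
  qed (rule sets_mixture)
qed

lemma weak_conv_m_symmetric:
  assumes a: "a > 0" and q: "0 \<le> q" "q < 1"
    and neg: "\<And>t. t < 0 \<Longrightarrow> (\<lambda>n. cdf (\<mu> n) t) \<longlonglongrightarrow> q * measure (normal_law a) {..t}"
    and pos: "\<And>t. t > 0 \<Longrightarrow> (\<lambda>n. cdf (\<mu> n) t) \<longlonglongrightarrow> 1 - q + q * measure (normal_law a) {..t}"
  shows "weak_conv_m \<mu> (mixture [(q, normal_law a), (1 - q, dirac0)])"
proof -
  let ?ws = "[(q, normal_law a), (1 - q, dirac0)]"
  have ws: "sets N = sets borel \<and> prob_space N \<and> w \<ge> 0" if "(w, N) \<in> set ?ws" for w N
    using that q a prob_space_normal_pm prob_space_normal_law by auto
  have cdf: "cdf (mixture ?ws) t = q * measure (normal_law a) {..t} + (1 - q) * measure dirac0 {..t}" for t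
    unfolding cdf_def by (subst measure_mixture[OF ws]) auto
  show ?thesis
  proof (rule weak_conv_m_atom)
    show "finite_measure (mixture ?ws)" by (rule finite_measure_mixture[OF ws])
    have "measure (mixture ?ws) {0} = q * measure (normal_law a) {0} + (1 - q)"
      by (subst measure_mixture[OF ws]) (auto simp: cdf_dirac0)
    also have "\<dots> > 0" using q by (intro add_nonneg_pos mult_nonneg_nonneg) auto
    finally show "measure (mixture ?ws) {0} > 0" .
    fix t :: real assume "t \<noteq> 0"
    then consider "t < 0" | "t > 0" by linarith
    then show "(\<lambda>n. cdf (\<mu> n) t) \<longlonglongrightarrow> cdf (mixture ?ws) t"
      by cases (use neg[of t] pos[of t] in \<open>auto simp: cdf cdf_dirac0 add.commute\<close>)
  qed (rule sets_mixture)
qed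

section \<open>Both sides of 0 and the resulting mixtures\<close>

context nondegenerate_maximizers
begin

lemma cdf_hhat_limit_Min:
  assumes "t < 0"
  shows "(\<lambda>N. cdf (hhat_law \<beta> h p N) t) \<longlonglongrightarrow> W (Min M) / (\<Sum>m\<in>M. W m) * measure (normal_law (- H2 \<beta> h p (Min M))) {..t}"
proof -
  have min: "Min M \<in> M" "\<And>m. m \<in> M \<Longrightarrow> Min M \<le> m" using finite_M nonempty_M by auto
  have "t * (m - Min M) < 0" if "m \<in> M" "m \<noteq> Min M" for m
    using that min(2)[of m] assms by (intro mult_neg_pos) auto
  then have "(\<lambda>N. cdf (hhat_law \<beta> h p N) t) \<longlonglongrightarrow>
     ((\<Sum>m\<in>{m \<in> M. m < Min M}. W m) + W (Min M) * measure (normal_law (- H2 \<beta> h p (Min M))) {..t}) / (\<Sum>m\<in>M. W m)"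
    using assms by (intro cdf_hhat_limit min(1)) auto
  moreover have e: "{m \<in> M. m < Min M} = {}" using min(2) by (auto simp: not_less)
  ultimately show ?thesis unfolding e by simp
qed

lemma cdf_hhat_limit_Max:
  assumes "t > 0"
  shows "(\<lambda>N. cdf (hhat_law \<beta> h p N) t) \<longlonglongrightarrow> 1 - W (Max M) / (\<Sum>m\<in>M. W m)
     + W (Max M) / (\<Sum>m\<in>M. W m) * measure (normal_law (- H2 \<beta> h p (Max M))) {..t}"
proof -
  have max: "Max M \<in> M" "\<And>m. m \<in> M \<Longrightarrow> m \<le> Max M" using finite_M nonempty_M by auto
  have "t * (m - Max M) < 0" if "m \<in> M" "m \<noteq> Max M" for m
    using that max(2)[of m] assms by (intro mult_pos_neg) auto
  moreover have "(\<Sum>m\<in>{m \<in> M. m < Max M}. W m) = (\<Sum>m\<in>M. W m) - W (Max M)"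
  proof -
    have "{m \<in> M. m < Max M} = M - {Max M}" using max(2) by (auto simp: order_less_le)
    then show ?thesis using sum_diff1[OF finite_M, of W "Max M"] max(1) by simp
  qed
  ultimately have "(\<lambda>N. cdf (hhat_law \<beta> h p N) t) \<longlonglongrightarrow>
      ((\<Sum>m\<in>M. W m) - W (Max M) + W (Max M) * measure (normal_law (- H2 \<beta> h p (Max M))) {..t}) / (\<Sum>m\<in>M. W m)"
    using cdf_hhat_limit[OF max(1), of t] assms by simp
  also have "((\<Sum>m\<in>M. W m) - W (Max M) + W (Max M) * measure (normal_law (- H2 \<beta> h p (Max M))) {..t}) / (\<Sum>m\<in>M. W m)
    = 1 - W (Max M) / (\<Sum>m\<in>M. W m) + W (Max M) / (\<Sum>m\<in>M. W m) * measure (normal_law (- H2 \<beta> h p (Max M))) {..t}"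
    using sum_W_pos by (simp add: add_divide_distrib diff_divide_distrib)
  finally show ?thesis .
qed

lemma neg_H2_pos: "m \<in> M \<Longrightarrow> - H2 \<beta> h p m > 0"
  using H2_neg by simp

lemma hhat_two_maximizers:
  assumes "card M = 2"
  defines "p1 \<equiv> W (Min M) / (\<Sum>m\<in>M. W m)"
  shows "weak_conv_m (hhat_law \<beta> h p)
    (mixture [(p1 / 2, normal_minus (- H2 \<beta> h p (Min M))), ((1 - p1) / 2, normal_plus (- H2 \<beta> h p (Max M))), (1 / 2, dirac0)])"
proof -
  obtain x y where xy: "M = {x, y}" "x < y"
    using assms(1) unfolding card_2_iff by (metis insert_commute linorder_less_linear)
  have mm: "Min M = x" "Max M = y" using xy by auto
  have sum: "(\<Sum>m\<in>M. W m) = W x + W y" using xy by simp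
  have pos: "W x > 0" "W y > 0" using xy by (auto intro: mweight_eq)
  have p1: "0 < p1" "p1 < 1" and p2: "1 - p1 = W (Max M) / (\<Sum>m\<in>M. W m)"
    unfolding p1_def sum mm using pos by (auto simp: field_simps)
  have half: "2 * ((1 - p1) / 2) = 1 - p1" by simp
  show ?thesis
  proof (rule weak_conv_m_two_sided)
    show "- H2 \<beta> h p (Min M) > 0" "- H2 \<beta> h p (Max M) > 0" using neg_H2_pos xy mm by auto
    show "(\<lambda>n. cdf (hhat_law \<beta> h p n) t) \<longlonglongrightarrow> 2 * (p1 / 2) * measure (normal_law (- H2 \<beta> h p (Min M))) {..t}" if "t < 0" for t
      using cdf_hhat_limit_Min[OF that] by (simp add: p1_def)
    show "(\<lambda>n. cdf (hhat_law \<beta> h p n) t) \<longlonglongrightarrow> 1 - 2 * ((1 - p1) / 2) + 2 * ((1 - p1) / 2) * measure (normal_law (- H2 \<beta> h p (Max M))) {..t}" if "t > 0" for t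
      using cdf_hhat_limit_Max[OF that] unfolding p2[symmetric] half .
  qed (use p1 in \<open>auto simp: field_simps\<close>)
qed

text \<open>The two extreme maximizers share weight and curvature, so the half-normal pieces on the
  two sides fit together to one full normal law. A maximizer at 0 only adds to the atom.\<close>

lemma hhat_symmetric_maximizers:
  assumes ms: "ms > 0" and M: "M = {- ms, ms} \<or> M = {- ms, 0, ms}" and p: "even p"
  defines "p1 \<equiv> W (- ms) / (\<Sum>m\<in>M. W m)"
  shows "weak_conv_m (hhat_law \<beta> h p) (mixture [(p1, normal_law (- H2 \<beta> h p ms)), (1 - p1, dirac0)])"
    and "H2 \<beta> h p (- ms) = H2 \<beta> h p ms" and "Min M = - ms" and "M = {- ms, ms} \<Longrightarrow> p1 = 1 / 2"
proof -
  have msM: "ms \<in> M" "- ms \<in> M" using M by auto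
  show H2: "H2 \<beta> h p (- ms) = H2 \<beta> h p ms"
    using H2_minus_even[OF p] global_maximizer_interior[OF msM(1)] by simp
  have Ws: "W (- ms) = W ms" by (simp add: mweight_def H2)
  show Min: "Min M = - ms" using M ms by (auto intro!: Min_eqI)
  have Max: "Max M = ms" using M ms by (auto intro!: Max_eqI)
  \<comment> \<open>Dropping a possible weight at 0 bounds \<open>p1\<close> by 1/2, which
    guarantees the atom.\<close>
  have "(\<Sum>m\<in>M. W m) \<ge> (\<Sum>m\<in>{- ms, ms}. W m)"
    using msM finite_M mweight_eq(2) by (intro sum_mono2) (auto simp: less_imp_le)
  then have "(\<Sum>m\<in>M. W m) \<ge> 2 * W ms" using ms Ws by simp
  then have p1: "0 \<le> p1" "p1 < 1"
    unfolding p1_def Ws using mweight_eq(2)[OF msM(1)] by (auto simp: divide_simps)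
  show "p1 = 1 / 2" if "M = {- ms, ms}"
    unfolding p1_def that using ms Ws mweight_eq(2)[OF msM(1)] by simp
  show "weak_conv_m (hhat_law \<beta> h p) (mixture [(p1, normal_law (- H2 \<beta> h p ms)), (1 - p1, dirac0)])"
  proof (rule weak_conv_m_symmetric)
    show "- H2 \<beta> h p ms > 0" by (rule neg_H2_pos[OF msM(1)])
    show "(\<lambda>n. cdf (hhat_law \<beta> h p n) t) \<longlonglongrightarrow> p1 * measure (normal_law (- H2 \<beta> h p ms)) {..t}" if "t < 0" for t
      using cdf_hhat_limit_Min[OF that] unfolding Min H2 p1_def .
    show "(\<lambda>n. cdf (hhat_law \<beta> h p n) t) \<longlonglongrightarrow> 1 - p1 + p1 * measure (normal_law (- H2 \<beta> h p ms)) {..t}" if "t > 0" for t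
      using cdf_hhat_limit_Max[OF that] unfolding Max p1_def Ws .
  qed (use p1 in auto)
qed

end

theorem mainTheorem5:
  fixes p :: nat and \<beta> h :: real
  defines "M \<equiv> global_maximizers \<beta> h p"
      and "m1 \<equiv> Min (global_maximizers \<beta> h p)"
      and "m2 \<equiv> Max (global_maximizers \<beta> h p)"
      and "p1 \<equiv> mweight \<beta> h p (Min (global_maximizers \<beta> h p)) /
                (\<Sum>m\<in>global_maximizers \<beta> h p. mweight \<beta> h p m)"
  assumes "p \<ge> 3" and "\<beta> \<ge> 0" and "p_critical p \<beta> h"
  shows
    "(odd p \<longrightarrow> card M = 2 \<and>
        weak_conv_m (hhat_law \<beta> h p)
          (mixture [(p1 / 2, normal_minus (- H2 \<beta> h p m1)),
                    ((1 - p1) / 2, normal_plus (- H2 \<beta> h p m2)),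
                    (1 / 2, dirac0)]))
   \<and> (even p \<and> h \<noteq> 0 \<longrightarrow> card M = 2 \<and>
        weak_conv_m (hhat_law \<beta> h p)
          (mixture [(p1 / 2, normal_minus (- H2 \<beta> h p m1)),
                    ((1 - p1) / 2, normal_plus (- H2 \<beta> h p m2)),
                    (1 / 2, dirac0)]))
   \<and> (even p \<and> h = 0 \<and> \<beta> > beta_tilde p \<longrightarrow>
        (\<exists>ms>0. M = {-ms, ms} \<and> card M = 2 \<and>
          weak_conv_m (hhat_law \<beta> h p)
            (mixture [(1 / 2, normal_law (- H2 \<beta> h p ms)), (1 / 2, dirac0)])))
   \<and> (even p \<and> h = 0 \<and> \<beta> = beta_tilde p \<longrightarrow>
        (\<exists>ms>0. M = {-ms, 0, ms} \<and> card M = 3 \<and>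
          weak_conv_m (hhat_law \<beta> h p)
            (mixture [(p1, normal_law (- H2 \<beta> h p m1)), (1 - p1, dirac0)])))"
proof -
  have two: "card M = 2 \<and> weak_conv_m (hhat_law \<beta> h p)
          (mixture [(p1 / 2, normal_minus (- H2 \<beta> h p m1)),
                    ((1 - p1) / 2, normal_plus (- H2 \<beta> h p m2)), (1 / 2, dirac0)])"
    if "card (global_maximizers \<beta> h p) = 2" "\<forall>m\<in>global_maximizers \<beta> h p. H2 \<beta> h p m < 0"
  proof -
    interpret nondegenerate_maximizers \<beta> h p
      by unfold_locales (use that in \<open>auto intro: card_ge_0_finite\<close>)
    show ?thesis using hhat_two_maximizers[OF that(1)] that(1) by (simp only: M_def m1_def m2_def p1_def simp_thms)
  qed
  have sym: "\<exists>ms>0. M \<subseteq> {- ms, 0, ms} \<and> ms \<in> M \<and> - ms \<in> M \<and> (\<forall>m\<in>global_maximizers \<beta> h p. H2 \<beta> h p m < 0)"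
    if "even p" "h = 0"
    using maximizers_even_no_field[of p \<beta>] assms that unfolding M_def by metis
  have b: "\<exists>ms>0. M = {-ms, ms} \<and> card M = 2 \<and>
          weak_conv_m (hhat_law \<beta> h p) (mixture [(1 / 2, normal_law (- H2 \<beta> h p ms)), (1 / 2, dirac0)])"
    if h: "even p" "h = 0" "\<beta> > beta_tilde p"
  proof -
    obtain ms where ms: "ms > 0" "M \<subseteq> {- ms, 0, ms}" "ms \<in> M" "- ms \<in> M" "\<forall>m\<in>global_maximizers \<beta> h p. H2 \<beta> h p m < 0"
      using sym[OF h(1,2)] by blast
    have "0 \<notin> M" using zero_maximizer_beta_tilde(1)[of p \<beta>] assms h by (simp add: M_def)
    then have M: "M = {- ms, ms}" using ms by blast
    interpret nondegenerate_maximizers \<beta> h p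
      by unfold_locales (use ms M in \<open>auto simp: M_def\<close>)
    note * = hhat_symmetric_maximizers[OF ms(1) disjI1[OF M[unfolded M_def]] h(1)]
    have "weak_conv_m (hhat_law \<beta> h p) (mixture [(1 / 2, normal_law (- H2 \<beta> h p ms)), (1 / 2, dirac0)])"
      using *(1) unfolding *(4)[OF M[unfolded M_def]] by simp
    then show ?thesis using ms(1) M by (intro exI[of _ ms]) auto
  qed
  have c: "\<exists>ms>0. M = {-ms, 0, ms} \<and> card M = 3 \<and>
          weak_conv_m (hhat_law \<beta> h p) (mixture [(p1, normal_law (- H2 \<beta> h p m1)), (1 - p1, dirac0)])"
    if h: "even p" "h = 0" "\<beta> = beta_tilde p"
  proof -
    obtain ms where ms: "ms > 0" "M \<subseteq> {- ms, 0, ms}" "ms \<in> M" "- ms \<in> M" "\<forall>m\<in>global_maximizers \<beta> h p. H2 \<beta> h p m < 0"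
      using sym[OF h(1,2)] by blast
    have "0 \<in> M" using zero_maximizer_beta_tilde(2)[of p \<beta>] assms h by (simp add: M_def)
    then have M: "M = {- ms, 0, ms}" using ms by blast
    interpret nondegenerate_maximizers \<beta> h p
      by unfold_locales (use ms M in \<open>auto simp: M_def\<close>)
    note * = hhat_symmetric_maximizers[OF ms(1) disjI2[OF M[unfolded M_def]] h(1)]
    have "weak_conv_m (hhat_law \<beta> h p) (mixture [(p1, normal_law (- H2 \<beta> h p m1)), (1 - p1, dirac0)])"
      using *(1) unfolding p1_def m1_def *(3) *(2) .
    then show ?thesis using ms(1) M by (intro exI[of _ ms]) auto
  qed
  show ?thesis
    using two maximizers_odd[of p \<beta> h] maximizers_even_field[of p \<beta> h] b c assms(5-7) by blast
qed

end
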